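(* Let $\alpha\in\mathbb{R}$ and let $\kappa$ be a convolution quadrature for $I_s^\alpha$, with weights $\kappa_j=e^{-j\sigma h}\omega_j$. Then $\kappa$ is stable and consistent of order $p$ if and only if $\kappa$ is convergent of order $p$.
   Context: $\sigma$ is a constant. For $\alpha>0$, $I_s^\alpha f(x)=\frac{1}{\Gamma(\alpha)}\int_0^x(x-\tau)^{\alpha-1}e^{-\sigma(x-\tau)}f(\tau)\,d\tau$; $I_s^0f=f$; for $\alpha<0$, $I_s^\alpha f=D_s^{-\alpha}f$, where for $\mu>0$, $D_s^\mu f=D_s^m[I_s^{m-\mu}f]$ with $m$ the smallest integer exceeding $\mu$ and $D_s=\frac{d}{dx}+\sigma$. On powers, $I_s^\alpha[e^{-\sigma t}t^{\beta-1}](x)=e^{-\sigma x}\frac{\Gamma(\beta)}{\Gamma(\alpha+\beta)}x^{\alpha+\beta-1}$ for complex $\beta\ne0,-1,-2,\dots$. Let $\omega=(\omega_n)_0^\infty$ be a sequence (convolution quadrature weights for the case $\sigma=0$) with generating power series $\omega(\zeta)=\sum_{n\ge0}\omega_n\zeta^n$. For a step size $h>0$ and grid points $x=nh$ in a bounded interval, put $\kappa_j=e^{-j\sigma h}\omega_j$ and $\kappa(\zeta)=\sum_{n\ge0}\kappa_n\zeta^n=\omega(\zeta/e^{\sigma h})$. The generating function is of the form $\omega(\zeta)=(1-\zeta)^{-\alpha}\widetilde\omega(\zeta)$, with $\widetilde\omega(\zeta)=c_0+c_1(1-\zeta)+\dots+c_{N-1}(1-\zeta)^{N-1}+(1-\zeta)^N\widetilde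 r(\zeta)$ the Taylor expansion of $\widetilde\omega$ at $\zeta=1$. Put $\Omega_{s,h}^\alpha f(x)=h^\alpha\sum_{j=0}^n\kappa_{n-j}f(jh)$ for $x=nh$ (the $j=0$ term is dropped when $f$ is undefined at $0$), and $E_{s,h}^\alpha=\Omega_{s,h}^\alpha-I_s^\alpha$. Definitions. $\kappa$ is stable (for $I_s^\alpha$) if $\kappa_n=\mathcal{O}(n^{\alpha-1})$. $\kappa$ is consistent of order $p$ if $h^\alpha\kappa(e^{\sigma h}e^{-h})=1+\mathcal{O}(h^p)$ as $h\to0$. $\kappa$ is convergent of order $p$ if $(E_{s,h}^\alpha[e^{-\sigma t}t^{\beta-1}])(1)=\mathcal{O}(h^\beta)+\mathcal{O}(h^p)$ as $h\to 0$ ($nh=1$) for all $\beta\in\mathbb{C}$, $\beta\neq0,-1,-2,\dots$. *)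

theory Defs
  imports "HOL-Complex_Analysis.Complex_Analysis"
begin

section \<open>Fractional substantial calculus\<close>

definition D_sub :: "complex \<Rightarrow> (real \<Rightarrow> complex) \<Rightarrow> real \<Rightarrow> complex" where
  "D_sub \<sigma> f x = vector_derivative f (at x) + \<sigma> * f x"

definition I_sub_pos :: "real \<Rightarrow> complex \<Rightarrow> (real \<Rightarrow> complex) \<Rightarrow> real \<Rightarrow> complex" where
  "I_sub_pos \<alpha> \<sigma> f x = complex_of_real (1 / Gamma \<alpha>) *
     integral {0..x} (\<lambda>\<tau>. complex_of_real ((x - \<tau>) powr (\<alpha> - 1))
                            * exp (- (\<sigma> * complex_of_real (x - \<tau>))) * f \<tau>)"

definition D_sub_frac :: "real \<Rightarrow> complex \<Rightarrow> (real \<Rightarrow> complex) \<Rightarrow> real \<Rightarrow> complex" where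
  "D_sub_frac \<mu> \<sigma> f = (let m = nat (\<lfloor>\<mu>\<rfloor> + 1)
     in (D_sub \<sigma> ^^ m) (I_sub_pos (real m - \<mu>) \<sigma> f))"

definition I_sub :: "real \<Rightarrow> complex \<Rightarrow> (real \<Rightarrow> complex) \<Rightarrow> real \<Rightarrow> complex" where
  "I_sub \<alpha> \<sigma> f = (if \<alpha> > 0 then I_sub_pos \<alpha> \<sigma> f
                      else if \<alpha> = 0 then f
                      else D_sub_frac (- \<alpha>) \<sigma> f)"

text \<open>
  The function \<open>t \<mapsto> exp (- \<sigma> t) t ^ (\<beta> - 1)\<close> on \<open>t \<ge> 0\<close>.  At \<open>t = 0\<close> the power is \<open>1\<close> for
  \<open>\<beta> = 1\<close> (where \<open>powr\<close> would give \<open>0\<close>) and \<open>0\<close> for \<open>Re \<beta> > 1\<close>; for all other \<open>\<beta>\<close> it is undefined,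
  and the value \<open>0\<close> given to it here has the effect of dropping the term \<open>j = 0\<close> from the
  quadrature sum below.
\<close>
definition sub_pow :: "complex \<Rightarrow> complex \<Rightarrow> real \<Rightarrow> complex" where
  "sub_pow \<sigma> \<beta> t = exp (- (\<sigma> * complex_of_real t)) *
     (if t = 0 \<and> \<beta> = 1 then 1 else complex_of_real t powr (\<beta> - 1))"

text \<open>
  The fractional integral of \<open>sub_pow \<sigma> \<beta>\<close>.  For \<open>Re \<beta> \<le> 0\<close> the defining integral
  diverges, and the usual analytic continuation in \<open>\<beta>\<close> of its value is taken; \<open>rGamma\<close> is the
  entire function \<open>1 / \<Gamma>\<close>, which is \<open>0\<close> at the poles of \<open>\<Gamma>\<close>.
\<close>
definition I_sub_pow :: "real \<Rightarrow> complex \<Rightarrow> complex \<Rightarrow> real \<Rightarrow> complex" where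
  "I_sub_pow \<alpha> \<sigma> \<beta> x =
     (if Re \<beta> > 0 then I_sub \<alpha> \<sigma> (sub_pow \<sigma> \<beta>) x
      else exp (- (\<sigma> * complex_of_real x)) * Gamma \<beta> * rGamma (complex_of_real \<alpha> + \<beta>)
             * complex_of_real x powr (complex_of_real \<alpha> + \<beta> - 1))"

section \<open>Convolution quadratures\<close>

definition kappa :: "complex \<Rightarrow> real \<Rightarrow> (nat \<Rightarrow> complex) \<Rightarrow> nat \<Rightarrow> complex" where
  "kappa \<sigma> h \<omega> j = exp (- (of_nat j * \<sigma> * complex_of_real h)) * \<omega> j"

text \<open>
  The generating function \<open>\<omega>(\<zeta>) = (1 - \<zeta>) powr (- \<alpha>) * w(\<zeta>)\<close>, with \<open>w\<close> having a Taylor expansion at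
  \<open>1\<close>.  The identity is asked for at the points of the unit disc where the power series
  converges, so that no lower bound on its radius of convergence is presupposed; on the unit
  disc \<open>Re (1 - \<zeta>) > 0\<close>, so \<open>powr\<close> is the holomorphic branch with value \<open>1\<close> at \<open>\<zeta> = 0\<close>.
\<close>
definition generating_form :: "real \<Rightarrow> (nat \<Rightarrow> complex) \<Rightarrow> (complex \<Rightarrow> complex) \<Rightarrow> bool" where
  "generating_form \<alpha> \<omega> w \<longleftrightarrow> w analytic_on {1} \<and>
     (\<forall>\<zeta>. norm \<zeta> < 1 \<and> ereal (norm \<zeta>) < fps_conv_radius (Abs_fps \<omega>) \<longrightarrow>
        eval_fps (Abs_fps \<omega>) \<zeta> = (1 - \<zeta>) powr (- complex_of_real \<alpha>) * w \<zeta>)"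

text \<open>The value at the grid point \<open>x = n h\<close>.\<close>
definition Omega_sub ::
  "real \<Rightarrow> complex \<Rightarrow> (nat \<Rightarrow> complex) \<Rightarrow> real \<Rightarrow> (real \<Rightarrow> complex) \<Rightarrow> nat \<Rightarrow> complex" where
  "Omega_sub \<alpha> \<sigma> \<omega> h f n =
     complex_of_real (h powr \<alpha>) * (\<Sum>j\<le>n. kappa \<sigma> h \<omega> (n - j) * f (real j * h))"

definition E_sub_pow ::
  "real \<Rightarrow> complex \<Rightarrow> (nat \<Rightarrow> complex) \<Rightarrow> real \<Rightarrow> complex \<Rightarrow> nat \<Rightarrow> complex" where
  "E_sub_pow \<alpha> \<sigma> \<omega> h \<beta> n =
     Omega_sub \<alpha> \<sigma> \<omega> h (sub_pow \<sigma> \<beta>) n - I_sub_pow \<alpha> \<sigma> \<beta> (real n * h)"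

text \<open>
  The weights \<open>kappa \<sigma> h \<omega> n\<close> depend on the step size; the bound is uniform over all
  grid points \<open>n h\<close> in the bounded interval \<open>[0, T]\<close>.
\<close>
definition stable_quad :: "real \<Rightarrow> real \<Rightarrow> complex \<Rightarrow> (nat \<Rightarrow> complex) \<Rightarrow> bool" where
  "stable_quad T \<alpha> \<sigma> \<omega> \<longleftrightarrow>
     (\<exists>C. \<forall>h>0. \<forall>n\<ge>1. real n * h \<le> T \<longrightarrow>
        norm (kappa \<sigma> h \<omega> n) \<le> C * real n powr (\<alpha> - 1))"

text \<open>The first conjunct says that the power series converges where it is evaluated.\<close>
definition consistent_quad :: "real \<Rightarrow> real \<Rightarrow> complex \<Rightarrow> (nat \<Rightarrow> complex) \<Rightarrow> bool" where
  "consistent_quad p \<alpha> \<sigma> \<omega> \<longleftrightarrow>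
     (\<forall>\<^sub>F h in at_right 0. ereal (norm (exp (\<sigma> * complex_of_real h) * exp (- complex_of_real h)))
        < fps_conv_radius (Abs_fps (kappa \<sigma> h \<omega>))) \<and>
     (\<lambda>h. norm (complex_of_real (h powr \<alpha>) *
        eval_fps (Abs_fps (kappa \<sigma> h \<omega>))
          (exp (\<sigma> * complex_of_real h) * exp (- complex_of_real h)) - 1))
       \<in> O[at_right 0](\<lambda>h. h powr p)"

text \<open>
  Since \<open>n h = 1\<close>, the limit \<open>h \<rightarrow> 0\<close> is taken along \<open>h = 1 / n\<close>; the term
  \<open>O(h ^ \<beta>)\<close> means \<open>O(\<bar>h ^ \<beta>\<bar>) = O(h ^ Re \<beta>)\<close>, with a constant that may depend on \<open>\<beta>\<close>.
\<close>
definition convergent_quad :: "real \<Rightarrow> real \<Rightarrow> complex \<Rightarrow> (nat \<Rightarrow> complex) \<Rightarrow> bool" where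
  "convergent_quad p \<alpha> \<sigma> \<omega> \<longleftrightarrow>
     (\<forall>\<beta>. \<beta> \<notin> \<int>\<^sub>\<le>\<^sub>0 \<longrightarrow>
        (\<lambda>n. norm (E_sub_pow \<alpha> \<sigma> \<omega> (1 / real n) \<beta> n))
          \<in> O(\<lambda>n. norm (complex_of_real (1 / real n) powr \<beta>) + (1 / real n) powr p))"

end

theory Submission
  imports Defs "HOL-Real_Asymp.Real_Asymp"
begin

text \<open>
  The factor \<open>exp (- \<sigma> x)\<close> cancels, so everything takes place for \<open>\<sigma> = 0\<close>.  If the error is small for
  one very negative \<open>\<beta>\<close>, the weights can be recovered from their convolution with \<open>n powr (\<beta> - 1)\<close>,
  whose first term dominates; this gives stability.  Conversely, stability and analyticity of \<open>w\<close> at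
  1 give, by a Fatou--Riesz argument, \<open>w (\<zeta>) = c\<^sub>0 + c\<^sub>1 (1 - \<zeta>) + \<dots> + (1 - \<zeta>) ^ I * r (\<zeta>)\<close> where the
  coefficients of \<open>r\<close> are still \<open>O(n powr (\<alpha> - 1))\<close>.  Expanding \<open>n powr (\<beta> - 1)\<close> in coefficients of
  powers of \<open>1 - \<zeta>\<close> as well, the convolution of the weights with it has, up to \<open>O(n powr (\<alpha> - 1))\<close>, the
  expansion \<open>\<Gamma>(\<beta>) * (\<Sum>l. g\<^sub>l * n powr (\<alpha> + \<beta> - l - 1) / \<Gamma>(\<alpha> + \<beta> - l))\<close>, where the \<open>g\<^sub>l\<close> are the Taylor
  coefficients of \<open>h powr \<alpha> * \<omega> (exp (- h))\<close>.  Both consistency and convergence of order \<open>p\<close> then say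
  that \<open>g\<^sub>0 = 1\<close> and \<open>g\<^sub>l = 0\<close> for \<open>0 < l < p\<close>.
\<close>

section \<open>Polynomially bounded sequences\<close>

text \<open>Nothing is known about \<open>w\<close> on the unit circle away from 1, so no contour
  can be moved across the circle to estimate the coefficients of \<open>r\<close>. Dividing a power
  series by 1 - \<zeta> replaces its coefficients by their partial sums, which in general costs a
  power of n for every factor; the Fatou--Riesz argument, local at 1, avoids this loss.

  The precision O(n powr (\<alpha> - 1)) is exactly what is required: as n h = 1, multiplying the
  error by n powr (\<alpha> + \<beta> - 1) turns the admissible O(h powr \<beta>) into O(n powr
  (\<alpha> - 1)), and O(h powr p) into O(n powr (\<alpha> + Re \<beta> - 1 - p)). The term of index
  l has size n powr (\<alpha> + Re \<beta> - l - 1), so only l < p can do harm. It is visible only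
  if 1 / Gamma(\<alpha> + \<beta> - l) does not vanish, which is why \<beta> is tested with \<alpha>
  + \<beta> half an odd integer. Expansions are handled as formal power series in h, so that
  matching their coefficients becomes an identity between series.\<close>

definition poly_bounded :: "real \<Rightarrow> (nat \<Rightarrow> complex) \<Rightarrow> bool" where
  "poly_bounded q a \<longleftrightarrow> (\<exists>C. \<forall>n. norm (a n) \<le> C * real (Suc n) powr q)"

lemma poly_boundedI: "(\<And>n. norm (a n) \<le> C * real (Suc n) powr q) \<Longrightarrow> poly_bounded q a"
  unfolding poly_bounded_def by blast

lemma poly_boundedE:
  assumes "poly_bounded q a"
  obtains C where "C > 0" "\<And>n. norm (a n) \<le> C * real (Suc n) powr q"
proof -
  from assms obtain C where C: "\<And>n. norm (a n) \<le> C * real (Suc n) powr q"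
    unfolding poly_bounded_def by blast
  have "norm (a n) \<le> max C 1 * real (Suc n) powr q" for n
    by (rule order_trans[OF C]) (intro mult_right_mono, auto)
  then show ?thesis using that[of "max C 1"] by auto
qed

lemma powr_le_powr_mult_powr_abs:
  fixes x y z q :: real
  assumes "0 < x" "0 < y" "1 \<le> z" "x \<le> y * z" "y \<le> x * z"
  shows "x powr q \<le> y powr q * z powr \<bar>q\<bar>"
proof (cases "q \<ge> 0")
  case True
  have "x powr q \<le> (y * z) powr q" using assms True by (intro powr_mono2) auto
  then show ?thesis using assms True by (simp add: powr_mult)
next
  case False
  have "y powr (-q) \<le> (x * z) powr (-q)" using assms False by (intro powr_mono2) auto
  then have "y powr (-q) \<le> x powr (-q) * z powr (-q)" using assms by (simp add: powr_mult)
  then show ?thesis using assms False by (simp add: powr_minus field_simps)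
qed

text \<open>A Peetre-type inequality: a shift of the index by k costs a factor depending on k alone,
  with |q| serving both signs of q.\<close>

lemma Suc_add_powr_le:
  "real (Suc (n + k)) powr q \<le> real (Suc n) powr q * real (Suc k) powr \<bar>q\<bar>"
  by (rule powr_le_powr_mult_powr_abs) (auto simp: algebra_simps)

lemma Suc_diff_powr_le:
  assumes "k \<le> n"
  shows "real (Suc (n - k)) powr q \<le> real (Suc n) powr q * real (Suc k) powr \<bar>q\<bar>"
proof (rule powr_le_powr_mult_powr_abs)
  obtain d where "n = k + d" using assms le_iff_add by blast
  then show "real (Suc n) \<le> real (Suc (n - k)) * real (Suc k)" by (simp add: algebra_simps)
  have "real (Suc (n - k)) \<le> real (Suc n)" by simp
  also have "\<dots> \<le> real (Suc n) * real (Suc k)" by simp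
  finally show "real (Suc (n - k)) \<le> real (Suc n) * real (Suc k)" .
qed auto

lemma poly_bounded_mono:
  assumes "poly_bounded q a" "q \<le> r"
  shows "poly_bounded r a"
proof -
  from assms(1) obtain C where C: "C > 0" "\<And>n. norm (a n) \<le> C * real (Suc n) powr q"
    using poly_boundedE by blast
  have "norm (a n) \<le> C * real (Suc n) powr r" for n
    by (rule order_trans[OF C(2)]) (use C(1) assms(2) in \<open>intro mult_left_mono powr_mono, auto\<close>)
  then show ?thesis by (rule poly_boundedI)
qed

lemma poly_bounded_add:
  assumes "poly_bounded q a" "poly_bounded q b"
  shows "poly_bounded q (\<lambda>n. a n + b n)"
proof -
  from assms(1) obtain C where C: "C > 0" "\<And>n. norm (a n) \<le> C * real (Suc n) powr q"
    using poly_boundedE by blast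
  from assms(2) obtain D where D: "D > 0" "\<And>n. norm (b n) \<le> D * real (Suc n) powr q"
    using poly_boundedE by blast
  have "norm (a n + b n) \<le> (C + D) * real (Suc n) powr q" for n
    using norm_triangle_ineq[of "a n" "b n"] C(2)[of n] D(2)[of n]
    unfolding distrib_right by linarith
  then show ?thesis by (rule poly_boundedI)
qed

lemma poly_bounded_cmult:
  assumes "poly_bounded q a"
  shows "poly_bounded q (\<lambda>n. c * a n)"
proof -
  from assms(1) obtain C where C: "C > 0" "\<And>n. norm (a n) \<le> C * real (Suc n) powr q"
    using poly_boundedE by blast
  have "norm (c * a n) \<le> (norm c * C) * real (Suc n) powr q" for n
    using mult_left_mono[OF C(2)[of n], of "norm c"] by (simp add: norm_mult mult.assoc)
  then show ?thesis by (rule poly_boundedI)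
qed

lemma poly_bounded_zero: "poly_bounded q (\<lambda>n. 0)"
  by (rule poly_boundedI[of _ 0]) simp

lemma poly_bounded_sum:
  assumes "\<And>i. i \<in> I \<Longrightarrow> poly_bounded q (a i)"
  shows "poly_bounded q (\<lambda>n. \<Sum>i\<in>I. a i n)"
  using assms
  by (induction I rule: infinite_finite_induct)
     (auto intro: poly_bounded_add simp: poly_bounded_zero)

lemma poly_bounded_diff:
  assumes "poly_bounded q a" "poly_bounded q b"
  shows "poly_bounded q (\<lambda>n. a n - b n)"
  using poly_bounded_add[OF assms(1) poly_bounded_cmult[OF assms(2), of "-1"]] by simp

lemma poly_bounded_iff_bigo: "poly_bounded q a \<longleftrightarrow> (\<lambda>n. norm (a n)) \<in> O(\<lambda>n. real n powr q)"
proof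
  assume "poly_bounded q a"
  then obtain C where C: "C > 0" "\<And>n. norm (a n) \<le> C * real (Suc n) powr q"
    using poly_boundedE by blast
  have "(\<lambda>n. norm (a n)) \<in> O(\<lambda>n. real (Suc n) powr q)"
    by (rule bigoI[of _ C]) (use C(2) in auto)
  also have "(\<lambda>n. real (Suc n) powr q) \<in> O(\<lambda>n. real n powr q)"
  proof (rule bigoI[of _ "2 powr \<bar>q\<bar>"])
    show "eventually (\<lambda>n. norm (real (Suc n) powr q) \<le> 2 powr \<bar>q\<bar> * norm (real n powr q)) at_top"
      using eventually_gt_at_top[of 0]
    proof eventually_elim
      case (elim n)
      then have "real (Suc n) powr q \<le> real n powr q * 2 powr \<bar>q\<bar>"
        by (intro powr_le_powr_mult_powr_abs) auto
      then show ?case by (simp add: mult.commute)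
    qed
  qed
  finally show "(\<lambda>n. norm (a n)) \<in> O(\<lambda>n. real n powr q)" .
next
  assume "(\<lambda>n. norm (a n)) \<in> O(\<lambda>n. real n powr q)"
  also have "(\<lambda>n. real n powr q) \<in> O(\<lambda>n. real (Suc n) powr q)"
  proof (rule bigoI[of _ "2 powr \<bar>q\<bar>"])
    show "eventually (\<lambda>n. norm (real n powr q) \<le> 2 powr \<bar>q\<bar> * norm (real (Suc n) powr q)) at_top"
      using eventually_gt_at_top[of 0]
    proof eventually_elim
      case (elim n)
      then have "real n powr q \<le> real (Suc n) powr q * 2 powr \<bar>q\<bar>"
        by (intro powr_le_powr_mult_powr_abs) auto
      then show ?case by (simp add: mult.commute)
    qed
  qed
  finally obtain c N where c: "\<And>n. n \<ge> N \<Longrightarrow> norm (a n) \<le> c * real (Suc n) powr q"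
    by (elim landau_o.bigE) (auto simp: eventually_at_top_linorder)
  define C where "C = max c (Max (insert 0 ((\<lambda>n. norm (a n) / real (Suc n) powr q) ` {..<N})))"
  have "norm (a n) \<le> C * real (Suc n) powr q" for n
  proof (cases "n < N")
    case True
    then have "norm (a n) / real (Suc n) powr q \<le> C"
      unfolding C_def by (intro max.coboundedI2 Max_ge) auto
    then show ?thesis by (simp add: field_simps)
  next
    case False
    then show ?thesis
      by (intro order_trans[OF c] mult_right_mono) (auto simp: C_def)
  qed
  then show "poly_bounded q a" by (rule poly_boundedI)
qed

text \<open>Peetre's inequality frees the bound on a from i at the cost of (i + 1) powr |q|. The
  decay demanded of b absorbs this factor and leaves (i + 1) powr (-2), which is summable.\<close>

lemma poly_bounded_convolution:
  assumes "poly_bounded q a" "poly_bounded (- \<bar>q\<bar> - 2) b"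
  shows "poly_bounded q (\<lambda>n. \<Sum>i\<le>n. a (n - i) * b i)"
proof -
  from assms(1) obtain C where C: "C > 0" "\<And>n. norm (a n) \<le> C * real (Suc n) powr q"
    using poly_boundedE by blast
  from assms(2) obtain D where D: "D > 0" "\<And>n. norm (b n) \<le> D * real (Suc n) powr (- \<bar>q\<bar> - 2)"
    using poly_boundedE by blast
  have summ: "summable (\<lambda>i. real (Suc i) powr (-2))"
    by (subst summable_Suc_iff[of "\<lambda>i. real i powr (-2)"]) (simp add: summable_real_powr_iff)
  define S where "S = (\<Sum>i. real (Suc i) powr (-2))"
  have "norm (\<Sum>i\<le>n. a (n - i) * b i) \<le> (C * D * S) * real (Suc n) powr q" for n
  proof -
    have summand: "norm (a (n - i) * b i) \<le> C * D * real (Suc n) powr q * real (Suc i) powr (-2)"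
      if "i \<le> n" for i
    proof -
      have "norm (a (n - i) * b i)
        \<le> (C * real (Suc (n - i)) powr q) * (D * real (Suc i) powr (- \<bar>q\<bar> - 2))"
        unfolding norm_mult using C D by (intro mult_mono) auto
      also have "\<dots> \<le> (C * (real (Suc n) powr q * real (Suc i) powr \<bar>q\<bar>))
          * (D * real (Suc i) powr (- \<bar>q\<bar> - 2))"
        using C(1) D(1) Suc_diff_powr_le[OF that, of q] by (intro mult_right_mono mult_left_mono) auto
      also have "\<dots> = C * D * real (Suc n) powr q * (real (Suc i) powr (\<bar>q\<bar> + (- \<bar>q\<bar> - 2)))"
        by (subst powr_add) (simp add: mult_ac)
      finally show ?thesis by simp
    qed
    have "norm (\<Sum>i\<le>n. a (n - i) * b i)
      \<le> (\<Sum>i\<le>n. C * D * real (Suc n) powr q * real (Suc i) powr (-2))"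
      using summand by (intro sum_norm_le) auto
    also have "\<dots> = C * D * real (Suc n) powr q * (\<Sum>i\<le>n. real (Suc i) powr (-2))"
      by (simp add: sum_distrib_left)
    also have "\<dots> \<le> C * D * real (Suc n) powr q * S"
      unfolding S_def using C(1) D(1) by (intro mult_left_mono sum_le_suminf summ) auto
    finally show ?thesis by (simp add: mult_ac)
  qed
  then show ?thesis by (rule poly_boundedI)
qed

section \<open>Power series with polynomially bounded coefficients\<close>

abbreviation coeff_bounded :: "real \<Rightarrow> complex fps \<Rightarrow> bool" where
  "coeff_bounded q A \<equiv> poly_bounded q (fps_nth A)"

lemma coeff_bounded_add:
  assumes "coeff_bounded q A" "coeff_bounded q B"
  shows "coeff_bounded q (A + B)"
proof -
  have "fps_nth (A + B) = (\<lambda>n. fps_nth A n + fps_nth B n)" by (rule ext) simp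
  then show ?thesis using poly_bounded_add[OF assms] by metis
qed

lemma coeff_bounded_diff:
  assumes "coeff_bounded q A" "coeff_bounded q B"
  shows "coeff_bounded q (A - B)"
proof -
  have "fps_nth (A - B) = (\<lambda>n. fps_nth A n - fps_nth B n)" by (rule ext) simp
  then show ?thesis using poly_bounded_diff[OF assms] by metis
qed

lemma coeff_bounded_const_mult:
  assumes "coeff_bounded q A"
  shows "coeff_bounded q (fps_const c * A)"
proof -
  have "fps_nth (fps_const c * A) = (\<lambda>n. c * fps_nth A n)" by (rule ext) simp
  then show ?thesis using poly_bounded_cmult[OF assms, of c] by metis
qed

lemma coeff_bounded_sum:
  assumes "\<And>i. i \<in> I \<Longrightarrow> coeff_bounded q (A i)"
  shows "coeff_bounded q (\<Sum>i\<in>I. A i)"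
proof -
  have "fps_nth (\<Sum>i\<in>I. A i) = (\<lambda>n. \<Sum>i\<in>I. fps_nth (A i) n)" by (rule ext) (simp add: fps_sum_nth)
  then show ?thesis using poly_bounded_sum[of I q "\<lambda>i. fps_nth (A i)", OF assms] by metis
qed

lemma coeff_bounded_mult:
  assumes "coeff_bounded q A" "coeff_bounded (- \<bar>q\<bar> - 2) B"
  shows "coeff_bounded q (A * B)"
proof -
  have "fps_nth (A * B) = (\<lambda>n. \<Sum>i\<le>n. fps_nth A (n - i) * fps_nth B i)"
    by (subst mult.commute, rule ext)
       (simp add: fps_mult_nth atLeast0AtMost mult.commute[of "fps_nth A _"])
  then show ?thesis using poly_bounded_convolution[OF assms] by metis
qed

lemma coeff_bounded_finite_support:
  assumes "\<And>n. n > N \<Longrightarrow> fps_nth A n = 0"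
  shows "coeff_bounded q A"
  unfolding poly_bounded_iff_bigo
  by (rule bigoI[of _ 0], rule eventually_mono[OF eventually_gt_at_top[of N]]) (simp add: assms)

lemma fps_conv_radius_ge_1_if_coeff_bounded:
  assumes "coeff_bounded q A"
  shows "fps_conv_radius A \<ge> 1"
proof -
  from assms obtain C where C: "C > 0" "\<And>n. norm (fps_nth A n) \<le> C * real (Suc n) powr q"
    using poly_boundedE by blast
  show ?thesis unfolding fps_conv_radius_def
  proof (rule conv_radius_geI_ex')
    fix r :: real assume r: "0 < r" "ereal r < 1"
    then have "r < 1" by simp
    have "(\<lambda>n. real (Suc n) powr q * r ^ n) \<in> O(\<lambda>n. ((1 + r) / 2) ^ n)"
      using \<open>0 < r\<close> \<open>r < 1\<close> by real_asymp
    moreover have "summable (\<lambda>n. norm (((1 + r) / 2) ^ n))"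
      using \<open>0 < r\<close> \<open>r < 1\<close> by (simp add: norm_power summable_geometric)
    ultimately have "summable (\<lambda>n. C * (real (Suc n) powr q * r ^ n))"
      using summable_comparison_test_bigo summable_mult by blast
    then show "summable (\<lambda>n. fps_nth A n * of_real r ^ n)"
    proof (rule summable_comparison_test'[of _ 0])
      show "norm (fps_nth A n * of_real r ^ n) \<le> C * (real (Suc n) powr q * r ^ n)" for n
        using mult_right_mono[OF C(2)[of n], of "r ^ n"] \<open>0 < r\<close>
        by (simp add: norm_mult norm_power mult.assoc)
    qed
  qed
qed

text \<open>Summation by parts: (1 - r) times the sum for M + 1 is at most M + 1 times the sum for
  M, because (k + 1)^(M + 1) - k^(M + 1) \<le> (M + 1) (k + 1)^M. The order of the pole at r = 1
  matters, since as many zeros of a polynomial will have to cancel it.\<close>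

lemma sum_Suc_power_mult_power_le:
  fixes r :: real
  assumes "0 \<le> r" "r < 1"
  shows "(\<Sum>k\<le>n. real (Suc k) ^ M * r ^ k) \<le> fact M / (1 - r) ^ Suc M"
proof (induction M)
  case 0
  have "(\<Sum>k\<le>n. r ^ k) = (1 - r ^ Suc n) / (1 - r)"
    using assms by (simp only: sum_gp_basic[symmetric] lessThan_Suc_atMost) (simp add: field_simps sum_gp_basic)
  also have "\<dots> \<le> 1 / (1 - r)" using assms by (intro divide_right_mono) auto
  finally show ?case by simp
next
  case (Suc M)
  have diff: "x ^ Suc m - y ^ Suc m \<le> real (Suc m) * (x - y) * x ^ m"
    if "0 \<le> y" "y \<le> x" for x y :: real and m
  proof (induction m)
    case (Suc m)
    have "x ^ Suc (Suc m) - y ^ Suc (Suc m) = x * (x ^ Suc m - y ^ Suc m) + (x - y) * y ^ Suc m"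
      by (simp add: algebra_simps)
    also have "\<dots> \<le> x * (real (Suc m) * (x - y) * x ^ m) + (x - y) * x ^ Suc m"
      using that by (intro add_mono mult_left_mono Suc.IH power_mono) auto
    finally show ?case by (simp add: algebra_simps)
  qed simp
  \<comment> \<open>The boundary term on the left makes the induction on n close; it is nonnegative
    and dropped afterwards.\<close>
  have "(1 - r) * (\<Sum>k\<le>n. real (Suc k) ^ Suc M * r ^ k) + real (Suc n) ^ Suc M * r ^ Suc n
      \<le> real (Suc M) * (\<Sum>k\<le>n. real (Suc k) ^ M * r ^ k)" for n
  proof (induction n)
    case 0
    then show ?case using assms by simp
  next
    case (Suc n)
    have "(real (Suc (Suc n)) ^ Suc M - real (Suc n) ^ Suc M) * r ^ Suc n
        \<le> real (Suc M) * real (Suc (Suc n)) ^ M * r ^ Suc n"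
      using diff[of "real (Suc n)" "real (Suc (Suc n))"] assms by (intro mult_right_mono) auto
    with Suc.IH show ?case by (simp add: algebra_simps)
  qed
  from this[of n] have "(1 - r) * (\<Sum>k\<le>n. real (Suc k) ^ Suc M * r ^ k)
      \<le> real (Suc M) * (\<Sum>k\<le>n. real (Suc k) ^ M * r ^ k)"
    using assms by (smt (verit) mult_nonneg_nonneg of_nat_0_le_iff zero_le_power)
  also have "\<dots> \<le> real (Suc M) * (fact M / (1 - r) ^ Suc M)"
    by (intro mult_left_mono Suc.IH) auto
  finally have "(\<Sum>k\<le>n. real (Suc k) ^ Suc M * r ^ k)
      \<le> real (Suc M) * (fact M / (1 - r) ^ Suc M) / (1 - r)"
    using assms by (subst pos_le_divide_eq) (simp_all add: mult.commute)
  then show ?case by (simp add: mult_ac)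
qed

section \<open>A quantitative Fatou--Riesz theorem\<close>

text \<open>On the circle \<delta>^2 = z * cnj z with z = \<zeta> - 1, so the polynomial equals z *
  (z + cnj z + z * cnj z) = z * (|\<zeta>|^2 - 1). For small \<delta> > 0 its roots are thus the two
  points where the circle meets the unit circle, while its value at \<zeta> = 1 is
  \<delta>^2.\<close>

lemma norm_riesz_factor:
  fixes \<zeta> :: complex and \<delta> :: real
  assumes "norm (\<zeta> - 1) = \<delta>"
  shows "norm ((\<zeta> - 1)\<^sup>2 + of_real (\<delta>\<^sup>2) * (\<zeta> - 1) + of_real (\<delta>\<^sup>2)) = \<delta> * \<bar>(norm \<zeta>)\<^sup>2 - 1\<bar>"
proof -
  define z where "z = \<zeta> - 1"
  have d: "of_real (\<delta>\<^sup>2) = z * cnj z"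
    using complex_norm_square[of z] assms unfolding z_def by metis
  have "z\<^sup>2 + of_real (\<delta>\<^sup>2) * z + of_real (\<delta>\<^sup>2) = z * (z + cnj z + of_real (\<delta>\<^sup>2))"
    by (simp only: d) (simp add: power2_eq_square algebra_simps)
  also have "z + cnj z + of_real (\<delta>\<^sup>2) = of_real (2 * Re z + \<delta>\<^sup>2)"
    by (simp add: complex_add_cnj)
  also have "2 * Re z + \<delta>\<^sup>2 = (norm \<zeta>)\<^sup>2 - 1"
  proof -
    have "\<delta>\<^sup>2 = (Re z)\<^sup>2 + (Im z)\<^sup>2" using assms cmod_power2[of z] by (simp add: z_def)
    moreover have "(norm \<zeta>)\<^sup>2 = (Re z + 1)\<^sup>2 + (Im z)\<^sup>2" by (simp add: z_def cmod_power2)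
    ultimately show ?thesis by (simp add: power2_eq_square algebra_simps)
  qed
  finally show ?thesis using assms by (simp add: z_def norm_mult del: of_real_diff)
qed

text \<open>
  A quantitative form of the Fatou--Riesz theorem.  On a small circle around 1 the
  factor \<open>Q\<close> vanishes exactly where the circle meets the unit circle, and compensates the
  growth of the remainder there; the maximum principle carries the bound to the centre.
\<close>
lemma poly_bounded_partial_sums:
  fixes a :: "nat \<Rightarrow> complex"
  assumes "poly_bounded q a" and "\<epsilon> > 0" and "F holomorphic_on ball 1 \<epsilon>"
    and sums: "\<And>\<zeta>. \<zeta> \<in> ball 1 \<epsilon> \<Longrightarrow> norm \<zeta> < 1 \<Longrightarrow> (\<lambda>n. a n * \<zeta> ^ n) sums F \<zeta>"
    and "F 1 = 0"
  shows "poly_bounded q (\<lambda>n. \<Sum>m<n. a m)"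
proof -
  obtain C where C: "C > 0" "\<And>n. norm (a n) \<le> C * real (Suc n) powr q"
    using assms(1) poly_boundedE by blast
  \<comment> \<open>The radius, at most 1/2, keeps 0 out of the closed disc, where \<zeta>^n will be
    divided out.\<close>
  define \<delta> where "\<delta> = min (\<epsilon> / 2) (1 / 2)"
  have \<delta>: "0 < \<delta>" "\<delta> < \<epsilon>" "\<delta> \<le> 1 / 2" using \<open>\<epsilon> > 0\<close> by (auto simp: \<delta>_def)
  define M where "M = nat \<lceil>\<bar>q\<bar>\<rceil>"
  have M: "\<bar>q\<bar> \<le> real M" unfolding M_def by linarith
  define Q where "Q = (\<lambda>\<zeta>::complex. (\<zeta> - 1)\<^sup>2 + of_real (\<delta>\<^sup>2) * (\<zeta> - 1) + of_real (\<delta>\<^sup>2))"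
  have cball: "cball 1 \<delta> \<subseteq> ball (1::complex) \<epsilon>" using \<delta> by auto
  have contF: "continuous_on (cball 1 \<delta>) F"
    using assms(3) cball holomorphic_on_imp_continuous_on holomorphic_on_subset by blast
  obtain B where B: "B > 0" "\<And>\<zeta>. \<zeta> \<in> cball 1 \<delta> \<Longrightarrow> norm (F \<zeta>) \<le> B"
  proof -
    have "bounded (F ` cball 1 \<delta>)"
      by (intro compact_imp_bounded compact_continuous_image contF compact_cball)
    then show ?thesis using that unfolding bounded_pos by auto
  qed
  define K where "K = (C + B) * fact M * 8 ^ Suc M"
  have powr_M: "real (Suc k) powr \<bar>q\<bar> \<le> real (Suc k) ^ M" for k
    using powr_mono[OF M, of "real (Suc k)"] by (simp add: powr_realpow[symmetric])
  define P where "P = (\<lambda>n \<zeta>. \<Sum>m<n. a m * \<zeta> ^ m)"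
  define D where "D = (\<lambda>r::real. fact M / (1 - r) ^ Suc M :: real)"

  \<comment> \<open>Inside the unit disc the difference is the tail of the series; shifting the
    index by n extracts (n + 1) powr q, and the remaining weights sum to at most
    \<open>D\<close>.\<close>
  have inner: "norm (F \<zeta> - P n \<zeta>) \<le> norm \<zeta> ^ n * (C * real (Suc n) powr q * D (norm \<zeta>))"
    if "\<zeta> \<in> ball 1 \<epsilon>" "norm \<zeta> < 1" for \<zeta> n
  proof -
    have "(\<lambda>k. a (k + n) * \<zeta> ^ (k + n)) sums (F \<zeta> - P n \<zeta>)"
      unfolding P_def by (rule sums_split_initial_segment[OF sums[OF that]])
    then have lim: "(\<lambda>N. \<Sum>k<N. a (k + n) * \<zeta> ^ (k + n)) \<longlonglongrightarrow> F \<zeta> - P n \<zeta>"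
      by (simp add: sums_def)
    show ?thesis
    proof (rule LIMSEQ_le_const2[OF tendsto_norm[OF lim]], intro exI allI impI)
      fix N :: nat assume "0 \<le> N"
      have "norm (\<Sum>k<N. a (k + n) * \<zeta> ^ (k + n))
        \<le> (\<Sum>k<N. norm \<zeta> ^ n * (C * real (Suc n) powr q) * (real (Suc k) ^ M * norm \<zeta> ^ k))"
      proof (rule sum_norm_le)
        fix k
        have "norm (a (k + n)) \<le> C * (real (Suc n) powr q * real (Suc k) ^ M)"
          using Suc_add_powr_le[of n k q] powr_M[of k] C(1)
          by (intro order_trans[OF C(2)] mult_left_mono)
             (auto simp: add.commute intro: order_trans mult_left_mono)
        then have "norm (a (k + n)) * norm \<zeta> ^ (k + n)
          \<le> C * (real (Suc n) powr q * real (Suc k) ^ M) * norm \<zeta> ^ (k + n)"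
          by (rule mult_right_mono) simp
        then show "norm (a (k + n) * \<zeta> ^ (k + n))
          \<le> norm \<zeta> ^ n * (C * real (Suc n) powr q) * (real (Suc k) ^ M * norm \<zeta> ^ k)"
          by (simp add: norm_mult norm_power power_add mult_ac)
      qed
      also have "\<dots> = norm \<zeta> ^ n * (C * real (Suc n) powr q) * (\<Sum>k<N. real (Suc k) ^ M * norm \<zeta> ^ k)"
        by (simp only: sum_distrib_left)
      also have "\<dots> \<le> norm \<zeta> ^ n * (C * real (Suc n) powr q) * (\<Sum>k\<le>N. real (Suc k) ^ M * norm \<zeta> ^ k)"
        using C(1) by (intro mult_left_mono sum_mono2) auto
      also have "\<dots> \<le> norm \<zeta> ^ n * (C * real (Suc n) powr q) * D (norm \<zeta>)"
        unfolding D_def using C(1) that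
        by (intro mult_left_mono sum_Suc_power_mult_power_le) auto
      finally show "norm (\<Sum>k<N. a (k + n) * \<zeta> ^ (k + n))
        \<le> norm \<zeta> ^ n * (C * real (Suc n) powr q * D (norm \<zeta>))" by (simp add: mult_ac)
    qed
  qed

  \<comment> \<open>Outside, the finite sum is read backwards, which gives the same estimate with 1
    / |\<zeta>| in \<open>D\<close>. The bounded function \<open>F\<close> fits under it because
    |\<zeta>|^n r^n = 1 and (n + 1)^M r^n is a single term of the sum estimated by
    \<open>D\<close>.\<close>
  have outer: "norm (F \<zeta> - P n \<zeta>) \<le> norm \<zeta> ^ n * ((C + B) * real (Suc n) powr q * D (inverse (norm \<zeta>)))"
    if "\<zeta> \<in> cball 1 \<delta>" "norm \<zeta> > 1" for \<zeta> n
  proof -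
    define r where "r = inverse (norm \<zeta>)"
    have r: "0 < r" "r < 1" using that(2) by (auto simp: r_def inverse_less_1_iff)
    have z0: "\<zeta> \<noteq> 0" using that(2) by auto
    have rn: "norm \<zeta> ^ n * r ^ n = 1" using z0 by (subst power_mult_distrib[symmetric]) (simp add: r_def)
    have DS: "(\<Sum>k\<le>n. real (Suc k) ^ M * r ^ k) \<le> D r"
      unfolding D_def using r by (intro sum_Suc_power_mult_power_le) auto
    have "real (Suc n) ^ M * r ^ n \<le> (\<Sum>k\<le>n. real (Suc k) ^ M * r ^ k)"
      using r by (intro member_le_sum) auto
    then have rD: "real (Suc n) ^ M * r ^ n \<le> D r" using DS by linarith
    have "1 \<le> real (Suc n) powr q * real (Suc n) ^ M"
    proof -
      have "1 \<le> real (Suc n) powr (q + \<bar>q\<bar>)" by (intro ge_one_powr_ge_zero) auto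
      also have "\<dots> \<le> real (Suc n) powr q * real (Suc n) ^ M"
        unfolding powr_add by (intro mult_left_mono powr_M) auto
      finally show ?thesis .
    qed
    then have "r ^ n \<le> real (Suc n) powr q * (real (Suc n) ^ M * r ^ n)"
      using mult_right_mono[of 1 "real (Suc n) powr q * real (Suc n) ^ M" "r ^ n"] r
      by (simp add: mult.assoc)
    also have "\<dots> \<le> real (Suc n) powr q * D r" by (intro mult_left_mono rD) auto
    finally have "B * (norm \<zeta> ^ n * r ^ n) \<le> B * (norm \<zeta> ^ n * (real (Suc n) powr q * D r))"
      using B(1) by (intro mult_left_mono) auto
    then have F: "norm (F \<zeta>) \<le> B * (norm \<zeta> ^ n * (real (Suc n) powr q * D r))"
      using B(2)[OF that(1)] rn by simp
    have "norm (P n \<zeta>) \<le> (\<Sum>m<n. norm (a m) * norm \<zeta> ^ m)"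
      unfolding P_def by (rule order_trans[OF norm_sum]) (simp add: norm_mult norm_power)
    also have "\<dots> \<le> (\<Sum>m\<le>n. norm (a m) * norm \<zeta> ^ m)" by (intro sum_mono2) auto
    also have "\<dots> = (\<Sum>k\<le>n. norm (a (n - k)) * norm \<zeta> ^ (n - k))"
      by (rule sum.reindex_bij_witness[of _ "\<lambda>k. n - k" "\<lambda>k. n - k"]) auto
    also have "\<dots> \<le> (\<Sum>k\<le>n. norm \<zeta> ^ n * (C * real (Suc n) powr q) * (real (Suc k) ^ M * r ^ k))"
    proof (rule sum_mono)
      fix k assume "k \<in> {..n}"
      then have k: "k \<le> n" by simp
      have "norm (a (n - k)) \<le> C * (real (Suc n) powr q * real (Suc k) ^ M)"
        using Suc_diff_powr_le[OF k, of q] powr_M[of k] C(1)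
        by (intro order_trans[OF C(2)] mult_left_mono) (auto intro: order_trans mult_left_mono)
      moreover have "norm \<zeta> ^ (n - k) = norm \<zeta> ^ n * r ^ k"
        using z0 k by (simp add: r_def power_diff_conv_inverse)
      ultimately have "norm (a (n - k)) * norm \<zeta> ^ (n - k)
          \<le> C * (real (Suc n) powr q * real (Suc k) ^ M) * (norm \<zeta> ^ n * r ^ k)"
        using r by (auto intro!: mult_right_mono)
      then show "norm (a (n - k)) * norm \<zeta> ^ (n - k)
          \<le> norm \<zeta> ^ n * (C * real (Suc n) powr q) * (real (Suc k) ^ M * r ^ k)"
        by (simp add: mult_ac)
    qed
    also have "\<dots> = norm \<zeta> ^ n * (C * real (Suc n) powr q) * (\<Sum>k\<le>n. real (Suc k) ^ M * r ^ k)"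
      by (simp only: sum_distrib_left)
    also have "\<dots> \<le> norm \<zeta> ^ n * (C * real (Suc n) powr q) * D r"
      using C(1) by (intro mult_left_mono DS) auto
    finally have "norm (P n \<zeta>) \<le> norm \<zeta> ^ n * (C * real (Suc n) powr q) * D r" .
    with F have "norm (F \<zeta> - P n \<zeta>)
      \<le> B * (norm \<zeta> ^ n * (real (Suc n) powr q * D r)) + norm \<zeta> ^ n * (C * real (Suc n) powr q) * D r"
      using norm_triangle_ineq4[of "F \<zeta>" "P n \<zeta>"] by linarith
    then show ?thesis unfolding r_def[symmetric] by (simp add: algebra_simps)
  qed

  have bound: "norm ((F \<zeta> - P n \<zeta>) * Q \<zeta> ^ Suc M / \<zeta> ^ n) \<le> K * real (Suc n) powr q"
    if z: "norm (\<zeta> - 1) = \<delta>" for \<zeta> n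
  proof -
    have zb: "\<zeta> \<in> cball 1 \<delta>" "\<zeta> \<in> ball 1 \<epsilon>" using z \<delta> by (auto simp: dist_norm norm_minus_commute)
    have z0: "\<zeta> \<noteq> 0" using z \<delta> by auto
    have nQ: "norm (Q \<zeta>) = \<delta> * \<bar>(norm \<zeta>)\<^sup>2 - 1\<bar>"
      unfolding Q_def using norm_riesz_factor[OF z] .
    \<comment> \<open>To be used with r = |\<zeta>| inside and r = 1 / |\<zeta>| outside: the M + 1
      factors \<open>Q\<close> cancel the pole of order M + 1 in \<open>D\<close>, and the division
      by \<zeta>^n cancels |\<zeta>|^n.\<close>
    have reduce: "norm ((F \<zeta> - P n \<zeta>) * Q \<zeta> ^ Suc M / \<zeta> ^ n) \<le> K * real (Suc n) powr q"
      if r: "r < 1" and 1: "norm (F \<zeta> - P n \<zeta>) \<le> norm \<zeta> ^ n * ((C + B) * real (Suc n) powr q * D r)"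
        and 2: "norm (Q \<zeta>) \<le> 8 * (1 - r)" for r
    proof -
      have "norm ((F \<zeta> - P n \<zeta>) * Q \<zeta> ^ Suc M / \<zeta> ^ n)
          = norm (F \<zeta> - P n \<zeta>) * norm (Q \<zeta>) ^ Suc M / norm \<zeta> ^ n"
        by (simp only: norm_mult norm_divide norm_power)
      also have "\<dots> \<le> (norm \<zeta> ^ n * ((C + B) * real (Suc n) powr q * D r)) * (8 * (1 - r)) ^ Suc M / norm \<zeta> ^ n"
        using 1 2 r B(1) C(1)
        by (intro divide_right_mono mult_mono power_mono) (auto simp: D_def)
      also have "\<dots> = (C + B) * real (Suc n) powr q * (D r * (8 * (1 - r)) ^ Suc M)"
        using z0 by simp
      also have "D r * (8 * (1 - r)) ^ Suc M = fact M * 8 ^ Suc M"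
        using r by (simp only: D_def power_mult_distrib) simp
      finally show ?thesis by (simp only: K_def mult_ac)
    qed
    have "norm \<zeta> \<le> 2" using norm_triangle_ineq[of "\<zeta> - 1" 1] z \<delta> by simp
    consider "norm \<zeta> < 1" | "norm \<zeta> = 1" | "norm \<zeta> > 1" by linarith
    then show ?thesis
    proof cases
      case 1
      have "norm \<zeta> ^ n * (C * real (Suc n) powr q * D (norm \<zeta>))
          \<le> norm \<zeta> ^ n * ((C + B) * real (Suc n) powr q * D (norm \<zeta>))"
        using B(1) 1 by (intro mult_left_mono mult_right_mono) (auto simp: D_def)
      then have a: "norm (F \<zeta> - P n \<zeta>) \<le> norm \<zeta> ^ n * ((C + B) * real (Suc n) powr q * D (norm \<zeta>))"
        using inner[OF zb(2) 1, of n] by linarith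
      have "norm (Q \<zeta>) = \<delta> * (1 + norm \<zeta>) * (1 - norm \<zeta>)"
      proof -
        have "\<bar>(norm \<zeta>)\<^sup>2 - 1\<bar> = 1 - (norm \<zeta>)\<^sup>2" using 1 by (simp add: abs_square_le_1)
        then show ?thesis unfolding nQ by (simp add: power2_eq_square algebra_simps)
      qed
      also have "\<dots> \<le> 8 * (1 - norm \<zeta>)"
      proof (intro mult_right_mono)
        have "\<delta> * (1 + norm \<zeta>) \<le> 1 * 2" using 1 \<delta> by (intro mult_mono) auto
        then show "\<delta> * (1 + norm \<zeta>) \<le> 8" by simp
      qed (use 1 in auto)
      finally show ?thesis using reduce[OF 1 a] by blast
    next
      \<comment> \<open>Neither estimate is available on the unit circle itself, but there
        \<open>Q\<close> vanishes.\<close>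
      case 2
      then have "Q \<zeta> = 0" using nQ by simp
      then show ?thesis using B(1) C(1) by (simp add: K_def)
    next
      case 3
      define r where "r = inverse (norm \<zeta>)"
      have r: "0 < r" "r < 1" using 3 by (auto simp: r_def inverse_less_1_iff)
      have rr: "norm \<zeta> * r = 1" using z0 by (simp add: r_def)
      have "norm (Q \<zeta>) = \<delta> * ((norm \<zeta>)\<^sup>2 - 1)" unfolding nQ using 3 by (simp add: abs_if power_less_one_iff)
      also have "(norm \<zeta>)\<^sup>2 - 1 = norm \<zeta> * (norm \<zeta> + 1) * (1 - r)"
      proof -
        have "norm \<zeta> * (norm \<zeta> + 1) * (1 - r) = norm \<zeta> * norm \<zeta> + norm \<zeta> - (norm \<zeta> + 1) * (norm \<zeta> * r)"
          by (simp add: algebra_simps)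
        then show ?thesis unfolding rr by (simp add: power2_eq_square)
      qed
      also have "\<delta> * (norm \<zeta> * (norm \<zeta> + 1) * (1 - r)) = (\<delta> * (norm \<zeta> * (norm \<zeta> + 1))) * (1 - r)" by simp
      also have "\<dots> \<le> 8 * (1 - r)"
      proof (intro mult_right_mono)
        have "norm \<zeta> * (norm \<zeta> + 1) \<le> 2 * 3" using \<open>norm \<zeta> \<le> 2\<close> by (intro mult_mono) auto
        moreover have "\<delta> * (norm \<zeta> * (norm \<zeta> + 1)) \<le> 1 * (norm \<zeta> * (norm \<zeta> + 1))"
          by (rule mult_right_mono) (use \<delta> in auto)
        ultimately show "\<delta> * (norm \<zeta> * (norm \<zeta> + 1)) \<le> 8" by linarith
      qed (use r in auto)
      finally show ?thesis using reduce[OF r(2)] outer[OF zb(1) 3, of n] unfolding r_def by blast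
    qed
  qed

  have "norm (\<Sum>m<n. a m) \<le> (K / \<delta> ^ (2 * Suc M)) * real (Suc n) powr q" for n
  proof -
    \<comment> \<open>At the centre \<zeta>^n = 1, \<open>F\<close> vanishes and \<open>Q\<close> is
      \<delta>^2, so up to sign \<open>G\<close> takes there the partial sum times a power of
      \<delta>.\<close>
    define G where "G = (\<lambda>\<zeta>. (F \<zeta> - P n \<zeta>) * Q \<zeta> ^ Suc M / \<zeta> ^ n)"
    have nz: "\<zeta> \<noteq> 0" if "\<zeta> \<in> cball 1 \<delta>" for \<zeta> :: complex using that \<delta> by auto
    have holF: "F holomorphic_on cball 1 \<delta>" using assms(3) cball holomorphic_on_subset by blast
    have holG: "G holomorphic_on cball 1 \<delta>"
      unfolding G_def P_def Q_def by (intro holomorphic_intros holF) (use nz in auto)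
    have "norm (G 1) \<le> K * real (Suc n) powr q"
    proof (rule maximum_modulus_frontier[of G "ball 1 \<delta>"])
      show "G holomorphic_on interior (ball 1 \<delta>)"
        using holG holomorphic_on_subset ball_subset_cball by (metis interior_ball)
      show "continuous_on (closure (ball 1 \<delta>)) G"
        using holG \<delta>(1) holomorphic_on_imp_continuous_on by simp
      show "norm (G \<zeta>) \<le> K * real (Suc n) powr q" if "\<zeta> \<in> frontier (ball 1 \<delta>)" for \<zeta>
        unfolding G_def using that \<delta>(1) by (intro bound) (auto simp: dist_norm norm_minus_commute)
    qed (use \<delta> in auto)
    moreover have "norm (G 1) = norm (\<Sum>m<n. a m) * \<delta> ^ (2 * Suc M)"
      using \<open>F 1 = 0\<close> \<delta>(1)
      by (simp only: G_def P_def Q_def norm_mult norm_divide norm_power power_mult) (simp add: norm_mult norm_power)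
    ultimately show ?thesis using \<delta>(1) by (simp add: field_simps)
  qed
  then show ?thesis by (rule poly_boundedI)
qed

text \<open>One factor at a time: the coefficients of A / (1 - X) are the partial sums of those of
  A. As long as a factor is left, the function of A vanishes at 1 and is holomorphic there, so the
  Fatou--Riesz bound applies and the exponent q survives the division.\<close>

lemma coeff_bounded_divide_one_minus_X:
  assumes "coeff_bounded q ((1 - fps_X) ^ m * R)" "fps_conv_radius R \<ge> 1" "\<epsilon> > 0"
    and "r holomorphic_on ball 1 \<epsilon>"
    and r: "\<And>\<zeta>. \<zeta> \<in> ball 1 \<epsilon> \<Longrightarrow> norm \<zeta> < 1 \<Longrightarrow> eval_fps R \<zeta> = r \<zeta>"
  shows "coeff_bounded q R"
  using assms(1)
proof (induction m)
  case (Suc m)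
  define A where "A = (1 - fps_X) ^ Suc m * R"
  define B where "B = (1 - fps_X) ^ m * R"
  have AB: "A = (1 - fps_X) * B" by (simp add: A_def B_def mult.assoc)
  have radius: "fps_conv_radius ((1 - fps_X) ^ Suc m * R :: complex fps) \<ge> 1"
    using assms(2) fps_conv_radius_mult[of "(1 - fps_X) ^ Suc m" R]
      fps_conv_radius_power[of "1 - fps_X :: complex fps" "Suc m"]
      fps_conv_radius_diff[of "1 :: complex fps" fps_X] by (simp add: min_def split: if_splits)
  have rad1: "fps_conv_radius (1 - fps_X :: complex fps) = \<infinity>"
    using fps_conv_radius_diff[of "1 :: complex fps" fps_X] by simp
  have rad2: "fps_conv_radius ((1 - fps_X :: complex fps) ^ Suc m) = \<infinity>"
    using fps_conv_radius_power[of "1 - fps_X :: complex fps" "Suc m"] rad1 by simp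
  have sums: "(\<lambda>n. fps_nth A n * \<zeta> ^ n) sums ((1 - \<zeta>) ^ Suc m * r \<zeta>)"
    if "\<zeta> \<in> ball 1 \<epsilon>" "norm \<zeta> < 1" for \<zeta>
  proof -
    have z: "ereal (norm \<zeta>) < fps_conv_radius R" "ereal (norm \<zeta>) < fps_conv_radius A"
      using that(2) assms(2) radius unfolding A_def
      by (auto intro: less_le_trans[of _ 1])
    have "eval_fps A \<zeta> = eval_fps ((1 - fps_X) ^ Suc m) \<zeta> * eval_fps R \<zeta>"
      unfolding A_def using z(1) rad2 by (intro eval_fps_mult) auto
    also have "eval_fps ((1 - fps_X) ^ Suc m) \<zeta> = (1 - \<zeta>) ^ Suc m"
      using rad1 by (subst eval_fps_power) (auto simp: eval_fps_diff)
    finally have "eval_fps A \<zeta> = (1 - \<zeta>) ^ Suc m * r \<zeta>" using r[OF that] by simp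
    then show ?thesis using sums_eval_fps[OF z(2)] by simp
  qed
  have "poly_bounded q (\<lambda>n. \<Sum>k<n. fps_nth A k)"
    by (rule poly_bounded_partial_sums[where F = "\<lambda>\<zeta>. (1 - \<zeta>) ^ Suc m * r \<zeta>" and \<epsilon> = \<epsilon>])
       (use Suc.prems[folded A_def] assms(3,4) sums in \<open>auto intro!: holomorphic_intros\<close>)
  then have "poly_bounded q (\<lambda>n. (\<Sum>k<n. fps_nth A k) + fps_nth A n)"
    using Suc.prems unfolding A_def[symmetric] by (rule poly_bounded_add)
  moreover have "(\<Sum>k<n. fps_nth A k) + fps_nth A n = fps_nth B n" for n
  proof (induction n)
    case (Suc n)
    then show ?case unfolding AB by (simp add: left_diff_distrib)
  qed (simp add: AB)
  ultimately have "coeff_bounded q B" by simp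
  then show ?case unfolding B_def by (rule Suc.IH)
qed simp

section \<open>Asymptotic expansions of binomial coefficients\<close>

lemma poly_bounded_mult:
  assumes "poly_bounded q a" "poly_bounded r b"
  shows "poly_bounded (q + r) (\<lambda>n. a n * b n)"
proof -
  obtain C where C: "C > 0" "\<And>n. norm (a n) \<le> C * real (Suc n) powr q"
    using assms(1) poly_boundedE by blast
  obtain D where D: "D > 0" "\<And>n. norm (b n) \<le> D * real (Suc n) powr r"
    using assms(2) poly_boundedE by blast
  have "norm (a n * b n) \<le> (C * real (Suc n) powr q) * (D * real (Suc n) powr r)" for n
    unfolding norm_mult using C D by (intro mult_mono) auto
  then show ?thesis by (intro poly_boundedI[of _ "C * D"]) (simp add: powr_add mult_ac)
qed

lemma poly_bounded_eventually_norm_le: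
  assumes "eventually (\<lambda>n. norm (a n) \<le> C * real n powr q) at_top"
  shows "poly_bounded q a"
  unfolding poly_bounded_iff_bigo by (rule bigoI[of _ C]) (use assms in simp)

lemma norm_of_nat_powr: "norm (of_nat n powr s :: complex) = real n powr Re s"
  using norm_powr_real_powr[of "of_nat n" s] by simp

lemma poly_bounded_of_nat_powr: "poly_bounded (Re s) (\<lambda>n. of_nat n powr s)"
  by (rule poly_bounded_eventually_norm_le[of _ 1]) (simp add: norm_of_nat_powr)

lemma poly_bounded_of_nat_powr_mult_convergent:
  assumes "(\<lambda>n. a n * of_nat n powr (- s)) \<longlonglongrightarrow> L"
  shows "poly_bounded (Re s) a"
proof -
  from assms have "Bseq (\<lambda>n. a n * of_nat n powr (- s))"
    by (intro convergent_imp_Bseq) (auto simp: convergent_def)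
  then obtain C where C: "\<And>n. norm (a n * of_nat n powr (- s)) \<le> C"
    unfolding Bseq_def by blast
  show ?thesis
  proof (rule poly_bounded_eventually_norm_le[of _ C])
    show "eventually (\<lambda>n. norm (a n) \<le> C * real n powr Re s) at_top"
      using eventually_gt_at_top[of 0]
    proof eventually_elim
      case (elim n)
      with C[of n] show ?case
        by (simp add: norm_mult norm_divide norm_of_nat_powr powr_minus field_simps)
    qed
  qed
qed

definition one_minus_X_powr :: "complex \<Rightarrow> complex fps" where
  "one_minus_X_powr s = Abs_fps (\<lambda>n. pochhammer (- s) n / fact n)"

lemma one_minus_X_powr_altdef: "one_minus_X_powr s = fps_binomial s oo (- fps_X)"
proof (rule fps_ext)
  fix n
  have "((- 1) ^ n :: complex) * (- 1) ^ n = 1" by (simp flip: power_mult_distrib)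
  then show "fps_nth (one_minus_X_powr s) n = fps_nth (fps_binomial s oo (- fps_X)) n"
    by (simp add: fps_compose_uminus' one_minus_X_powr_def gbinomial_pochhammer)
qed

lemma one_minus_X_powr_add:
  "one_minus_X_powr (s + t) = one_minus_X_powr s * one_minus_X_powr t"
  unfolding one_minus_X_powr_altdef fps_binomial_add_mult by (rule fps_compose_mult_distrib) simp

lemma one_minus_X_powr_of_nat: "one_minus_X_powr (of_nat n) = (1 - fps_X) ^ n"
  by (simp add: one_minus_X_powr_altdef fps_binomial_of_nat fps_compose_add_distrib flip: fps_compose_power)

lemma one_minus_X_powr_0 [simp]: "one_minus_X_powr 0 = 1"
  using one_minus_X_powr_of_nat[of 0] by simp

lemma eval_one_minus_X_powr:
  assumes "norm z < 1"
  shows "eval_fps (one_minus_X_powr s) z = (1 - z) powr s"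
proof -
  have "(\<lambda>n. (s gchoose n) * (- z) ^ n) = (\<lambda>n. fps_nth (one_minus_X_powr s) n * z ^ n)"
  proof
    fix n
    have "(s gchoose n) * (- z) ^ n = ((- 1) ^ n * (- 1) ^ n) * (pochhammer (- s) n / fact n) * z ^ n"
      by (simp only: gbinomial_pochhammer power_minus[of z]) simp
    then show "(s gchoose n) * (- z) ^ n = fps_nth (one_minus_X_powr s) n * z ^ n"
      by (simp add: one_minus_X_powr_def flip: power_mult_distrib)
  qed
  with gen_binomial_complex[of "- z" s] assms show ?thesis
    by (simp add: eval_fps_def sums_iff)
qed

text \<open>Euler's limit formula \<open>rGamma_series\<close> has one Pochhammer factor s + n more,
  which the quotient n / (s + n) removes. The poles of Gamma are included; there the limit is
  0.\<close>

lemma one_minus_X_powr_asymp: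
  "(\<lambda>n. fps_nth (one_minus_X_powr (- s)) n * of_nat n powr (1 - s)) \<longlonglongrightarrow> rGamma s"
proof (rule Lim_transform_eventually)
  have "(\<lambda>n. of_nat n / (s + of_nat n)) \<longlonglongrightarrow> 1"
  proof -
    have "(\<lambda>n. inverse (1 + s * inverse (of_nat n))) \<longlonglongrightarrow> inverse (1 + s * 0)"
      by (intro tendsto_intros lim_inverse_n) auto
    then show ?thesis
      by (rule Lim_transform_eventually[THEN tendsto_eq_rhs])
         (auto intro!: eventually_mono[OF eventually_gt_at_top[of 0]] simp: field_simps)
  qed
  then show "(\<lambda>n. rGamma_series s n * (of_nat n / (s + of_nat n))) \<longlonglongrightarrow> rGamma s"
    using tendsto_mult[OF rGamma_series_LIMSEQ[of s]] by fastforce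
  show "eventually (\<lambda>n. rGamma_series s n * (of_nat n / (s + of_nat n)) =
      fps_nth (one_minus_X_powr (- s)) n * of_nat n powr (1 - s)) at_top"
    using eventually_gt_at_top[of "nat \<lceil>norm s\<rceil>"]
  proof eventually_elim
    case (elim n)
    then have n: "norm s < real n" "n > 0" by linarith+
    have "s + of_nat n \<noteq> 0"
    proof
      assume "s + of_nat n = 0"
      then have "s = - of_nat n" by (simp add: eq_neg_iff_add_eq_0)
      then show False using n by simp
    qed
    moreover have "exp (s * of_real (ln (of_nat n))) = of_nat n powr s"
      using n by (simp add: powr_def)
    moreover have "of_nat n powr (1 - s) = of_nat n / (of_nat n powr s :: complex)"
      using n by (simp add: powr_diff)
    ultimately show ?case using n
      by (simp add: rGamma_series_def one_minus_X_powr_def pochhammer_rec')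
  qed
qed

lemma coeff_bounded_one_minus_X_powr: "coeff_bounded (- Re s - 1) (one_minus_X_powr s)"
  using poly_bounded_of_nat_powr_mult_convergent[of "fps_nth (one_minus_X_powr s)" "-s - 1"]
    one_minus_X_powr_asymp[of "-s"] by simp

lemma fps_conv_radius_one_minus_X_powr: "fps_conv_radius (one_minus_X_powr s) \<ge> 1"
  by (rule fps_conv_radius_ge_1_if_coeff_bounded[OF coeff_bounded_one_minus_X_powr])

section \<open>Asymptotic expansions in the functions n powr (s - 1) / Gamma(s)\<close>

definition rGamma_powr :: "complex \<Rightarrow> nat \<Rightarrow> complex" where
  "rGamma_powr s n = rGamma s * of_nat n powr (s - 1)"

lemma poly_bounded_rGamma_powr: "poly_bounded (Re s - 1) (rGamma_powr s)"
  using poly_bounded_cmult[OF poly_bounded_of_nat_powr[of "s - 1"], of "rGamma s"]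
  by (simp add: rGamma_powr_def[abs_def])

text \<open>With the entire function \<open>rGamma\<close> the rule has no exceptional s; at n = 0
  both sides vanish, because \<open>powr\<close> gives 0 there.\<close>

lemma of_nat_mult_rGamma_powr: "of_nat n * rGamma_powr s n = s * rGamma_powr (s + 1) n"
proof -
  have "of_nat n * of_nat n powr (s - 1) = (of_nat n powr s :: complex)"
    by (cases "n = 0") (simp_all add: powr_diff)
  then show ?thesis using rGamma_plus1[of s] by (simp add: rGamma_powr_def mult_ac flip: mult.assoc)
qed

text \<open>
  When a sequence is identified with the series of its coefficients, \<open>rGamma s * n powr (s - 1)\<close>
  plays the role of \<open>h powr (- s)\<close>: delaying a sequence by one step amounts to multiplication by
  \<open>exp (- h)\<close>, and multiplication by \<open>n\<close> to the operator \<open>- d / dh\<close>.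
\<close>
definition expands :: "nat \<Rightarrow> complex \<Rightarrow> complex fps \<Rightarrow> (nat \<Rightarrow> complex) \<Rightarrow> bool" where
  "expands N s F x \<longleftrightarrow> poly_bounded (Re s - 1 - real N)
     (\<lambda>n. x n - (\<Sum>l<N. fps_nth F l * rGamma_powr (s - of_nat l) n))"

lemma expands_cong:
  assumes "\<And>l. l < N \<Longrightarrow> fps_nth F l = fps_nth G l"
  shows "expands N s F x \<longleftrightarrow> expands N s G x"
  unfolding expands_def by (rule arg_cong[where f = "poly_bounded _"]) (use assms in \<open>auto intro!: ext sum.cong\<close>)

lemma expands_add:
  assumes "expands N s F x" "expands N s G y"
  shows "expands N s (F + G) (\<lambda>n. x n + y n)"
proof -
  have eq: "x n + y n - (\<Sum>l<N. fps_nth (F + G) l * rGamma_powr (s - of_nat l) n) =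
    (x n - (\<Sum>l<N. fps_nth F l * rGamma_powr (s - of_nat l) n)) +
    (y n - (\<Sum>l<N. fps_nth G l * rGamma_powr (s - of_nat l) n))" for n
    by (simp add: sum.distrib distrib_right)
  show ?thesis unfolding expands_def eq by (intro poly_bounded_add assms[unfolded expands_def])
qed

lemma expands_cmult:
  assumes "expands N s F x"
  shows "expands N s (fps_const c * F) (\<lambda>n. c * x n)"
proof -
  have eq: "c * x n - (\<Sum>l<N. fps_nth (fps_const c * F) l * rGamma_powr (s - of_nat l) n) =
    c * (x n - (\<Sum>l<N. fps_nth F l * rGamma_powr (s - of_nat l) n))" for n
    by (simp add: sum_distrib_left right_diff_distrib mult.assoc)
  show ?thesis unfolding expands_def eq by (intro poly_bounded_cmult assms[unfolded expands_def])
qed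

lemma expands_diff:
  assumes "expands N s F x" "expands N s G y"
  shows "expands N s (F - G) (\<lambda>n. x n - y n)"
proof -
  have "fps_const (- 1) * G = - G" by (rule fps_ext) simp
  with expands_add[OF assms(1) expands_cmult[OF assms(2), of "-1"]] show ?thesis by simp
qed

lemma expands_zero: "expands N s 0 (\<lambda>n. 0)"
  by (simp add: expands_def poly_bounded_zero)

lemma expands_sum:
  assumes "\<And>i. i \<in> I \<Longrightarrow> expands N s (F i) (x i)"
  shows "expands N s (\<Sum>i\<in>I. F i) (\<lambda>n. \<Sum>i\<in>I. x i n)"
  using assms
  by (induction I rule: infinite_finite_induct) (auto intro: expands_add simp: expands_zero)

lemma expands_0_iff: "expands 0 s F x \<longleftrightarrow> poly_bounded (Re s - 1) x"
  by (simp add: expands_def)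

text \<open>Truncation after N terms at s is truncation after N - k terms at s - k, so the
  hypothesis covers all orders. If k > N, no term is left and the bound of order 0 suffices.\<close>

lemma expands_X_power_mult:
  assumes "\<And>N. expands N (s - of_nat k) F x"
  shows "expands N s (fps_X ^ k * F) x"
proof (cases "k \<le> N")
  case True
  have "(\<Sum>l<N. fps_nth (fps_X ^ k * F) l * rGamma_powr (s - of_nat l) n) =
      (\<Sum>l<N - k. fps_nth F l * rGamma_powr (s - of_nat k - of_nat l) n)" for n
  proof -
    have "(\<Sum>l<N. fps_nth (fps_X ^ k * F) l * rGamma_powr (s - of_nat l) n) =
        (\<Sum>l\<in>{k..<N}. fps_nth F (l - k) * rGamma_powr (s - of_nat l) n)"
      by (rule sum.mono_neutral_cong_right) (auto simp: fps_X_power_mult_nth)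
    also have "\<dots> = (\<Sum>l<N - k. fps_nth F l * rGamma_powr (s - of_nat k - of_nat l) n)"
      by (rule sum.reindex_bij_witness[of _ "\<lambda>l. l + k" "\<lambda>l. l - k"]) (auto simp: of_nat_diff algebra_simps)
    finally show ?thesis .
  qed
  moreover have "Re (s - of_nat k) - 1 - real (N - k) = Re s - 1 - real N"
    using True by (simp add: of_nat_diff)
  ultimately show ?thesis using assms[of "N - k"] unfolding expands_def by (simp only:)
next
  case False
  have "(\<Sum>l<N. fps_nth (fps_X ^ k * F) l * rGamma_powr (s - of_nat l) n) = 0" for n
    using False by (intro sum.neutral) (auto simp: fps_X_power_mult_nth)
  moreover have "poly_bounded (Re s - 1 - real N) x"
    by (rule poly_bounded_mono[OF assms[of 0, unfolded expands_0_iff]]) (use False in simp)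
  ultimately show ?thesis unfolding expands_def by simp
qed

text \<open>In the dictionary above, - d / dh applied to h powr (-s) * F is h powr (-s - 1) * (s * F
  - h * F').\<close>

lemma expands_of_nat_mult:
  assumes "expands N s F x"
  shows "expands N (s + 1) (fps_const s * F - fps_X * fps_deriv F) (\<lambda>n. of_nat n * x n)"
proof -
  have nth: "fps_nth (fps_const s * F - fps_X * fps_deriv F) l = (s - of_nat l) * fps_nth F l" for l
    by (cases l) (simp_all add: algebra_simps)
  have "of_nat n * x n - (\<Sum>l<N. (s - of_nat l) * fps_nth F l * rGamma_powr (s + 1 - of_nat l) n) =
      (x n - (\<Sum>l<N. fps_nth F l * rGamma_powr (s - of_nat l) n)) * of_nat n powr 1" for n
  proof -
    have "(\<Sum>l<N. (s - of_nat l) * fps_nth F l * rGamma_powr (s + 1 - of_nat l) n) =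
      (\<Sum>l<N. fps_nth F l * rGamma_powr (s - of_nat l) n) * of_nat n"
      unfolding sum_distrib_right
    proof (rule sum.cong)
      fix l
      show "(s - of_nat l) * fps_nth F l * rGamma_powr (s + 1 - of_nat l) n
        = fps_nth F l * rGamma_powr (s - of_nat l) n * of_nat n"
        using of_nat_mult_rGamma_powr[of n "s - of_nat l"]
        by (simp add: diff_add_eq mult.commute mult.left_commute)
    qed simp
    then show ?thesis by (simp add: algebra_simps)
  qed
  moreover have "poly_bounded (Re s - 1 - real N + Re 1)
    (\<lambda>n. (x n - (\<Sum>l<N. fps_nth F l * rGamma_powr (s - of_nat l) n)) * of_nat n powr 1)"
    by (rule poly_bounded_mult[OF assms[unfolded expands_def] poly_bounded_of_nat_powr])
  moreover have "Re s - 1 - real N + Re 1 = Re (s + 1) - 1 - real N" by simp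
  ultimately show ?thesis unfolding expands_def nth by (simp only:)
qed

lemma expands_rGamma_powr: "expands N s 1 (rGamma_powr s)"
proof (cases "N = 0")
  case True
  then show ?thesis by (simp add: expands_0_iff poly_bounded_rGamma_powr)
next
  case False
  then have "(\<Sum>l<N. fps_nth 1 l * rGamma_powr (s - of_nat l) n) = rGamma_powr s n" for n
    by (subst sum.remove[of _ 0]) auto
  then show ?thesis by (simp add: expands_def poly_bounded_zero)
qed

lemma has_fps_expansion_remainder:
  fixes f :: "complex \<Rightarrow> complex"
  assumes "f has_fps_expansion F"
  obtains g where "isCont g 0" "g 0 = fps_nth F N"
    "eventually (\<lambda>z. f z = (\<Sum>k<N. fps_nth F k * z ^ k) + z ^ N * g z) (nhds 0)"
proof -
  define g where "g = eval_fps (fps_shift N F)"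
  have rad: "fps_conv_radius F > 0" using assms by (simp add: has_fps_expansion_def)
  have g: "g has_fps_expansion fps_shift N F"
    unfolding g_def using rad by (intro eval_fps_has_fps_expansion) simp
  have "(\<lambda>z. (\<Sum>k<N. fps_nth F k * z ^ k) + z ^ N * g z) has_fps_expansion
     ((\<Sum>k<N. fps_const (fps_nth F k) * fps_X ^ k) + fps_X ^ N * fps_shift N F)"
    by (intro has_fps_expansion_add has_fps_expansion_sum has_fps_expansion_mult g
        has_fps_expansion_const has_fps_expansion_fps_X_power)
  also have "(\<Sum>k<N. fps_const (fps_nth F k) * fps_X ^ k) = fps_cutoff N F"
    by (rule fps_ext) (simp add: fps_sum_nth if_distrib[of "(*) _"] cong: if_cong)
  also have "fps_cutoff N F + fps_X ^ N * fps_shift N F = F"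
    by (subst add.commute) (rule fps_shift_cutoff')
  finally have "eventually (\<lambda>z. eval_fps F z = (\<Sum>k<N. fps_nth F k * z ^ k) + z ^ N * g z) (nhds 0)"
    by (simp add: has_fps_expansion_def)
  moreover have "eventually (\<lambda>z. eval_fps F z = f z) (nhds 0)"
    using assms by (simp add: has_fps_expansion_def)
  ultimately have "eventually (\<lambda>z. f z = (\<Sum>k<N. fps_nth F k * z ^ k) + z ^ N * g z) (nhds 0)"
    by eventually_elim simp
  moreover have "isCont g 0" using g by (rule has_fps_expansion_imp_continuous)
  moreover have "g 0 = fps_nth F N" by (simp add: g_def eval_fps_at_0)
  ultimately show ?thesis using that by blast
qed

lemma rGamma_mult_gbinomial: "rGamma s * ((s - 1) gchoose k) = rGamma (s - of_nat k) / fact k"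
proof -
  have "rGamma s * (\<Prod>i = 0..<k. s - 1 - of_nat i) = rGamma (s - of_nat k)"
  proof (induction k)
    case (Suc k)
    have "rGamma s * (\<Prod>i = 0..<Suc k. s - 1 - of_nat i) = rGamma (s - of_nat k) * (s - 1 - of_nat k)"
      using Suc.IH by (simp add: mult.assoc[symmetric])
    also have "\<dots> = rGamma (s - of_nat (Suc k))"
      using rGamma_plus1[of "s - of_nat (Suc k)"] by (simp add: algebra_simps)
    finally show ?case .
  qed simp
  then show ?thesis by (simp add: gbinomial_prod_rev field_simps)
qed

text \<open>Expand (1 - 1 / n) powr (s - 1) by the binomial series. The factor 1 / Gamma(s) turns
  the binomial coefficient into 1 / (k! Gamma(s - k)), so that the coefficients (-1)^k / k! are free
  of s: this is the purpose of normalising by \<open>rGamma\<close>.\<close>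

lemma expands_rGamma_powr_delay: "expands N s (fps_exp (- 1)) (\<lambda>n. rGamma_powr s (n - 1))"
proof -
  obtain g where g: "isCont g 0" "g 0 = fps_nth (fps_binomial (s - 1)) N"
    "eventually (\<lambda>z. (1 + z) powr (s - 1) =
       (\<Sum>k<N. fps_nth (fps_binomial (s - 1)) k * z ^ k) + z ^ N * g z) (nhds 0)"
    by (rule has_fps_expansion_remainder[OF has_fps_expansion_binomial_complex[of "s - 1"], of N]) blast
  have lim: "(\<lambda>n. - inverse (of_nat n) :: complex) \<longlonglongrightarrow> 0"
    using tendsto_minus[OF lim_inverse_n] by simp
  have ev: "eventually (\<lambda>n. rGamma_powr s (n - 1) -
      (\<Sum>l<N. fps_nth (fps_exp (- 1)) l * rGamma_powr (s - of_nat l) n) =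
      rGamma s * (- 1) ^ N * g (- inverse (of_nat n)) * of_nat n powr (s - 1 - of_nat N)) at_top"
    using eventually_compose_filterlim[OF g(3) lim] eventually_gt_at_top[of 1]
  proof eventually_elim
    case (elim n)
    define z where "z = - inverse (of_nat n :: complex)"
    define w where "w = of_nat n powr (s - 1)"
    have n: "of_nat n \<noteq> (0::complex)" using elim by simp
    have pow: "w * z ^ k = (- 1) ^ k * of_nat n powr (s - 1 - of_nat k)" for k
      using n by (simp add: w_def z_def powr_diff powr_nat power_minus[of "inverse _"] divide_inverse power_inverse)
    have "of_nat (n - 1) = of_real (real n) * (of_real (1 - 1 / real n) :: complex)"
      using elim(2) by (simp add: field_simps of_nat_diff)
    then have "of_nat (n - 1) powr (s - 1) = w * of_real (1 - 1 / real n) powr (s - 1)"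
      using elim(2) by (simp only: w_def) (subst powr_times_real, auto simp: field_simps)
    also have "of_real (1 - 1 / real n) = 1 + z" by (simp add: z_def divide_inverse)
    also have "w * (1 + z) powr (s - 1) =
      (\<Sum>k<N. ((s - 1) gchoose k) * (w * z ^ k)) + (w * z ^ N) * g z"
      unfolding elim(1)[folded z_def] by (simp add: distrib_left sum_distrib_left mult_ac)
    finally have "rGamma_powr s (n - 1) =
      (\<Sum>k<N. (rGamma s * ((s - 1) gchoose k)) * (w * z ^ k)) + rGamma s * (w * z ^ N) * g z"
      by (simp only: rGamma_powr_def distrib_left sum_distrib_left mult.assoc)
    also have "(\<Sum>k<N. (rGamma s * ((s - 1) gchoose k)) * (w * z ^ k)) =
      (\<Sum>l<N. fps_nth (fps_exp (- 1)) l * rGamma_powr (s - of_nat l) n)"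
      unfolding rGamma_mult_gbinomial pow
      by (intro sum.cong refl) (simp add: rGamma_powr_def diff_diff_eq add.commute[of 1])
    finally show ?case unfolding pow by (simp add: z_def mult_ac)
  qed
  have "(\<lambda>n. rGamma s * (- 1) ^ N * g (- inverse (of_nat n))) \<longlonglongrightarrow> rGamma s * (- 1) ^ N * g 0"
    by (intro tendsto_intros isCont_tendsto_compose[OF g(1) lim])
  then have "Bseq (\<lambda>n. rGamma s * (- 1) ^ N * g (- inverse (of_nat n)))"
    by (intro convergent_imp_Bseq) (auto simp: convergent_def)
  then obtain C where C: "\<And>n. norm (rGamma s * (- 1) ^ N * g (- inverse (of_nat n))) \<le> C"
    unfolding Bseq_def by blast
  show ?thesis unfolding expands_def
  proof (rule poly_bounded_eventually_norm_le[of _ C], rule eventually_mono[OF ev])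
    fix n
    assume *: "rGamma_powr s (n - 1) - (\<Sum>l<N. fps_nth (fps_exp (- 1)) l * rGamma_powr (s - of_nat l) n)
      = rGamma s * (- 1) ^ N * g (- inverse (of_nat n)) * of_nat n powr (s - 1 - of_nat N)"
    show "norm (rGamma_powr s (n - 1) - (\<Sum>l<N. fps_nth (fps_exp (- 1)) l * rGamma_powr (s - of_nat l) n))
      \<le> C * real n powr (Re s - 1 - real N)"
      unfolding * norm_mult[of _ "_ powr _"] norm_of_nat_powr using C[of n] by (simp add: mult_right_mono)
  qed
qed

text \<open>The differences beyond n are compared with the telescoping 1 / k - 1 / (k + 1) after (n
  + 1) powr (1 - N) has been split off, so their sum is one power of n larger than the
  terms.\<close>

lemma poly_bounded_diff_limit:
  assumes y: "poly_bounded (- real N - 1) (\<lambda>n. q n - q (n - 1))" and "N \<ge> 1" and lim: "q \<longlonglongrightarrow> L"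
  shows "poly_bounded (- real N) (\<lambda>n. q n - L)"
proof -
  obtain C where C: "C > 0" "\<And>n. norm (q n - q (n - 1)) \<le> C * real (Suc n) powr (- real N - 1)"
    using y poly_boundedE by blast
  have step: "real (Suc k) powr (- real N - 1)
      \<le> real (Suc n) powr (1 - real N) * (1 / real k - 1 / real (Suc k))" if "n < k" for n k
  proof -
    have "real (Suc k) powr (- real N - 1) = real (Suc k) powr (1 - real N) * real (Suc k) powr (- 2)"
      by (subst powr_add[symmetric]) (rule arg_cong[where f = "\<lambda>t. _ powr t"], simp)
    also have "\<dots> \<le> real (Suc n) powr (1 - real N) * (1 / real k - 1 / real (Suc k))"
    proof (rule mult_mono)
      show "real (Suc k) powr (1 - real N) \<le> real (Suc n) powr (1 - real N)"
        using that \<open>N \<ge> 1\<close> by (intro powr_mono2') auto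
      have "real (Suc k) powr (- 2) = 1 / (real (Suc k) * real (Suc k))"
        by (simp add: powr_minus powr_numeral power2_eq_square divide_inverse)
      also have "\<dots> \<le> 1 / (real k * real (Suc k))" using that by (intro divide_left_mono mult_right_mono) auto
      also have "\<dots> = 1 / real k - 1 / real (Suc k)" using that by (simp add: field_simps)
      finally show "real (Suc k) powr (- 2) \<le> 1 / real k - 1 / real (Suc k)" .
    qed auto
    finally show ?thesis .
  qed
  have *: "norm (q (n + m) - q n) \<le> C * real (Suc n) powr (1 - real N) * (1 / real (Suc n) - 1 / real (Suc (n + m)))" for n m
  proof (induction m)
    case (Suc m)
    have "norm (q (n + Suc m) - q n) \<le> norm (q (n + m) - q n) + norm (q (Suc (n + m)) - q (Suc (n + m) - 1))"
      using norm_triangle_ineq[of "q (n + m) - q n" "q (Suc (n + m)) - q (n + m)"] by simp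
    also have "norm (q (Suc (n + m)) - q (Suc (n + m) - 1))
        \<le> C * (real (Suc n) powr (1 - real N) * (1 / real (Suc (n + m)) - 1 / real (Suc (Suc (n + m)))))"
      by (rule order_trans[OF C(2)]) (use C(1) in \<open>intro mult_left_mono step, auto\<close>)
    finally show ?case using Suc.IH by (simp add: algebra_simps)
  qed simp
  have "norm (q n - L) \<le> C * real (Suc n) powr (- real N)" for n
  proof -
    have "(\<lambda>m. norm (q (n + m) - q n)) \<longlonglongrightarrow> norm (L - q n)"
      using LIMSEQ_ignore_initial_segment[OF lim, of n] by (intro tendsto_intros) (simp add: add.commute)
    moreover have "norm (q (n + m) - q n) \<le> C * real (Suc n) powr (- real N)" for m
    proof -
      have "norm (q (n + m) - q n) \<le> C * real (Suc n) powr (1 - real N) * (1 / real (Suc n))"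
        by (rule order_trans[OF *]) (use C(1) in \<open>intro mult_left_mono, auto\<close>)
      also have "\<dots> = C * real (Suc n) powr (- real N)"
        by (simp add: powr_diff powr_minus divide_inverse)
      finally show ?thesis .
    qed
    ultimately show ?thesis by (intro LIMSEQ_le_const2[of _ "norm (q n - L)"]) (auto simp: norm_minus_commute)
  qed
  then show ?thesis by (rule poly_boundedI)
qed


section \<open>The series of 1 - exp(-h) and its powers\<close>

definition Z_fps :: "complex fps" where "Z_fps = 1 - fps_exp (- 1)"

text \<open>The series of (1 - exp(-h)) / h. Once a delay is read as exp(-h), 1 - exp(-h) is the
  backward difference, and also the value of 1 - \<zeta> at \<zeta> = exp(-h).\<close>

definition \<phi>_fps :: "complex fps" where "\<phi>_fps = Abs_fps (\<lambda>k. (- 1) ^ k / fact (Suc k))"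

text \<open>The series of \<open>((1 - exp (- h)) / h) powr (- s)\<close>.\<close>
definition \<Phi>_fps :: "complex \<Rightarrow> complex fps" where
  "\<Phi>_fps s = fps_binomial (- s) oo (\<phi>_fps - 1)"

lemma \<phi>_fps_nth_0 [simp]: "fps_nth \<phi>_fps 0 = 1"
  by (simp add: \<phi>_fps_def)

lemma Z_fps_eq: "Z_fps = fps_X * \<phi>_fps"
proof (rule fps_ext)
  fix n show "fps_nth Z_fps n = fps_nth (fps_X * \<phi>_fps) n"
    by (cases n) (simp_all add: Z_fps_def \<phi>_fps_def algebra_simps)
qed

lemma Z_fps_nth_0 [simp]: "fps_nth Z_fps 0 = 0"
  by (simp add: Z_fps_eq)

lemma \<Phi>_fps_add: "\<Phi>_fps (s + t) = \<Phi>_fps s * \<Phi>_fps t"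
  unfolding \<Phi>_fps_def minus_add_distrib fps_binomial_add_mult by (rule fps_compose_mult_distrib) simp

lemma \<Phi>_fps_0 [simp]: "\<Phi>_fps 0 = 1"
  by (simp add: \<Phi>_fps_def)

lemma \<Phi>_fps_minus_1: "\<Phi>_fps (- 1) = \<phi>_fps"
  by (simp add: \<Phi>_fps_def fps_binomial_1 fps_compose_add_distrib)

lemma \<Phi>_fps_diff_1: "\<Phi>_fps (s - 1) = \<phi>_fps * \<Phi>_fps s"
  using \<Phi>_fps_add[of "- 1" s] by (simp add: \<Phi>_fps_minus_1)

text \<open>The coefficients of (1 - X)^(k - s) naturally expand at s - k; this identity refers all
  of them to the same s.\<close>

lemma \<Phi>_fps_diff_of_nat: "fps_X ^ k * \<Phi>_fps (s - of_nat k) = Z_fps ^ k * \<Phi>_fps s"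
proof (induction k)
  case (Suc k)
  have "\<Phi>_fps (s - of_nat (Suc k)) = \<phi>_fps * \<Phi>_fps (s - of_nat k)"
    using \<Phi>_fps_diff_1[of "s - of_nat k"] by (simp add: algebra_simps)
  then have "fps_X ^ Suc k * \<Phi>_fps (s - of_nat (Suc k))
      = (fps_X * \<phi>_fps) * (fps_X ^ k * \<Phi>_fps (s - of_nat k))" by (simp add: mult_ac)
  then show ?case unfolding Suc.IH Z_fps_eq by (simp add: mult_ac)
qed simp

lemma \<Phi>_fps_nth_0 [simp]: "fps_nth (\<Phi>_fps s) 0 = 1"
  by (simp add: \<Phi>_fps_def)

lemma fps_deriv_\<Phi>_fps: "fps_deriv (\<Phi>_fps (s - 1)) = fps_const (1 - s) * \<Phi>_fps s * fps_deriv \<phi>_fps"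
proof -
  have binom: "fps_binomial (c + 1) = fps_binomial c * (1 + fps_X)" for c :: complex
    by (simp add: fps_binomial_add_mult fps_binomial_1)
  have c: "fps_const (1 - s) * A = A + fps_const (- s) * A" for A
    by (rule fps_ext) (simp add: algebra_simps)
  have unit: "(1 + fps_X :: complex fps) \<noteq> 0"
  proof
    assume "(1 + fps_X :: complex fps) = 0"
    then have "fps_nth (1 + fps_X :: complex fps) 0 = 0" by (simp only: fps_zero_nth)
    then show False by simp
  qed
  have "fps_deriv (fps_binomial (1 - s)) = fps_const (1 - s) * fps_binomial (- s)"
    using binom[of "- s"] unit by (simp add: fps_binomial_deriv c[of "fps_binomial _"] mult.assoc[symmetric])
  moreover have "fps_deriv (\<Phi>_fps (s - 1)) =
      (fps_deriv (fps_binomial (1 - s)) oo (\<phi>_fps - 1)) * fps_deriv (\<phi>_fps - 1)"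
    unfolding \<Phi>_fps_def by (subst fps_compose_deriv) simp_all
  ultimately show ?thesis
    by (simp add: \<Phi>_fps_def fps_compose_mult_distrib)
qed

text \<open>The recurrence \<open>n * (u n - u (n - 1)) = (s - 1) * u (n - 1)\<close> of the
  binomial coefficients reads - d / dh (Z powr (1 - s)) = (s - 1) * exp(-h) * Z powr (-s) with Z = 1
  - exp(-h). This is that equation multiplied by h powr (s + 1), where Z powr (-s) = h powr (-s) *
  \<Phi>.\<close>

lemma \<Phi>_fps_ode:
  "fps_const s * (\<Phi>_fps s * Z_fps) - fps_X * fps_deriv (\<Phi>_fps s * Z_fps)
     = fps_X * (fps_const (s - 1) * (\<Phi>_fps s * fps_exp (- 1)))"
proof -
  have Z': "\<phi>_fps + fps_X * fps_deriv \<phi>_fps = fps_exp (- 1)"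
  proof -
    have "fps_const (- 1) * fps_exp (- 1) = - fps_exp (- 1 :: complex)" by (rule fps_ext) simp
    then show ?thesis using arg_cong[OF Z_fps_eq, of fps_deriv] unfolding Z_fps_def by (simp add: add.commute)
  qed
  have eq: "\<Phi>_fps s * Z_fps = fps_X * \<Phi>_fps (s - 1)"
    unfolding Z_fps_eq \<Phi>_fps_diff_1 by (simp add: mult_ac)
  have c: "fps_const s = fps_const (s - 1) + 1" "fps_const (1 - s) = - fps_const (s - 1)"
    by (rule fps_ext, simp)+
  have "fps_const s * (\<Phi>_fps s * Z_fps) - fps_X * fps_deriv (\<Phi>_fps s * Z_fps)
      = fps_X * (fps_const (s - 1) * \<Phi>_fps (s - 1) - fps_X * fps_deriv (\<Phi>_fps (s - 1)))"
    unfolding eq by (simp add: c(1) algebra_simps)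
  also have "fps_const (s - 1) * \<Phi>_fps (s - 1) - fps_X * fps_deriv (\<Phi>_fps (s - 1))
      = fps_const (s - 1) * (\<Phi>_fps s * (\<phi>_fps + fps_X * fps_deriv \<phi>_fps))"
  proof -
    define k where "k = fps_const (s - 1)"
    have "fps_const (1 - s) = - k" using c(2) by (simp only: k_def)
    then show ?thesis unfolding fps_deriv_\<Phi>_fps k_def[symmetric] unfolding \<Phi>_fps_diff_1
      by (simp add: algebra_simps)
  qed
  finally show ?thesis unfolding Z' .
qed

lemma fps_mult_nth_cong:
  assumes "\<And>l. l < N \<Longrightarrow> fps_nth A l = fps_nth B l" "j < N"
  shows "fps_nth (A * C) j = fps_nth (B * C) j"
  unfolding fps_mult_nth using assms by (intro sum.cong) auto

text \<open>As \<open>Z_fps\<close> has no constant term, one coefficient more of the product is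
  determined than of the factor.\<close>

lemma fps_mult_Z_fps_nth_cong:
  assumes "\<And>l. l < N \<Longrightarrow> fps_nth A l = fps_nth B l" "j < Suc N"
  shows "fps_nth (A * Z_fps) j = fps_nth (B * Z_fps) j"
  unfolding fps_mult_nth
proof (rule sum.cong)
  fix i assume i: "i \<in> {0..j}"
  show "fps_nth A i * fps_nth Z_fps (j - i) = fps_nth B i * fps_nth Z_fps (j - i)"
    using i assms by (cases "i = j") auto
qed simp

text \<open>
  The truncated expansion \<open>D\<close> satisfies the recurrence \<open>n u\<^sub>n = (n + s - 1) u\<^sub>n\<^sub>-\<^sub>1\<close> of the binomial
  coefficients up to a small error, and has the same leading behaviour.
\<close>
lemma expands_one_minus_X_powr: "expands N s (\<Phi>_fps s) (fps_nth (one_minus_X_powr (- s)))"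
proof (cases "s \<in> \<int>\<^sub>\<le>\<^sub>0")
  case True
  then obtain k where k: "s = - of_nat k" by (auto elim!: nonpos_Ints_cases')
  \<comment> \<open>Here (1 - X)^(-s) is a polynomial, and every term of the expansion vanishes at a
    pole of Gamma.\<close>
  have "rGamma_powr (s - of_nat l) n = 0" for l n
  proof -
    have "s - of_nat l = - of_nat (k + l)" by (simp add: k)
    then have "rGamma (s - of_nat l) = 0" by (simp only: rGamma_eq_zero_iff minus_of_nat_in_nonpos_Ints)
    then show ?thesis by (simp add: rGamma_powr_def)
  qed
  moreover have "coeff_bounded q (one_minus_X_powr (- s))" for q
    by (rule coeff_bounded_finite_support[of k])
       (simp add: one_minus_X_powr_def k pochhammer_of_nat_eq_0_lemma)
  ultimately show ?thesis by (simp add: expands_def)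
next
  case False
  define u where "u = fps_nth (one_minus_X_powr (- s))"
  have u_nz: "u n \<noteq> 0" for n
    using False by (auto simp: u_def one_minus_X_powr_def dest: pochhammer_eq_0_imp_nonpos_Int)
  have u_rec: "of_nat n * u n = (of_nat n + s - 1) * u (n - 1)" if n: "n > 0" for n
  proof -
    obtain m where "n = Suc m" using n gr0_implies_Suc by blast
    then show ?thesis
      by (simp add: u_def one_minus_X_powr_def pochhammer_rec' add.commute fact_Suc del: of_nat_Suc) simp
  qed
  have u_lim: "(\<lambda>n. u n * of_nat n powr (1 - s)) \<longlonglongrightarrow> rGamma s"
    unfolding u_def by (rule one_minus_X_powr_asymp)
  have rG: "rGamma s \<noteq> 0" using False by (simp add: rGamma_eq_zero_iff)
  have u_bd: "poly_bounded (Re s - 1) u"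
    unfolding u_def using coeff_bounded_one_minus_X_powr[of "- s"] by simp
  have inv_powr: "inverse (of_nat n powr (1 - s)) = (of_nat n powr (s - 1) :: complex)" for n
    using powr_minus[of "of_nat n :: complex" "1 - s"] by simp
  have inv_bd: "poly_bounded (1 - Re s) (\<lambda>n. 1 / u n)"
  proof -
    have "(\<lambda>n. inverse (u n * of_nat n powr (1 - s))) \<longlonglongrightarrow> inverse (rGamma s)"
      by (intro tendsto_intros u_lim rG)
    moreover have "inverse (u n * of_nat n powr (1 - s)) = (1 / u n) * of_nat n powr (- (1 - s))" for n
      by (simp add: inv_powr divide_inverse)
    ultimately have "(\<lambda>n. (1 / u n) * of_nat n powr (- (1 - s))) \<longlonglongrightarrow> inverse (rGamma s)" by (simp only:)
    from poly_bounded_of_nat_powr_mult_convergent[OF this] show ?thesis by simp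
  qed
  show ?thesis
  proof (cases "N = 0")
    case True
    then show ?thesis using u_bd by (simp add: expands_0_iff u_def)
  next
    case N: False
    define T where "T = fps_cutoff N (\<Phi>_fps s)"
    define D where "D = (\<lambda>n. \<Sum>l<N. fps_nth (\<Phi>_fps s) l * rGamma_powr (s - of_nat l) n)"
    have T_eq: "(\<Sum>l<N. fps_const (fps_nth (\<Phi>_fps s) l) * (fps_X ^ l * A)) = T * A" for A
    proof -
      have "(\<Sum>l<N. fps_const (fps_nth (\<Phi>_fps s) l) * fps_X ^ l) = T"
        unfolding T_def by (rule fps_ext) (simp add: fps_sum_nth if_distrib[of "(*) _"] cong: if_cong)
      then show ?thesis by (simp only: sum_distrib_right[symmetric] mult.assoc[symmetric])
    qed
    have D: "expands M s T D" for M
    proof -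
      have "expands M s (\<Sum>l<N. fps_const (fps_nth (\<Phi>_fps s) l) * (fps_X ^ l * 1)) D"
        unfolding D_def by (intro expands_sum expands_cmult expands_X_power_mult expands_rGamma_powr)
      then show ?thesis unfolding T_eq by simp
    qed
    have D_delay: "expands M s (T * fps_exp (- 1)) (\<lambda>n. D (n - 1))" for M
    proof -
      have "expands M s (\<Sum>l<N. fps_const (fps_nth (\<Phi>_fps s) l) * (fps_X ^ l * fps_exp (- 1))) (\<lambda>n. D (n - 1))"
        unfolding D_def by (intro expands_sum expands_cmult expands_X_power_mult expands_rGamma_powr_delay)
      then show ?thesis unfolding T_eq .
    qed
    have T_nth: "fps_nth T l = fps_nth (\<Phi>_fps s) l" if "l < N" for l using that by (simp add: T_def)
    \<comment> \<open>The defect of \<open>D\<close> in the recurrence. Its two parts have the same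
      expansion up to order N + 1 by \<open>\<Phi>_fps_ode\<close>; this order is within reach
      because \<open>Z_fps\<close> and the factor X delay the effect of the truncation by one
      coefficient.\<close>
    define e where "e = (\<lambda>n. of_nat n * (D n - D (n - 1)) - (s - 1) * D (n - 1))"
    have "expands (Suc N) s (T * Z_fps) (\<lambda>n. D n - D (n - 1))"
      using expands_diff[OF D D_delay, of "Suc N"] by (simp add: Z_fps_def right_diff_distrib)
    then have "expands (Suc N) s (\<Phi>_fps s * Z_fps) (\<lambda>n. D n - D (n - 1))"
      by (subst expands_cong[of _ _ "T * Z_fps"]) (auto intro!: fps_mult_Z_fps_nth_cong T_nth[symmetric])
    then have 1: "expands (Suc N) (s + 1) (fps_X * (fps_const (s - 1) * (\<Phi>_fps s * fps_exp (- 1))))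
        (\<lambda>n. of_nat n * (D n - D (n - 1)))"
      using expands_of_nat_mult[of "Suc N" s "\<Phi>_fps s * Z_fps"] by (simp only: \<Phi>_fps_ode)
    have "expands (Suc N) (s + 1) (fps_X ^ 1 * (fps_const (s - 1) * (T * fps_exp (- 1)))) (\<lambda>n. (s - 1) * D (n - 1))"
    proof (rule expands_X_power_mult)
      fix M show "expands M (s + 1 - of_nat 1) (fps_const (s - 1) * (T * fps_exp (- 1))) (\<lambda>n. (s - 1) * D (n - 1))"
        using expands_cmult[OF D_delay, of M "s - 1"] by simp
    qed
    then have 2: "expands (Suc N) (s + 1) (fps_X * (fps_const (s - 1) * (\<Phi>_fps s * fps_exp (- 1)))) (\<lambda>n. (s - 1) * D (n - 1))"
    proof (subst expands_cong[of _ _ "fps_X ^ 1 * (fps_const (s - 1) * (T * fps_exp (- 1)))"])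
      fix l assume "l < Suc N"
      then show "fps_nth (fps_X * (fps_const (s - 1) * (\<Phi>_fps s * fps_exp (- 1)))) l
        = fps_nth (fps_X ^ 1 * (fps_const (s - 1) * (T * fps_exp (- 1)))) l"
        using fps_mult_nth_cong[OF T_nth, of N "l - 1" "fps_exp (- 1)"] by (cases l) simp_all
    qed
    have e: "poly_bounded (Re s - 1 - real N) e"
      using expands_diff[OF 1 2] by (simp add: expands_def e_def diff_diff_eq)
    define q where "q = (\<lambda>n. D n / u n)"
    \<comment> \<open>Variation of constants: division by the exact solution \<open>u\<close> leaves
      the increments e n / (n * u n). At n = 0 both sides are 0, because n - 1 = 0 and 0 powr (-1) =
      0.\<close>
    have q_diff: "q n - q (n - 1) = e n * (1 / u n) * of_nat n powr (- 1)" for n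
    proof (cases "n = 0")
      case False
      have "q n - q (n - 1) = (D n - D (n - 1) * (u n / u (n - 1))) / u n"
        using u_nz[of n] by (simp add: q_def diff_divide_distrib)
      also have "u n / u (n - 1) = (of_nat n + s - 1) / of_nat n"
        using u_rec[of n] u_nz[of "n - 1"] False by (simp add: field_simps)
      also have "(D n - D (n - 1) * ((of_nat n + s - 1) / of_nat n)) / u n
          = (of_nat n * D n - D (n - 1) * (of_nat n + s - 1)) / of_nat n / u n"
        using False by (simp add: field_simps)
      also have "of_nat n * D n - D (n - 1) * (of_nat n + s - 1) = e n"
        by (simp add: e_def algebra_simps)
      finally show ?thesis using False by (simp add: powr_minus divide_inverse)
    qed (simp add: q_def)
    have "poly_bounded (Re s - 1 - real N + (1 - Re s) + Re (- 1)) (\<lambda>n. e n * (1 / u n) * of_nat n powr (- 1))"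
      by (intro poly_bounded_mult e inv_bd poly_bounded_of_nat_powr)
    moreover have "Re s - 1 - real N + (1 - Re s) + Re (- 1) = - real N - 1" by simp
    ultimately have "poly_bounded (- real N - 1) (\<lambda>n. q n - q (n - 1))"
      by (simp only: q_diff)
    \<comment> \<open>Only leading terms are compared; as N is not 0, \<open>T\<close> contains the
      constant coefficient 1 of \<Phi>.\<close>
    moreover have "q \<longlonglongrightarrow> 1"
    proof -
      have "expands 1 s T D" by (rule D)
      then have "poly_bounded (Re s - 2) (\<lambda>n. D n - rGamma_powr s n)"
        using N by (simp add: expands_def T_def)
      from poly_bounded_mult[OF this inv_bd]
      have "poly_bounded (- 1) (\<lambda>n. (D n - rGamma_powr s n) * (1 / u n))" by simp
      then have "(\<lambda>n. norm ((D n - rGamma_powr s n) * (1 / u n))) \<in> O(\<lambda>n. real n powr (- 1))"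
        by (simp add: poly_bounded_iff_bigo)
      also have "(\<lambda>n. real n powr (- 1)) \<in> o(\<lambda>n. 1 :: real)" by real_asymp
      finally have "(\<lambda>n. norm ((D n - rGamma_powr s n) * (1 / u n))) \<longlonglongrightarrow> 0"
        by (auto dest: smalloD_tendsto)
      then have lim1: "(\<lambda>n. (D n - rGamma_powr s n) * (1 / u n)) \<longlonglongrightarrow> 0"
        by (rule tendsto_norm_zero_cancel)
      have "(\<lambda>n. rGamma s / (u n * of_nat n powr (1 - s))) \<longlonglongrightarrow> rGamma s / rGamma s"
        by (intro tendsto_intros u_lim rG)
      moreover have "rGamma s / (u n * of_nat n powr (1 - s)) = rGamma_powr s n * (1 / u n)" for n
        by (simp add: rGamma_powr_def divide_inverse inv_powr)
      ultimately have "(\<lambda>n. rGamma_powr s n * (1 / u n)) \<longlonglongrightarrow> 1" using rG by simp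
      from tendsto_add[OF lim1 this] show ?thesis by (simp add: q_def diff_divide_distrib)
    qed
    ultimately have "poly_bounded (- real N) (\<lambda>n. q n - 1)"
      using N by (intro poly_bounded_diff_limit) auto
    from poly_bounded_mult[OF poly_bounded_cmult[OF this, of "-1"] u_bd]
    have "poly_bounded (- real N + (Re s - 1)) (\<lambda>n. - (q n - 1) * u n)" by simp
    moreover have "- real N + (Re s - 1) = Re s - 1 - real N" by simp
    moreover have "- (q n - 1) * u n = u n - D n" for n
      using u_nz[of n] by (simp add: q_def algebra_simps)
    ultimately show ?thesis by (simp only: expands_def u_def D_def)
  qed
qed

section \<open>Convolution of the weights with powers\<close>

lemma fps_conv_radius_one_minus_X_power: "fps_conv_radius ((1 - fps_X) ^ i :: complex fps) = \<infinity>"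
  using fps_conv_radius_power[of "1 - fps_X :: complex fps" i]
    fps_conv_radius_diff[of "1 :: complex fps" fps_X] by simp

lemma eval_sum_one_minus_X_power:
  "eval_fps (\<Sum>i<I. fps_const (c i) * (1 - fps_X) ^ i) z = (\<Sum>i<I. c i * (1 - z :: complex) ^ i)"
  "fps_conv_radius (\<Sum>i<I. fps_const (c i) * (1 - fps_X :: complex fps) ^ i) = \<infinity>"
proof -
  have mono: "fps_conv_radius (fps_const a * (1 - fps_X) ^ i :: complex fps) = \<infinity>" for a i
    using fps_conv_radius_mult[of "fps_const a" "(1 - fps_X) ^ i :: complex fps"]
    by (simp add: fps_conv_radius_one_minus_X_power)
  have rad: "fps_conv_radius (\<Sum>i<I. fps_const (c i) * (1 - fps_X :: complex fps) ^ i) = \<infinity>" for I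
  proof (induction I)
    case (Suc I)
    then show ?case
      using fps_conv_radius_add[of "\<Sum>i<I. fps_const (c i) * (1 - fps_X) ^ i" "fps_const (c I) * (1 - fps_X) ^ I"]
      by (simp add: mono)
  qed simp
  then show "fps_conv_radius (\<Sum>i<I. fps_const (c i) * (1 - fps_X :: complex fps) ^ i) = \<infinity>" .
  have eval: "eval_fps (fps_const a * (1 - fps_X) ^ i) z = a * (1 - z) ^ i" for a i
    by (subst eval_fps_mult) (simp_all add: fps_conv_radius_one_minus_X_power eval_fps_power eval_fps_diff
        fps_conv_radius_one_minus_X_power[of 1, simplified])
  show "eval_fps (\<Sum>i<I. fps_const (c i) * (1 - fps_X) ^ i) z = (\<Sum>i<I. c i * (1 - z) ^ i)"
    by (induction I) (simp_all add: eval_fps_add rad mono eval)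
qed

lemma eval_fps_split_initial_segment:
  fixes c :: "complex fps"
  assumes "ereal (norm x) < fps_conv_radius c"
  shows "eval_fps c x = (\<Sum>i<N. fps_nth c i * x ^ i) + x ^ N * eval_fps (fps_shift N c) x"
proof -
  have s1: "summable (\<lambda>n. fps_nth c n * x ^ n)" by (rule summable_fps[OF assms])
  have s2: "summable (\<lambda>n. fps_nth (fps_shift N c) n * x ^ n)" by (rule summable_fps) (use assms in simp)
  have "(\<Sum>n. fps_nth c (n + N) * x ^ (n + N)) = x ^ N * eval_fps (fps_shift N c) x"
    unfolding eval_fps_def by (subst suminf_mult[OF s2, symmetric]) (simp add: power_add mult_ac)
  then show ?thesis
    unfolding eval_fps_def[of c] by (subst suminf_split_initial_segment[OF s1, of N]) simp
qed

lemma coeff_bounded_one_minus_X_power: "coeff_bounded q ((1 - fps_X) ^ i)"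
  by (rule coeff_bounded_finite_support[of i])
     (simp add: one_minus_X_powr_of_nat[symmetric] one_minus_X_powr_def pochhammer_of_nat_eq_0_lemma)

section \<open>Taylor expansion of the generating function at 1\<close>

definition taylor_at_1 :: "(complex \<Rightarrow> complex) \<Rightarrow> complex fps" where
  "taylor_at_1 w = fps_expansion (\<lambda>x. w (1 - x)) 0"

lemma analytic_at_1_reflect:
  assumes "w analytic_on {1}"
  obtains \<epsilon> where "\<epsilon> > 0" "(\<lambda>x. w (1 - x)) has_fps_expansion taylor_at_1 w"
    "fps_conv_radius (taylor_at_1 w) \<ge> ereal \<epsilon>"
    "\<And>x. norm x < \<epsilon> \<Longrightarrow> eval_fps (taylor_at_1 w) x = w (1 - x)"
proof -
  obtain \<epsilon> where \<epsilon>: "\<epsilon> > 0" "w holomorphic_on ball 1 \<epsilon>"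
    using assms by (auto simp: analytic_on_def)
  have "w \<circ> (\<lambda>x. 1 - x) holomorphic_on ball 0 \<epsilon>"
    by (intro holomorphic_on_compose_gen[OF _ \<epsilon>(2)] holomorphic_intros) (auto simp: dist_norm)
  then have hol: "(\<lambda>x. w (1 - x)) holomorphic_on ball 0 \<epsilon>" by (simp add: o_def)
  have exp: "(\<lambda>x. w (1 - x)) has_fps_expansion taylor_at_1 w"
    unfolding taylor_at_1_def
    by (rule has_fps_expansion_fps_expansion[OF open_ball _ hol]) (use \<epsilon>(1) in simp)
  have rad: "fps_conv_radius (taylor_at_1 w) \<ge> ereal \<epsilon>"
    unfolding taylor_at_1_def by (rule conv_radius_fps_expansion) (use hol in simp)
  have "eval_fps (taylor_at_1 w) x = w (1 - x)" if "norm x < \<epsilon>" for x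
    using has_fps_expansion_imp_eval_fps_eq[OF exp that hol] .
  with \<epsilon>(1) exp rad that show ?thesis by blast
qed

text \<open>Multiplied by a high power of 1 - X the remainder becomes, up to a polynomial, the
  product of the weights with rapidly decaying binomial coefficients, so its coefficients are O(n
  powr q). The power can be divided out again without loss, since the remainder extends
  holomorphically to a neighbourhood of 1.\<close>

lemma coeff_bounded_taylor_remainder:
  fixes \<alpha> q :: real
  assumes gen: "generating_form \<alpha> \<omega> w" and bd: "coeff_bounded q (Abs_fps \<omega>)"
  defines "W \<equiv> one_minus_X_powr (of_real \<alpha>) * Abs_fps \<omega>"
  defines "c \<equiv> fps_nth (taylor_at_1 w)"
  shows "coeff_bounded q (one_minus_X_powr (- of_nat I) * (W - (\<Sum>i<I. fps_const (c i) * (1 - fps_X) ^ i)))"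
proof -
  define A where "A = Abs_fps \<omega>"
  have radA: "fps_conv_radius A \<ge> 1"
    unfolding A_def by (rule fps_conv_radius_ge_1_if_coeff_bounded[OF bd])
  have radW: "fps_conv_radius W \<ge> 1"
    using fps_conv_radius_mult[of "one_minus_X_powr (of_real \<alpha>)" A] radA
      fps_conv_radius_one_minus_X_powr[of "of_real \<alpha>"]
    unfolding W_def A_def[symmetric] by (simp add: min_def split: if_splits)
  have evalW: "eval_fps W z = w z" if "norm z < 1" for z
  proof -
    have z: "ereal (norm z) < fps_conv_radius A" "ereal (norm z) < fps_conv_radius (one_minus_X_powr (of_real \<alpha>))"
      using that radA fps_conv_radius_one_minus_X_powr[of "of_real \<alpha>"]
      by (auto intro: less_le_trans[of _ 1])
    have "1 - z \<noteq> 0" using that by auto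
    moreover have "eval_fps A z = (1 - z) powr (- of_real \<alpha>) * w z"
      using gen that z(1) unfolding generating_form_def A_def by blast
    moreover have "eval_fps W z = (1 - z) powr of_real \<alpha> * eval_fps A z"
      unfolding W_def A_def[symmetric] using z that by (simp add: eval_fps_mult eval_one_minus_X_powr)
    ultimately show ?thesis by (simp add: powr_minus)
  qed
  obtain \<epsilon> where \<epsilon>: "\<epsilon> > 0" "fps_conv_radius (taylor_at_1 w) \<ge> ereal \<epsilon>"
    "\<And>x. norm x < \<epsilon> \<Longrightarrow> eval_fps (taylor_at_1 w) x = w (1 - x)"
    using gen by (auto simp: generating_form_def elim: analytic_at_1_reflect)
  define P where "P = (\<Sum>i<I. fps_const (c i) * (1 - fps_X) ^ i)"
  define R where "R = one_minus_X_powr (- of_nat I) * (W - P)"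
  have radWP: "fps_conv_radius (W - P) \<ge> 1"
    using fps_conv_radius_diff[of W P] radW eval_sum_one_minus_X_power(2)[of c I]
    unfolding P_def[symmetric] by (simp add: min_def split: if_splits)
  have radR: "fps_conv_radius R \<ge> 1"
    using fps_conv_radius_mult[of "one_minus_X_powr (- of_nat I)" "W - P"] radWP
      fps_conv_radius_one_minus_X_powr[of "- of_nat I"]
    unfolding R_def[symmetric] by (simp add: min_def split: if_splits)
  define r where "r = (\<lambda>z. eval_fps (fps_shift I (taylor_at_1 w)) (1 - z))"
  have "r holomorphic_on ball 1 \<epsilon>"
  proof -
    have "ereal (norm x) < fps_conv_radius (taylor_at_1 w)" if "norm x < \<epsilon>" for x :: complex
      by (rule less_le_trans[OF _ \<epsilon>(2)]) (use that in simp)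
    then have "eval_fps (fps_shift I (taylor_at_1 w)) holomorphic_on ball 0 \<epsilon>"
      by (intro holomorphic_on_eval_fps) auto
    then have "eval_fps (fps_shift I (taylor_at_1 w)) \<circ> (\<lambda>z. 1 - z) holomorphic_on ball 1 \<epsilon>"
      by (rule holomorphic_on_compose_gen[rotated])
         (auto simp: dist_norm norm_minus_commute intro!: holomorphic_intros)
    then show ?thesis by (simp add: r_def o_def)
  qed
  moreover have "eval_fps R z = r z" if z: "z \<in> ball 1 \<epsilon>" "norm z < 1" for z
  proof -
    have nz: "1 - z \<noteq> 0" using z(2) by auto
    have small: "norm (1 - z) < \<epsilon>" using z(1) by (simp add: dist_norm)
    have "w z = eval_fps (taylor_at_1 w) (1 - z)" using \<epsilon>(3)[OF small] by simp
    also have "\<dots> = (\<Sum>i<I. c i * (1 - z) ^ i) + (1 - z) ^ I * r z"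
      unfolding c_def r_def
      by (rule eval_fps_split_initial_segment) (rule less_le_trans[OF _ \<epsilon>(2)], use small in simp)
    finally have "w z - (\<Sum>i<I. c i * (1 - z) ^ i) = (1 - z) ^ I * r z" by simp
    moreover have "eval_fps (W - P) z = w z - (\<Sum>i<I. c i * (1 - z) ^ i)"
      using evalW[OF z(2)] eval_sum_one_minus_X_power[of c I] less_le_trans[OF _ radW, of "ereal (norm z)"] z(2)
      by (simp add: P_def[symmetric] eval_fps_diff)
    moreover have "eval_fps R z = (1 - z) powr (- of_nat I) * eval_fps (W - P) z"
      unfolding R_def using z(2) less_le_trans[OF _ radWP, of "ereal (norm z)"]
        less_le_trans[OF _ fps_conv_radius_one_minus_X_powr, of "ereal (norm z)" "- of_nat I"]
      by (subst eval_fps_mult) (simp_all add: eval_one_minus_X_powr)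
    ultimately show ?thesis using nz by (simp add: powr_minus powr_nat)
  qed
  moreover have "\<exists>m. coeff_bounded q ((1 - fps_X) ^ m * R)"
  proof -
    \<comment> \<open>The coefficients of (1 - X)^(K + \<alpha>) are O(n powr (- K - \<alpha> - 1)),
      and convolution with the weights asks for the exponent - |q| - 2.\<close>
    define K where "K = nat \<lceil>\<bar>q\<bar> + 1 + \<bar>\<alpha>\<bar>\<rceil>"
    have K: "real K \<ge> \<bar>q\<bar> + 1 + \<bar>\<alpha>\<bar>" unfolding K_def by linarith
    have "(1 - fps_X) ^ (K + I) * R = (1 - fps_X) ^ K *
        ((one_minus_X_powr (of_nat I) * one_minus_X_powr (- of_nat I)) * (W - P))"
      unfolding R_def one_minus_X_powr_of_nat by (simp add: power_add mult_ac)
    also have "one_minus_X_powr (of_nat I) * one_minus_X_powr (- of_nat I) = 1"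
      by (simp flip: one_minus_X_powr_add)
    also have "(1 - fps_X) ^ K * (1 * (W - P)) =
        A * one_minus_X_powr (of_nat K + of_real \<alpha>) - (\<Sum>i<I. fps_const (c i) * (1 - fps_X) ^ (K + i))"
      unfolding W_def P_def A_def[symmetric] one_minus_X_powr_add one_minus_X_powr_of_nat
      by (simp add: right_diff_distrib sum_distrib_left power_add mult_ac)
    finally have eq: "(1 - fps_X) ^ (K + I) * R = A * one_minus_X_powr (of_nat K + of_real \<alpha>)
        - (\<Sum>i<I. fps_const (c i) * (1 - fps_X) ^ (K + i))" .
    have "coeff_bounded (- \<bar>q\<bar> - 2) (one_minus_X_powr (of_nat K + of_real \<alpha>))"
      by (rule poly_bounded_mono[OF coeff_bounded_one_minus_X_powr]) (use K in simp)
    then have "coeff_bounded q ((1 - fps_X) ^ (K + I) * R)"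
      unfolding eq using bd unfolding A_def
      by (intro coeff_bounded_diff coeff_bounded_mult coeff_bounded_sum coeff_bounded_const_mult
          coeff_bounded_one_minus_X_power)
    then show ?thesis by blast
  qed
  ultimately have "coeff_bounded q R"
    using coeff_bounded_divide_one_minus_X[OF _ radR \<epsilon>(1)] by blast
  then show ?thesis by (simp only: R_def P_def)
qed

section \<open>Expansion of n powr (\<beta> - 1) in binomial coefficients\<close>

lemma fps_compose_nth_truncated:
  fixes b Z :: "complex fps"
  assumes "fps_nth Z 0 = 0" "l < N"
  shows "fps_nth (\<Sum>k<N. fps_const (fps_nth b k) * Z ^ k) l = fps_nth (b oo Z) l"
proof -
  have "(\<Sum>k<N. fps_nth b k * fps_nth (Z ^ k) l) = (\<Sum>k = 0..l. fps_nth b k * fps_nth (Z ^ k) l)"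
    by (rule sum.mono_neutral_right) (use assms startsby_zero_power_prefix[OF assms(1)] in auto)
  then show ?thesis by (simp add: fps_sum_nth fps_compose_nth)
qed

text \<open>The b for which n powr (\<beta> - 1) expands into b_k times the coefficients of (1 -
  X)^(k - \<beta>). In terms of h this means b(Z) * Z powr (-\<beta>) = Gamma(\<beta>) * h powr
  (-\<beta>), that is, b(Z) = Gamma(\<beta>) * (Z / h) powr \<beta>, solved for b by inverting Z = 1
  - exp(-h).\<close>

definition binomial_series_coeffs :: "complex \<Rightarrow> complex fps" where
  "binomial_series_coeffs \<beta> = fps_const (Gamma \<beta>) * (\<Phi>_fps (- \<beta>) oo fps_inv Z_fps)"

lemma binomial_series_coeffs_compose:
  "(binomial_series_coeffs \<beta> oo Z_fps) * \<Phi>_fps \<beta> = fps_const (Gamma \<beta>)"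
proof -
  have Z1: "fps_nth Z_fps 1 \<noteq> 0" by (simp add: Z_fps_eq)
  have "(\<Phi>_fps (- \<beta>) oo fps_inv Z_fps) oo Z_fps = \<Phi>_fps (- \<beta>) oo (fps_inv Z_fps oo Z_fps)"
    by (rule fps_compose_assoc[symmetric]) (simp_all add: fps_inv_def)
  also have "\<dots> = \<Phi>_fps (- \<beta>)" using Z1 by (simp add: fps_inv)
  finally have "binomial_series_coeffs \<beta> oo Z_fps = fps_const (Gamma \<beta>) * \<Phi>_fps (- \<beta>)"
    unfolding binomial_series_coeffs_def by (subst fps_compose_mult_distrib) simp_all
  moreover have "\<Phi>_fps (- \<beta>) * \<Phi>_fps \<beta> = 1" by (simp flip: \<Phi>_fps_add)
  ultimately show ?thesis by (simp add: mult.assoc)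
qed

lemma expands_one_minus_X_powr_shifted:
  "expands N s (Z_fps ^ k * \<Phi>_fps s) (fps_nth (one_minus_X_powr (of_nat k - s)))"
proof -
  have "expands N s (fps_X ^ k * \<Phi>_fps (s - of_nat k)) (fps_nth (one_minus_X_powr (- (s - of_nat k))))"
    by (intro expands_X_power_mult expands_one_minus_X_powr)
  then show ?thesis by (simp add: \<Phi>_fps_diff_of_nat)
qed

lemma coeff_bounded_power_sequence:
  assumes "\<beta> \<notin> \<int>\<^sub>\<le>\<^sub>0"
  shows "coeff_bounded (Re \<beta> - 1 - real N) (Abs_fps (\<lambda>n. of_nat n powr (\<beta> - 1)) -
    (\<Sum>k<N. fps_const (fps_nth (binomial_series_coeffs \<beta>) k) * one_minus_X_powr (of_nat k - \<beta>)))"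
proof -
  let ?b = "fps_nth (binomial_series_coeffs \<beta>)"
  let ?P = "\<lambda>k. one_minus_X_powr (of_nat k - \<beta>)"
  have "expands N \<beta> (fps_const (Gamma \<beta>) * 1) (\<lambda>n. Gamma \<beta> * rGamma_powr \<beta> n)"
    by (intro expands_cmult expands_rGamma_powr)
  moreover have "Gamma \<beta> * rGamma_powr \<beta> n = of_nat n powr (\<beta> - 1)" for n
    using assms by (simp add: rGamma_powr_def Gamma_def rGamma_eq_zero_iff)
  moreover have "expands N \<beta> (\<Sum>k<N. fps_const (?b k) * (Z_fps ^ k * \<Phi>_fps \<beta>)) (\<lambda>n. \<Sum>k<N. ?b k * fps_nth (?P k) n)"
    by (intro expands_sum expands_cmult expands_one_minus_X_powr_shifted)
  ultimately have "expands N \<beta> (fps_const (Gamma \<beta>) - (\<Sum>k<N. fps_const (?b k) * (Z_fps ^ k * \<Phi>_fps \<beta>)))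
      (\<lambda>n. of_nat n powr (\<beta> - 1) - (\<Sum>k<N. ?b k * fps_nth (?P k) n))"
    using expands_diff by simp
  moreover have "fps_nth (fps_const (Gamma \<beta>) - (\<Sum>k<N. fps_const (?b k) * (Z_fps ^ k * \<Phi>_fps \<beta>))) l = fps_nth 0 l"
    if "l < N" for l
  proof -
    have "fps_nth ((\<Sum>k<N. fps_const (?b k) * Z_fps ^ k) * \<Phi>_fps \<beta>) l
        = fps_nth ((binomial_series_coeffs \<beta> oo Z_fps) * \<Phi>_fps \<beta>) l"
      by (rule fps_mult_nth_cong[OF fps_compose_nth_truncated that]) simp_all
    then show ?thesis by (simp add: binomial_series_coeffs_compose sum_distrib_right mult.assoc)
  qed
  ultimately have "expands N \<beta> 0 (\<lambda>n. of_nat n powr (\<beta> - 1) - (\<Sum>k<N. ?b k * fps_nth (?P k) n))"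
    using expands_cong by blast
  moreover have "fps_nth (Abs_fps (\<lambda>n. of_nat n powr (\<beta> - 1)) - (\<Sum>k<N. fps_const (?b k) * ?P k))
    = (\<lambda>n. of_nat n powr (\<beta> - 1) - (\<Sum>k<N. ?b k * fps_nth (?P k) n))"
    by (rule ext) (simp add: fps_sum_nth)
  ultimately show ?thesis by (simp add: expands_def)
qed

text \<open>
  The power series of \<open>h powr \<alpha> * \<omega> (exp (- h)) = ((1 - exp (- h)) / h) powr (- \<alpha>) * w (exp (- h))\<close>.
\<close>
definition quad_symbol :: "real \<Rightarrow> (complex \<Rightarrow> complex) \<Rightarrow> complex fps" where
  "quad_symbol \<alpha> w = (taylor_at_1 w oo Z_fps) * \<Phi>_fps (of_real \<alpha>)"

text \<open>Multiply two finite expansions, of the weights in powers (1 - X)^(i - \<alpha>) and of n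
  powr (\<beta> - 1) in powers (1 - X)^(k - \<beta>). Every product with a remainder is O(n powr
  (\<alpha> - 1)), and the double sum belongs to the series b(Z) * c(Z) * \<Phi>(\<alpha> + \<beta>)
  = Gamma(\<beta>) * \<open>quad_symbol\<close>. Terms with l \<ge> Re \<beta> have the size of the
  error, so the sum may stop at L.\<close>

theorem convolution_power_expansion:
  fixes \<alpha> :: real and \<beta> :: complex
  assumes gen: "generating_form \<alpha> \<omega> w" and bd: "coeff_bounded (\<alpha> - 1) (Abs_fps \<omega>)"
    and \<beta>: "\<beta> \<notin> \<int>\<^sub>\<le>\<^sub>0" and L: "Re \<beta> \<le> real L"
  shows "poly_bounded (\<alpha> - 1) (\<lambda>n. (\<Sum>j\<le>n. \<omega> (n - j) * of_nat j powr (\<beta> - 1)) -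
    Gamma \<beta> * (\<Sum>l<L. fps_nth (quad_symbol \<alpha> w) l * rGamma_powr (of_real \<alpha> + \<beta> - of_nat l) n))"
proof -
  define q where "q = \<alpha> - 1"
  define A where "A = Abs_fps \<omega>"
  define B where "B = Abs_fps (\<lambda>n. of_nat n powr (\<beta> - 1) :: complex)"
  define b where "b = fps_nth (binomial_series_coeffs \<beta>)"
  define c where "c = fps_nth (taylor_at_1 w)"
  define s where "s = of_real \<alpha> + \<beta>"
  \<comment> \<open>\<open>N\<close> and \<open>I\<close> make the remainder of the powers, and the
    binomial coefficients multiplying \<open>R\<close>, decay like n powr (- |q| - 2); being at
    least L, they leave the first L coefficients of the series intact.\<close>
  define N where "N = max L (nat \<lceil>Re \<beta> + \<bar>q\<bar> + 1\<rceil>)"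
  define I where "I = max L (nat \<lceil>\<alpha> + Re \<beta> + \<bar>q\<bar> + 1\<rceil>)"
  have N: "L \<le> N" "Re \<beta> + \<bar>q\<bar> + 1 \<le> real N" unfolding N_def by linarith+
  have I: "L \<le> I" "\<alpha> + Re \<beta> + \<bar>q\<bar> + 1 \<le> real I" unfolding I_def by linarith+
  define Rem where "Rem = B - (\<Sum>k<N. fps_const (b k) * one_minus_X_powr (of_nat k - \<beta>))"
  define W where "W = one_minus_X_powr (of_real \<alpha>) * A"
  define R where "R = one_minus_X_powr (- of_nat I) * (W - (\<Sum>i<I. fps_const (c i) * (1 - fps_X) ^ i))"
  have bdA: "coeff_bounded q A" using bd by (simp only: A_def q_def)
  have bdR: "coeff_bounded q R"
    using coeff_bounded_taylor_remainder[OF gen bd, of I] unfolding R_def W_def A_def c_def q_def .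
  have bdRem: "coeff_bounded (- \<bar>q\<bar> - 2) Rem"
    unfolding Rem_def B_def b_def
    by (rule poly_bounded_mono[OF coeff_bounded_power_sequence[OF \<beta>]]) (use N in simp)
  have A_eq: "A = one_minus_X_powr (- of_real \<alpha>) * W"
  proof -
    have "one_minus_X_powr (- of_real \<alpha>) * one_minus_X_powr (of_real \<alpha>) = 1"
      by (simp flip: one_minus_X_powr_add)
    then show ?thesis by (simp add: W_def flip: mult.assoc)
  qed
  have W_eq: "W = (\<Sum>i<I. fps_const (c i) * one_minus_X_powr (of_nat i)) + one_minus_X_powr (of_nat I) * R"
  proof -
    have "one_minus_X_powr (of_nat I) * one_minus_X_powr (- of_nat I) = 1"
      by (simp flip: one_minus_X_powr_add)
    then have "one_minus_X_powr (of_nat I) * R = W - (\<Sum>i<I. fps_const (c i) * (1 - fps_X) ^ i)"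
      by (simp add: R_def flip: mult.assoc)
    then show ?thesis by (simp add: one_minus_X_powr_of_nat)
  qed
  have AP: "A * one_minus_X_powr (of_nat k - \<beta>) =
      (\<Sum>i<I. fps_const (c i) * one_minus_X_powr (of_nat (k + i) - s)) + R * one_minus_X_powr (of_nat (k + I) - s)" for k
  proof -
    have "one_minus_X_powr (- of_real \<alpha>) * one_minus_X_powr (of_nat i) * one_minus_X_powr (of_nat k - \<beta>)
        = one_minus_X_powr (of_nat (k + i) - s)" for i
      by (simp add: s_def algebra_simps flip: one_minus_X_powr_add)
    note P = this[symmetric]
    show ?thesis unfolding A_eq W_eq P
      by (simp add: distrib_left distrib_right sum_distrib_left sum_distrib_right mult_ac)
  qed
  define S where "S = (\<Sum>k<N. fps_const (b k) * (\<Sum>i<I. fps_const (c i) * one_minus_X_powr (of_nat (k + i) - s)))"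
  have "A * B = A * Rem + (\<Sum>k<N. fps_const (b k) * (A * one_minus_X_powr (of_nat k - \<beta>)))"
    by (simp add: Rem_def right_diff_distrib sum_distrib_left mult.left_commute)
  then have AB: "A * B - S = A * Rem + (\<Sum>k<N. fps_const (b k) * (R * one_minus_X_powr (of_nat (k + I) - s)))"
    unfolding AP S_def by (simp add: distrib_left sum.distrib)
  have "coeff_bounded q (A * B - S)" unfolding AB
  proof (intro coeff_bounded_add coeff_bounded_sum coeff_bounded_const_mult coeff_bounded_mult bdA bdR bdRem)
    fix k show "coeff_bounded (- \<bar>q\<bar> - 2) (one_minus_X_powr (of_nat (k + I) - s))"
      by (rule poly_bounded_mono[OF coeff_bounded_one_minus_X_powr]) (use I in \<open>simp add: s_def\<close>)
  qed
  moreover have "poly_bounded q (\<lambda>n. fps_nth S n -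
      (\<Sum>l<L. fps_nth (fps_const (Gamma \<beta>) * quad_symbol \<alpha> w) l * rGamma_powr (s - of_nat l) n))"
  proof -
    have "expands L s (\<Sum>k<N. fps_const (b k) * (\<Sum>i<I. fps_const (c i) * (Z_fps ^ (k + i) * \<Phi>_fps s)))
        (\<lambda>n. \<Sum>k<N. b k * (\<Sum>i<I. c i * fps_nth (one_minus_X_powr (of_nat (k + i) - s)) n))"
      by (intro expands_sum expands_cmult expands_one_minus_X_powr_shifted)
    moreover have "(\<lambda>n. \<Sum>k<N. b k * (\<Sum>i<I. c i * fps_nth (one_minus_X_powr (of_nat (k + i) - s)) n)) = fps_nth S"
      by (rule ext) (simp add: S_def fps_sum_nth)
    moreover have "(\<Sum>k<N. fps_const (b k) * (\<Sum>i<I. fps_const (c i) * (Z_fps ^ (k + i) * \<Phi>_fps s)))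
       = (\<Sum>k<N. fps_const (b k) * Z_fps ^ k) * ((\<Sum>i<I. fps_const (c i) * Z_fps ^ i) * \<Phi>_fps s)"
      unfolding sum_distrib_right[of _ "{..<N}"]
      by (rule sum.cong) (simp_all add: sum_distrib_left sum_distrib_right power_add mult_ac)
    ultimately have "expands L s ((\<Sum>k<N. fps_const (b k) * Z_fps ^ k) *
        ((\<Sum>i<I. fps_const (c i) * Z_fps ^ i) * \<Phi>_fps s)) (fps_nth S)" by (simp only:)
    moreover have "fps_nth ((\<Sum>k<N. fps_const (b k) * Z_fps ^ k) * ((\<Sum>i<I. fps_const (c i) * Z_fps ^ i) * \<Phi>_fps s)) l
        = fps_nth (fps_const (Gamma \<beta>) * quad_symbol \<alpha> w) l" if l: "l < L" for l
    proof -
      have "fps_nth ((\<Sum>k<N. fps_const (b k) * Z_fps ^ k) * ((\<Sum>i<I. fps_const (c i) * Z_fps ^ i) * \<Phi>_fps s)) l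
        = fps_nth ((binomial_series_coeffs \<beta> oo Z_fps) * ((\<Sum>i<I. fps_const (c i) * Z_fps ^ i) * \<Phi>_fps s)) l"
        unfolding b_def by (rule fps_mult_nth_cong[OF fps_compose_nth_truncated, of N]) (use l N in auto)
      also have "\<dots> = fps_nth ((\<Sum>i<I. fps_const (c i) * Z_fps ^ i) * ((binomial_series_coeffs \<beta> oo Z_fps) * \<Phi>_fps s)) l"
        by (simp add: mult_ac)
      also have "\<dots> = fps_nth ((taylor_at_1 w oo Z_fps) * ((binomial_series_coeffs \<beta> oo Z_fps) * \<Phi>_fps s)) l"
        unfolding c_def by (rule fps_mult_nth_cong[OF fps_compose_nth_truncated, of I]) (use l I in auto)
      also have "(taylor_at_1 w oo Z_fps) * ((binomial_series_coeffs \<beta> oo Z_fps) * \<Phi>_fps s)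
        = ((binomial_series_coeffs \<beta> oo Z_fps) * \<Phi>_fps \<beta>) * quad_symbol \<alpha> w"
        unfolding s_def \<Phi>_fps_add quad_symbol_def by (simp add: mult_ac)
      finally show ?thesis unfolding binomial_series_coeffs_compose .
    qed
    ultimately have "expands L s (fps_const (Gamma \<beta>) * quad_symbol \<alpha> w) (fps_nth S)"
      using expands_cong by blast
    then show ?thesis unfolding expands_def
      by (rule poly_bounded_mono) (use L in \<open>simp add: s_def q_def\<close>)
  qed
  ultimately have "poly_bounded q (\<lambda>n. fps_nth (A * B - S) n + (fps_nth S n -
      (\<Sum>l<L. fps_nth (fps_const (Gamma \<beta>) * quad_symbol \<alpha> w) l * rGamma_powr (s - of_nat l) n)))"
    by (rule poly_bounded_add)
  moreover have "fps_nth (A * B - S) n + (fps_nth S n -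
      (\<Sum>l<L. fps_nth (fps_const (Gamma \<beta>) * quad_symbol \<alpha> w) l * rGamma_powr (s - of_nat l) n)) =
    (\<Sum>j\<le>n. \<omega> (n - j) * of_nat j powr (\<beta> - 1)) -
    Gamma \<beta> * (\<Sum>l<L. fps_nth (quad_symbol \<alpha> w) l * rGamma_powr (of_real \<alpha> + \<beta> - of_nat l) n)" for n
  proof -
    have "A * B = B * A" by (rule mult.commute)
    then have "fps_nth (A * B) n = (\<Sum>j\<le>n. \<omega> (n - j) * of_nat j powr (\<beta> - 1))"
      by (simp only: A_def B_def fps_mult_nth) (simp add: atLeast0AtMost mult.commute[of "\<omega> _"])
    then show ?thesis by (simp add: sum_distrib_left s_def mult.assoc)
  qed
  ultimately show ?thesis by (simp only: q_def)
qed

section \<open>Fractional integrals of powers\<close>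

definition beta_integrand :: "real \<Rightarrow> complex \<Rightarrow> real \<Rightarrow> complex" where
  "beta_integrand a \<beta> t = of_real ((1 - t) powr (a - 1)) * of_real t powr (\<beta> - 1)"

definition beta_integral :: "real \<Rightarrow> complex \<Rightarrow> complex" where
  "beta_integral a \<beta> = integral {0<..<1} (beta_integrand a \<beta>)"

lemma norm_beta_integrand:
  assumes "0 < t"
  shows "norm (beta_integrand a \<beta> t) = t powr (Re \<beta> - 1) * (1 - t) powr (a - 1)"
  using assms by (simp add: beta_integrand_def norm_mult norm_powr_real_powr mult.commute)

lemma beta_integrand_has_integral:
  assumes "a > 0" "Re \<beta> > 0"
  shows "(beta_integrand a \<beta> has_integral beta_integral a \<beta>) {0<..<1}"
  unfolding beta_integral_def
proof (rule integrable_integral, rule measurable_bounded_by_integrable_imp_integrable)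
  have "continuous_on {0<..<1} (beta_integrand a \<beta>)"
    unfolding beta_integrand_def by (intro continuous_intros) auto
  then show "beta_integrand a \<beta> \<in> borel_measurable (lebesgue_on {0<..<1})"
    by (rule continuous_imp_measurable_on_sets_lebesgue) simp
  show "(\<lambda>t. t powr (Re \<beta> - 1) * (1 - t) powr (a - 1)) integrable_on {0<..<1}"
    using has_integral_Beta_real[OF assms(2,1)] by (auto simp: has_integral_Icc_iff_Ioo integrable_on_def)
  show "norm (beta_integrand a \<beta> t) \<le> t powr (Re \<beta> - 1) * (1 - t) powr (a - 1)" if "t \<in> {0<..<1}" for t
    using that by (simp add: norm_beta_integrand)
qed simp

lemma beta_integral_of_real:
  assumes "a > 0" "b > 0"
  shows "beta_integral a (of_real b) = of_real (Beta b a)"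
proof -
  have "((\<lambda>t. complex_of_real (t powr (b - 1) * (1 - t) powr (a - 1))) has_integral of_real (Beta b a)) {0<..<1}"
    unfolding has_integral_Icc_iff_Ioo[symmetric]
    by (rule has_integral_of_real[OF has_integral_Beta_real[OF assms(2,1)]])
  moreover have "complex_of_real (t powr (b - 1) * (1 - t) powr (a - 1)) = beta_integrand a (of_real b) t"
    if "t \<in> {0<..<1}" for t
    using that by (simp add: beta_integrand_def powr_of_real[symmetric] mult.commute)
  ultimately have "(beta_integrand a (of_real b) has_integral of_real (Beta b a)) {0<..<1}"
    by (rule has_integral_eq[rotated])
  then show ?thesis unfolding beta_integral_def by (rule integral_unique)
qed

text \<open>From 1 = (1 - t) + t. Combined with integration by parts it gives the recursion of the
  Beta integral in \<beta>.\<close>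

lemma beta_integral_split:
  assumes "a > 0" "Re \<beta> > 0"
  shows "beta_integral a \<beta> = beta_integral (a + 1) \<beta> + beta_integral a (\<beta> + 1)"
proof -
  have "((\<lambda>t. beta_integrand (a + 1) \<beta> t + beta_integrand a (\<beta> + 1) t) has_integral
      beta_integral (a + 1) \<beta> + beta_integral a (\<beta> + 1)) {0<..<1}"
    using assms by (intro has_integral_add beta_integrand_has_integral) auto
  moreover have "beta_integrand (a + 1) \<beta> t + beta_integrand a (\<beta> + 1) t = beta_integrand a \<beta> t"
    if t: "t \<in> {0<..<1}" for t
  proof -
    have 1: "complex_of_real ((1 - t) powr a) = of_real ((1 - t) powr (a - 1)) * (1 - of_real t)"
      using t by (simp add: powr_diff)
    have 2: "of_real t powr \<beta> = of_real t powr (\<beta> - 1) * complex_of_real t"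
      using t by (simp add: powr_diff)
    show ?thesis by (simp add: beta_integrand_def 1 2 algebra_simps)
  qed
  ultimately have "(beta_integrand a \<beta> has_integral beta_integral (a + 1) \<beta> + beta_integral a (\<beta> + 1)) {0<..<1}"
    by (rule has_integral_eq[rotated])
  with beta_integrand_has_integral[OF assms] show ?thesis by (rule has_integral_unique)
qed

lemma beta_integral_by_parts:
  assumes "a > 0" "Re \<beta> > 0"
  shows "\<beta> * beta_integral (a + 1) \<beta> = of_real a * beta_integral a (\<beta> + 1)"
proof -
  define G where "G = (\<lambda>t::real. complex_of_real ((1 - t) powr a) * of_real t powr \<beta>)"
  have "((\<lambda>t. \<beta> * beta_integrand (a + 1) \<beta> t - of_real a * beta_integrand a (\<beta> + 1) t) has_integral G 1 - G 0) {0..1}"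
  proof (rule fundamental_theorem_of_calculus_interior)
    have cont: "isCont (\<lambda>t::real. complex_of_real t powr \<beta>) t" if "t \<ge> 0" for t
    proof (cases "t = 0")
      case True
      have "((\<lambda>t::real. complex_of_real t powr \<beta>) \<longlongrightarrow> 0) (at 0)"
        by (rule tendsto_powr_complex_0[where b = \<beta>]) (use assms(2) in \<open>auto intro!: tendsto_eq_intros\<close>)
      then show ?thesis using True by (simp add: isCont_def)
    next
      case False
      then show ?thesis using that by (intro continuous_intros) auto
    qed
    have "continuous_on {0..1} (\<lambda>t::real. complex_of_real t powr \<beta>)"
      using cont by (intro continuous_at_imp_continuous_on) auto
    moreover have "continuous_on {0..1} (\<lambda>t. (1 - t) powr a)"
      using assms(1) by (intro continuous_on_powr' continuous_intros) auto
    ultimately show "continuous_on {0..1} G"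
      unfolding G_def by (intro continuous_on_mult continuous_on_of_real)
  next
    fix t :: real assume t: "t \<in> {0<..<1}"
    have "((\<lambda>t. (1 - t) powr a) has_real_derivative - (a * (1 - t) powr (a - 1))) (at t)"
      using t by (auto intro!: derivative_eq_intros simp: powr_diff field_simps)
    then have 1: "((\<lambda>t. complex_of_real ((1 - t) powr a)) has_vector_derivative
        of_real (- (a * (1 - t) powr (a - 1)))) (at t)"
      by (rule has_vector_derivative_of_real)
    have "((\<lambda>z. z powr \<beta>) has_field_derivative \<beta> * of_real t powr (\<beta> - 1)) (at (of_real t))"
      by (rule has_field_derivative_powr) (use t in auto)
    then have 2: "((\<lambda>t. of_real t powr \<beta>) has_vector_derivative \<beta> * of_real t powr (\<beta> - 1)) (at t)"
      by (rule has_vector_derivative_real_field)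
    have "(G has_vector_derivative
      (of_real ((1 - t) powr a) * (\<beta> * of_real t powr (\<beta> - 1)) +
       of_real (- (a * (1 - t) powr (a - 1))) * of_real t powr \<beta>)) (at t)"
      unfolding G_def by (rule has_vector_derivative_mult[OF 1 2])
    then show "(G has_vector_derivative
        \<beta> * beta_integrand (a + 1) \<beta> t - of_real a * beta_integrand a (\<beta> + 1) t) (at t)"
      by (simp add: beta_integrand_def mult_ac)
  qed simp
  moreover have "G 1 - G 0 = 0" using assms by (simp add: G_def)
  ultimately have "((\<lambda>t. \<beta> * beta_integrand (a + 1) \<beta> t - of_real a * beta_integrand a (\<beta> + 1) t) has_integral 0) {0<..<1}"
    by (simp add: has_integral_Icc_iff_Ioo)
  moreover have "((\<lambda>t. \<beta> * beta_integrand (a + 1) \<beta> t - of_real a * beta_integrand a (\<beta> + 1) t) has_integral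
      \<beta> * beta_integral (a + 1) \<beta> - of_real a * beta_integral a (\<beta> + 1)) {0<..<1}"
    using assms by (intro has_integral_diff has_integral_mult_right beta_integrand_has_integral) auto
  ultimately have "0 = \<beta> * beta_integral (a + 1) \<beta> - of_real a * beta_integral a (\<beta> + 1)"
    by (rule has_integral_unique)
  then show ?thesis by simp
qed

lemma beta_integral_rec:
  assumes "a > 0" "Re \<beta> > 0"
  shows "\<beta> * beta_integral a \<beta> = (of_real a + \<beta>) * beta_integral a (\<beta> + 1)"
  unfolding beta_integral_split[OF assms] distrib_left beta_integral_by_parts[OF assms]
  by (rule distrib_right[symmetric])

lemma Re_pos_not_nonpos_Int: "Re z > 0 \<Longrightarrow> z \<notin> \<int>\<^sub>\<le>\<^sub>0"
  by (auto elim!: nonpos_Ints_cases)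

text \<open>Mean value inequality along the segment from t to 1; Re s \<ge> 1 bounds the derivative
  s * u powr (s - 1) by |s|, uniformly in t.\<close>

lemma norm_powr_minus_1_le:
  assumes "Re s \<ge> 1" "0 < t" "t \<le> 1"
  shows "norm (of_real t powr s - 1) \<le> norm s * (1 - t)"
proof -
  have "norm ((of_real t :: complex) powr s - 1 powr s) \<le> norm s * norm (of_real t - 1 :: complex)"
  proof (rule field_differentiable_bound[of "closed_segment (of_real t) 1"])
    fix z :: complex assume "z \<in> closed_segment (of_real t) 1"
    then obtain u where u: "z = of_real u" "t \<le> u" "u \<le> 1"
      using assms(3) by (auto simp: closed_segment_of_real[of t 1, simplified] closed_segment_eq_real_ivl)
    show "((\<lambda>z. z powr s) has_field_derivative s * z powr (s - 1)) (at z within closed_segment (of_real t) 1)"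
      by (rule has_field_derivative_at_within[OF has_field_derivative_powr]) (use u assms in auto)
    have "u powr (Re s - 1) \<le> 1" using u assms by (intro powr_le1) auto
    then have "norm s * u powr (Re s - 1) \<le> norm s * 1" by (intro mult_left_mono) auto
    then show "norm (s * z powr (s - 1)) \<le> norm s"
      using u assms by (simp add: norm_mult norm_powr_real_powr)
  qed auto
  moreover have "norm (of_real t - 1 :: complex) = 1 - t"
    using assms(3) norm_of_real[of "t - 1", where 'a = complex] by simp
  ultimately show ?thesis by simp
qed

text \<open>The difference gains a factor 1 - t, which raises a to a + 1. As Beta b (a + 1) is a /
  (a + b) times Beta b a, it is of lower order when b grows.\<close>

lemma beta_integral_diff_bound:
  assumes "a > 0" "b > 0" "Re s \<ge> 1"
  shows "norm (beta_integral a (of_real b + s) - beta_integral a (of_real b)) \<le> norm s * Beta b (a + 1)"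
proof -
  let ?f = "\<lambda>t. beta_integrand a (of_real b + s) t - beta_integrand a (of_real b) t"
  let ?g = "\<lambda>t. norm s * (t powr (b - 1) * (1 - t) powr (a + 1 - 1))"
  have f: "(?f has_integral beta_integral a (of_real b + s) - beta_integral a (of_real b)) {0<..<1}"
    using assms by (intro has_integral_diff beta_integrand_has_integral) auto
  have g: "(?g has_integral norm s * Beta b (a + 1)) {0<..<1}"
    using has_integral_Beta_real[of b "a + 1"] assms by (intro has_integral_mult_right) (auto simp: has_integral_Icc_iff_Ioo)
  have "norm (integral {0<..<1} ?f) \<le> integral {0<..<1} ?g"
  proof (rule integral_norm_bound_integral)
    fix t :: real assume t: "t \<in> {0<..<1}"
    have "of_real t powr (of_real b + s - 1) = of_real t powr (of_real b - 1) * complex_of_real t powr s"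
      by (simp add: algebra_simps flip: powr_add)
    then have "?f t = beta_integrand a (of_real b) t * (of_real t powr s - 1)"
      by (simp only: beta_integrand_def) (simp only: right_diff_distrib mult.assoc mult_1_right)
    then have "norm (?f t) = t powr (b - 1) * (1 - t) powr (a - 1) * norm (of_real t powr s - 1)"
      using t by (simp only: norm_mult norm_beta_integrand) (simp add: norm_beta_integrand)
    also have "\<dots> \<le> t powr (b - 1) * (1 - t) powr (a - 1) * (norm s * (1 - t))"
      using t assms(3) by (intro mult_left_mono norm_powr_minus_1_le) auto
    also have "\<dots> = ?g t" using t by (simp add: powr_diff)
    finally show "norm (?f t) \<le> ?g t" .
  qed (use f g in auto)
  then show ?thesis unfolding integral_unique[OF f] integral_unique[OF g] .
qed

text \<open>Gamma(s + n) is Gamma(s) times a Pochhammer symbol, whose growth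
  \<open>one_minus_X_powr_asymp\<close> provides; the factorials cancel in the quotient.\<close>

lemma Gamma_ratio_asymp:
  assumes "Re z > 0" "a > 0"
  shows "(\<lambda>n. Gamma (of_real a + z + of_nat n) * rGamma (z + of_nat n) * of_nat n powr (- of_real a)) \<longlonglongrightarrow> 1"
proof -
  have nz: "z \<notin> \<int>\<^sub>\<le>\<^sub>0" "of_real a + z \<notin> \<int>\<^sub>\<le>\<^sub>0" using assms by (auto intro!: Re_pos_not_nonpos_Int)
  have lim: "(\<lambda>n. Gamma s * (pochhammer s n / fact n * of_nat n powr (1 - s))) \<longlonglongrightarrow> 1" if "s \<notin> \<int>\<^sub>\<le>\<^sub>0" for s :: complex
    using tendsto_mult[OF tendsto_const[of "Gamma s"] one_minus_X_powr_asymp[of s]] that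
    by (simp add: one_minus_X_powr_def Gamma_def rGamma_eq_zero_iff)
  have Gn: "Gamma (s + of_nat n) = Gamma s * pochhammer s n" if "s \<notin> \<int>\<^sub>\<le>\<^sub>0" for s :: complex and n
    using pochhammer_Gamma[OF that, of n] that by (simp add: Gamma_eq_zero_iff)
  have "(\<lambda>n. (Gamma (of_real a + z) * (pochhammer (of_real a + z) n / fact n * of_nat n powr (1 - (of_real a + z))))
      / (Gamma z * (pochhammer z n / fact n * of_nat n powr (1 - z)))) \<longlonglongrightarrow> 1 / 1"
    by (intro tendsto_divide lim nz) simp
  moreover have "eventually (\<lambda>n. (Gamma (of_real a + z) * (pochhammer (of_real a + z) n / fact n * of_nat n powr (1 - (of_real a + z))))
      / (Gamma z * (pochhammer z n / fact n * of_nat n powr (1 - z)))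
      = Gamma (of_real a + z + of_nat n) * rGamma (z + of_nat n) * of_nat n powr (- of_real a)) at_top"
    using eventually_gt_at_top[of 0]
  proof eventually_elim
    case (elim n)
    have "of_nat n powr (1 - (of_real a + z)) = of_nat n powr (1 - z) * (of_nat n powr (- of_real a) :: complex)"
      by (simp add: algebra_simps flip: powr_add)
    moreover have "(g * (p / f * (w * v))) / (g' * (p' / f * w)) = g * p * inverse (g' * p') * v"
      if "f \<noteq> 0" "w \<noteq> 0" for f g g' p p' v w :: complex
    proof -
      have "(g * (p / f * (w * v))) / (g' * (p' / f * w)) = (g * p * v * (w / f)) / (g' * p' * (w / f))"
        by (simp add: mult_ac)
      also have "\<dots> = (g * p * v) / (g' * p')" using that by (intro mult_divide_mult_cancel_right) auto
      finally show ?thesis by (simp add: divide_inverse mult_ac)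
    qed
    ultimately show ?case using elim
      by (simp add: Gn[OF nz(1)] Gn[OF nz(2)] rGamma_inverse_Gamma divide_inverse mult_ac)
  qed
  ultimately show ?thesis using Lim_transform_eventually by fastforce
qed

text \<open>
  Since \<open>beta_integral a \<beta> * Gamma (a + \<beta>) / Gamma \<beta>\<close> is invariant under \<open>\<beta> \<mapsto> \<beta> + 1\<close>, its value can be
  compared, for \<open>\<beta> + n\<close> with \<open>n\<close> large, with the value \<open>Gamma a\<close> known at the integers.
\<close>
lemma beta_integral_eq:
  assumes "a > 0" "Re \<beta> > 0"
  shows "beta_integral a \<beta> = of_real (Gamma a) * Gamma \<beta> * rGamma (of_real a + \<beta>)"
proof -
  define \<rho> where "\<rho> = (\<lambda>z::complex. Gamma (of_real a + z) * rGamma z)"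
  define q where "q = (\<lambda>z. beta_integral a z * \<rho> z)"
  have q_Suc: "q (z + 1) = q z" if "Re z > 0" for z
  proof -
    have "Gamma (of_real a + z + 1) = (of_real a + z) * Gamma (of_real a + z)"
      using that assms by (intro Gamma_plus1 Re_pos_not_nonpos_Int) simp
    moreover have "rGamma z = z * rGamma (z + 1)" by (rule rGamma_plus1[symmetric])
    ultimately show ?thesis
      using beta_integral_rec[OF assms(1) that] by (simp add: q_def \<rho>_def mult_ac flip: add.assoc)
  qed
  have q_shift: "q (z + of_nat n) = q z" if "Re z > 0" for z n
  proof (induction n)
    case (Suc n)
    have "q (z + of_nat n + 1) = q (z + of_nat n)" using that by (intro q_Suc) simp
    then show ?case using Suc.IH by (simp add: add_ac)
  qed simp
  \<comment> \<open>The shift by 2 makes z + n exceed the integer x n by \<beta> + 1, whose real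
    part is at least 1, as \<open>beta_integral_diff_bound\<close> demands.\<close>
  define z where "z = \<beta> + 2"
  define x where "x = (\<lambda>n::nat. 1 + of_nat n :: complex)"
  have q_real: "q (x n) = of_real (Gamma a)" for n
  proof -
    define b where "b = 1 + real n"
    have b: "b > 0" "x n = of_real b" by (simp_all add: b_def x_def)
    have "of_real (Beta b a) * (Gamma (of_real a + of_real b) * rGamma (of_real b)) = complex_of_real (Gamma a)"
    proof -
      have "Beta b a * (Gamma (a + b) * rGamma b) = Gamma a"
        using b(1) assms(1) Gamma_real_pos[of "a + b", THEN less_imp_neq] Gamma_real_pos[of b, THEN less_imp_neq]
        by (simp add: Beta_def rGamma_inverse_Gamma add.commute)
      then show ?thesis
        by (metis Gamma_complex_of_real of_real_add of_real_mult rGamma_complex_of_real)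
    qed
    then show ?thesis using beta_integral_of_real[OF assms(1) b(1)] by (simp add: q_def \<rho>_def b(2))
  qed
  have \<rho>_x: "\<rho> (x n) \<noteq> 0" for n
    using q_real[of n] Gamma_real_pos[OF assms(1)] by (auto simp: q_def)
  have ratio: "(\<lambda>n. \<rho> (z + of_nat n) / \<rho> (x n)) \<longlonglongrightarrow> 1"
  proof -
    have "(\<lambda>n. (\<rho> (z + of_nat n) * of_nat n powr (- of_real a)) / (\<rho> (x n) * of_nat n powr (- of_real a))) \<longlonglongrightarrow> 1 / 1"
      using Gamma_ratio_asymp[of z a] Gamma_ratio_asymp[of 1 a] assms
      by (intro tendsto_divide) (simp_all add: \<rho>_def x_def z_def add_ac)
    moreover have "eventually (\<lambda>n. (\<rho> (z + of_nat n) * of_nat n powr (- of_real a)) / (\<rho> (x n) * of_nat n powr (- of_real a))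
        = \<rho> (z + of_nat n) / \<rho> (x n)) at_top"
      using eventually_gt_at_top[of 0] by eventually_elim simp
    ultimately show ?thesis using Lim_transform_eventually by fastforce
  qed
  define d where "d = (\<lambda>n. (beta_integral a (z + of_nat n) - beta_integral a (x n)) * \<rho> (x n))"
  have "d \<longlonglongrightarrow> 0"
  proof (rule Lim_null_comparison)
    show "eventually (\<lambda>n. norm (d n) \<le> norm (\<beta> + 1) * Gamma (a + 1) / (a + 1 + real n)) at_top"
    proof (rule always_eventually, rule allI)
      fix n
      define b where "b = 1 + real n"
      have b: "b > 0" "x n = of_real b" "z + of_nat n = of_real b + (\<beta> + 1)"
        by (simp_all add: b_def x_def z_def)
      have \<rho>b: "\<rho> (x n) = of_real (Gamma (a + b) * rGamma b)"
        unfolding \<rho>_def b(2) by (metis Gamma_complex_of_real of_real_add of_real_mult rGamma_complex_of_real)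
      have pos: "Gamma (a + b) > 0" "Gamma b > 0" using b(1) assms(1) by (simp_all add: Gamma_real_pos)
      have "norm (d n) = norm (beta_integral a (of_real b + (\<beta> + 1)) - beta_integral a (of_real b)) * (Gamma (a + b) * rGamma b)"
        using pos by (simp only: d_def norm_mult \<rho>b b(3)) (simp add: b(2) rGamma_inverse_Gamma del: of_real_mult)
      also have "\<dots> \<le> (norm (\<beta> + 1) * Beta b (a + 1)) * (Gamma (a + b) * rGamma b)"
        using assms b(1) pos by (intro mult_right_mono beta_integral_diff_bound) (auto simp: rGamma_inverse_Gamma)
      also have "Beta b (a + 1) * (Gamma (a + b) * rGamma b) = Gamma (a + 1) / (a + b)"
      proof -
        have "Gamma (b + (a + 1)) = (a + b) * Gamma (a + b)"
        proof -
          have "a + b \<notin> \<int>\<^sub>\<le>\<^sub>0" using assms(1) b(1) nonpos_Ints_nonpos[of "a + b"] by auto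
          then show ?thesis using Gamma_plus1[of "a + b"] by (simp add: add_ac)
        qed
        then have "Beta b (a + 1) * (Gamma (a + b) * rGamma b)
            = (Gamma (a + 1) * (Gamma b * Gamma (a + b))) / ((a + b) * (Gamma b * Gamma (a + b)))"
          by (simp add: Beta_def rGamma_inverse_Gamma divide_inverse mult_ac)
        also have "\<dots> = Gamma (a + 1) / (a + b)"
          using pos by (intro mult_divide_mult_cancel_right) auto
        finally show ?thesis .
      qed
      then have "(norm (\<beta> + 1) * Beta b (a + 1)) * (Gamma (a + b) * rGamma b) = norm (\<beta> + 1) * (Gamma (a + 1) / (a + b))"
        by (simp only: mult.assoc)
      finally show "norm (d n) \<le> norm (\<beta> + 1) * Gamma (a + 1) / (a + 1 + real n)"
        by (simp add: b_def add_ac)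
    qed
    show "(\<lambda>n. norm (\<beta> + 1) * Gamma (a + 1) / (a + 1 + real n)) \<longlonglongrightarrow> 0" by real_asymp
  qed
  \<comment> \<open>The left side is free of n, so it equals the limit of the right side.\<close>
  have "q z = (of_real (Gamma a) + d n) * (\<rho> (z + of_nat n) / \<rho> (x n))" for n
  proof -
    have "q z = beta_integral a (z + of_nat n) * \<rho> (z + of_nat n)"
      using q_shift[of z n] assms(2) by (simp add: q_def z_def)
    also have "beta_integral a (z + of_nat n) = (q (x n) + d n) / \<rho> (x n)"
      using \<rho>_x[of n] by (simp add: q_def d_def field_simps)
    finally show ?thesis by (simp add: q_real)
  qed
  moreover have "(\<lambda>n. (of_real (Gamma a) + d n) * (\<rho> (z + of_nat n) / \<rho> (x n))) \<longlonglongrightarrow> (of_real (Gamma a) + 0) * 1"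
    by (intro tendsto_intros \<open>d \<longlonglongrightarrow> 0\<close> ratio)
  ultimately have "q z = of_real (Gamma a)"
    using LIMSEQ_unique[OF tendsto_const[of "q z"]] by simp
  then have "q \<beta> = of_real (Gamma a)"
    using q_shift[OF assms(2), of 2] by (simp add: z_def)
  then have "of_real (Gamma a) * Gamma \<beta> * rGamma (of_real a + \<beta>) =
      beta_integral a \<beta> * (Gamma (of_real a + \<beta>) * rGamma (of_real a + \<beta>)) * (Gamma \<beta> * rGamma \<beta>)"
    by (simp add: q_def \<rho>_def mult_ac flip: \<open>q \<beta> = of_real (Gamma a)\<close>)
  moreover have "Gamma s * rGamma s = 1" if "Re s > 0" for s :: complex
    using Re_pos_not_nonpos_Int[OF that] by (simp add: Gamma_def rGamma_eq_zero_iff)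
  ultimately show ?thesis using assms by simp
qed

section \<open>Substantial integrals and derivatives of powers\<close>

lemma I_sub_pos_sub_pow:
  assumes "a > 0" "Re \<beta> > 0" "x > 0"
  shows "I_sub_pos a \<sigma> (sub_pow \<sigma> \<beta>) x = exp (- (\<sigma> * of_real x)) * Gamma \<beta> *
    (rGamma (of_real a + \<beta>) * of_real x powr (of_real a + \<beta> - 1))"
proof -
  let ?c = "exp (- (\<sigma> * of_real x)) * of_real x powr (of_real a + \<beta> - 2)"
  let ?h = "\<lambda>\<tau>. complex_of_real ((x - \<tau>) powr (a - 1)) * exp (- (\<sigma> * complex_of_real (x - \<tau>))) * sub_pow \<sigma> \<beta> \<tau>"
  have "(beta_integrand a \<beta> has_integral beta_integral a \<beta>) (cbox 0 1)"
    using beta_integrand_has_integral[OF assms(1,2)] by (simp add: has_integral_Icc_iff_Ioo)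
  \<comment> \<open>The substitution \<tau> = x t leads to the Beta integral; the two exponentials
    combine to exp (- \<sigma> x).\<close>
  from has_integral_affinity'[OF this, of "1 / x" 0] have
    "((\<lambda>\<tau>. beta_integrand a \<beta> (\<tau> / x)) has_integral of_real x * beta_integral a \<beta>) (cbox 0 x)"
    using assms(3) by (simp add: divide_inverse mult.commute scaleR_conv_of_real)
  then have "((\<lambda>\<tau>. ?c * beta_integrand a \<beta> (\<tau> / x)) has_integral ?c * (of_real x * beta_integral a \<beta>)) (cbox 0 x)"
    by (rule has_integral_mult_right)
  then have "(?h has_integral ?c * (of_real x * beta_integral a \<beta>)) (cbox 0 x)"
  \<comment> \<open>At the end points the integrands may disagree, as for \<beta> = 1, where
    \<open>sub_pow\<close> is 1 at 0 but \<open>powr\<close> gives 0.\<close>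
  proof (rule has_integral_spike_interior)
    fix \<tau> assume "\<tau> \<in> box 0 x"
    then have \<tau>: "0 < \<tau>" "\<tau> < x" by (simp_all add: box_real)
    have "1 - \<tau> / x = (x - \<tau>) / x" using assms(3) by (simp add: field_simps)
    then have 1: "complex_of_real ((1 - \<tau> / x) powr (a - 1)) = of_real ((x - \<tau>) powr (a - 1)) / of_real x powr (of_real a - 1)"
      using \<tau> assms(3) by (simp add: powr_divide powr_of_real[symmetric])
    have 2: "complex_of_real (\<tau> / x) powr (\<beta> - 1) = of_real \<tau> powr (\<beta> - 1) / of_real x powr (\<beta> - 1)"
    proof -
      have "complex_of_real \<tau> powr (\<beta> - 1) = of_real (\<tau> / x) powr (\<beta> - 1) * of_real x powr (\<beta> - 1)"
        using \<tau> assms(3) powr_times_real[of "complex_of_real (\<tau> / x)" "of_real x" "\<beta> - 1"] by simp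
      then show ?thesis using assms(3) by (simp add: field_simps)
    qed
    have 3: "complex_of_real x powr (of_real a + \<beta> - 2) = of_real x powr (of_real a - 1) * of_real x powr (\<beta> - 1)"
      by (simp add: algebra_simps flip: powr_add)
    have 4: "exp (- (\<sigma> * complex_of_real (x - \<tau>))) * exp (- (\<sigma> * of_real \<tau>)) = exp (- (\<sigma> * of_real x))"
      by (simp add: algebra_simps flip: exp_add)
    have "?h \<tau> = of_real ((x - \<tau>) powr (a - 1)) * of_real \<tau> powr (\<beta> - 1) *
        (exp (- (\<sigma> * complex_of_real (x - \<tau>))) * exp (- (\<sigma> * of_real \<tau>)))"
      using \<tau> by (simp add: sub_pow_def mult_ac)
    also have "\<dots> = ?c * beta_integrand a \<beta> (\<tau> / x)"
      unfolding 4 beta_integrand_def 1 2 3 using assms(3) by simp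
    finally show "?h \<tau> = ?c * beta_integrand a \<beta> (\<tau> / x)" .
  qed
  then have "integral {0..x} ?h = ?c * (of_real x * beta_integral a \<beta>)"
    by (intro integral_unique) simp
  moreover have "of_real x powr (of_real a + \<beta> - 2) * of_real x = complex_of_real x powr (of_real a + \<beta> - 1)"
  proof -
    have "of_real x powr (of_real a + \<beta> - 2 + 1) = of_real x powr (of_real a + \<beta> - 2) * complex_of_real x"
      using assms(3) by (subst powr_add) simp
    then show ?thesis by (simp add: algebra_simps)
  qed
  ultimately have "integral {0..x} ?h = exp (- (\<sigma> * of_real x)) * of_real x powr (of_real a + \<beta> - 1) * beta_integral a \<beta>"
    by (simp add: mult_ac)
  then show ?thesis
    using Gamma_real_pos[OF assms(1)]
    by (simp add: I_sub_pos_def beta_integral_eq[OF assms(1,2)] del: of_real_diff)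
qed

text \<open>Conjugation by exp (- \<sigma> x) turns \<open>D_sub\<close> into d / dx, and the
  derivative of x powr (s - 1) / Gamma(s) is x powr (s - 2) / Gamma(s - 1), for every s because
  \<open>rGamma\<close> is entire.\<close>

lemma D_sub_power:
  assumes F: "\<And>x. x > 0 \<Longrightarrow> F x = exp (- (\<sigma> * of_real x)) * (C * (rGamma s * of_real x powr (s - 1)))"
    and "x > 0"
  shows "(D_sub \<sigma> ^^ m) F x = exp (- (\<sigma> * of_real x)) * (C * (rGamma (s - of_nat m) * of_real x powr (s - of_nat m - 1)))"
  using \<open>x > 0\<close>
proof (induction m arbitrary: x)
  case (Suc m)
  define t where "t = s - of_nat m"
  define G where "G = (\<lambda>z. exp (- (\<sigma> * z)) * (C * (rGamma t * z powr (t - 1))))"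
  have "(G has_field_derivative
      exp (- (\<sigma> * of_real x)) * (C * (rGamma t * ((t - 1) * of_real x powr (t - 1 - 1)))) +
      - \<sigma> * exp (- (\<sigma> * of_real x)) * (C * (rGamma t * of_real x powr (t - 1)))) (at (of_real x))"
    unfolding G_def using Suc.prems
    by (auto intro!: derivative_eq_intros has_field_derivative_powr simp: algebra_simps)
  then have "((\<lambda>x. G (of_real x)) has_vector_derivative
      exp (- (\<sigma> * of_real x)) * (C * (rGamma t * ((t - 1) * of_real x powr (t - 1 - 1)))) - \<sigma> * G (of_real x)) (at x)"
    by (intro has_vector_derivative_real_field) (simp add: G_def mult_ac)
  then have "((D_sub \<sigma> ^^ m) F has_vector_derivative
      exp (- (\<sigma> * of_real x)) * (C * (rGamma t * ((t - 1) * of_real x powr (t - 1 - 1)))) - \<sigma> * G (of_real x)) (at x)"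
    by (rule has_vector_derivative_transform_within_open[of _ _ _ "{0<..}"])
       (use Suc in \<open>auto simp: G_def t_def\<close>)
  then have "vector_derivative ((D_sub \<sigma> ^^ m) F) (at x) =
      exp (- (\<sigma> * of_real x)) * (C * (rGamma t * ((t - 1) * of_real x powr (t - 1 - 1)))) - \<sigma> * G (of_real x)"
    by (rule vector_derivative_at)
  moreover have "(D_sub \<sigma> ^^ m) F x = G (of_real x)"
    using Suc by (simp add: G_def t_def)
  moreover have "rGamma t * (t - 1) = rGamma (t - 1)"
    using rGamma_plus1[of "t - 1"] by (simp add: mult.commute)
  ultimately have "(D_sub \<sigma> ^^ Suc m) F x = exp (- (\<sigma> * of_real x)) * (C * (rGamma (t - 1) * of_real x powr (t - 1 - 1)))"
    by (simp add: D_sub_def mult.assoc[symmetric]) 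
  then show ?case by (simp add: t_def algebra_simps)
qed (simp add: F)

lemma I_sub_pow_eq:
  assumes "\<beta> \<notin> \<int>\<^sub>\<le>\<^sub>0" "x > 0"
  shows "I_sub_pow \<alpha> \<sigma> \<beta> x = exp (- (\<sigma> * of_real x)) * (Gamma \<beta> *
    (rGamma (of_real \<alpha> + \<beta>) * of_real x powr (of_real \<alpha> + \<beta> - 1)))"
proof (cases "Re \<beta> > 0")
  case Re: True
  consider "\<alpha> > 0" | "\<alpha> = 0" | "\<alpha> < 0" by linarith
  then show ?thesis
  proof cases
    case 1
    then show ?thesis using Re assms(2) I_sub_pos_sub_pow[of \<alpha> \<beta> x \<sigma>] by (simp add: I_sub_pow_def I_sub_def mult.assoc)
  next
    case 2
    have "Gamma \<beta> * rGamma \<beta> = 1" using assms(1) by (simp add: Gamma_def rGamma_eq_zero_iff)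
    then show ?thesis using Re assms(2) 2
      by (simp add: I_sub_pow_def I_sub_def sub_pow_def flip: mult.assoc)
  next
    case 3
    define m where "m = nat (\<lfloor>- \<alpha>\<rfloor> + 1)"
    define a where "a = real m - (- \<alpha>)"
    have a: "a > 0" using 3 unfolding a_def m_def by linarith
    have "(D_sub \<sigma> ^^ m) (I_sub_pos a \<sigma> (sub_pow \<sigma> \<beta>)) x =
      exp (- (\<sigma> * of_real x)) * (Gamma \<beta> * (rGamma (of_real a + \<beta> - of_nat m) * of_real x powr (of_real a + \<beta> - of_nat m - 1)))"
      by (rule D_sub_power) (use I_sub_pos_sub_pow[OF a Re] assms(2) in \<open>simp_all add: mult.assoc\<close>)
    moreover have "of_real a + \<beta> - of_nat m = of_real \<alpha> + \<beta>" by (simp add: a_def)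
    ultimately show ?thesis using Re 3
      by (simp add: I_sub_pow_def I_sub_def D_sub_frac_def Let_def flip: m_def a_def[simplified])
  qed
qed (simp add: I_sub_pow_def mult.assoc)

section \<open>Stability, consistency and convergence\<close>

lemma poly_bounded_powr_imp_zero:
  assumes "poly_bounded q (\<lambda>n. c * of_nat n powr t)" "q < Re t"
  shows "c = 0"
proof (rule ccontr)
  assume "c \<noteq> 0"
  from assms(1) have "(\<lambda>n. norm (c * of_nat n powr t)) \<in> O(\<lambda>n. real n powr q)"
    by (simp add: poly_bounded_iff_bigo)
  then have "(\<lambda>n. norm c * real n powr Re t) \<in> O(\<lambda>n. real n powr q)"
    by (simp only: norm_mult norm_of_nat_powr)
  then have "(\<lambda>n. real n powr Re t) \<in> O(\<lambda>n. real n powr q)"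
    using \<open>c \<noteq> 0\<close> by simp
  moreover have "(\<lambda>n. real n powr q) \<in> o(\<lambda>n. real n powr Re t)"
    using assms(2) by real_asymp
  ultimately have "(\<lambda>n. real n powr Re t) \<in> o(\<lambda>n. real n powr Re t)"
    by (rule landau_o.big_small_trans)
  then have "eventually (\<lambda>n. real n powr Re t = 0) at_top"
    by (simp add: landau_o.small_refl_iff)
  then have "eventually (\<lambda>n::nat. False) at_top"
    using eventually_gt_at_top[of 0] by eventually_elim auto
  then show False by simp
qed

lemma norm_kappa: "norm (kappa \<sigma> h \<omega> n) = exp (- (real n * h * Re \<sigma>)) * norm (\<omega> n)"
  by (simp add: kappa_def norm_mult mult_ac)

text \<open>For n h in [0, T] the modulus of exp (- \<sigma> n h) lies between positive constants,
  so \<sigma> and h drop out of the condition.\<close>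

lemma stable_quad_iff:
  assumes "T > 0"
  shows "stable_quad T \<alpha> \<sigma> \<omega> \<longleftrightarrow> poly_bounded (\<alpha> - 1) \<omega>"
proof
  assume "stable_quad T \<alpha> \<sigma> \<omega>"
  then obtain C where C: "\<And>h n. h > 0 \<Longrightarrow> n \<ge> 1 \<Longrightarrow> real n * h \<le> T \<Longrightarrow>
      norm (kappa \<sigma> h \<omega> n) \<le> C * real n powr (\<alpha> - 1)"
    unfolding stable_quad_def by blast
  show "poly_bounded (\<alpha> - 1) \<omega>"
  proof (rule poly_bounded_eventually_norm_le, rule eventually_mono[OF eventually_ge_at_top[of 1]])
    fix n :: nat assume n: "1 \<le> n"
    then have "norm (kappa \<sigma> (T / real n) \<omega> n) \<le> C * real n powr (\<alpha> - 1)"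
      using assms by (intro C) auto
    then show "norm (\<omega> n) \<le> (C * exp (T * Re \<sigma>)) * real n powr (\<alpha> - 1)"
      using n by (simp add: norm_kappa exp_minus field_simps)
  qed
next
  assume "poly_bounded (\<alpha> - 1) \<omega>"
  then obtain D where D: "D > 0" "\<And>n. norm (\<omega> n) \<le> D * real (Suc n) powr (\<alpha> - 1)"
    using poly_boundedE by blast
  have "norm (kappa \<sigma> h \<omega> n) \<le> (exp (T * \<bar>Re \<sigma>\<bar>) * (D * 2 powr \<bar>\<alpha> - 1\<bar>)) * real n powr (\<alpha> - 1)"
    if "h > 0" "n \<ge> 1" "real n * h \<le> T" for h n
  proof -
    have "- (real n * h * Re \<sigma>) \<le> (real n * h) * \<bar>Re \<sigma>\<bar>"
      using that mult_left_mono[of "- Re \<sigma>" "\<bar>Re \<sigma>\<bar>" "real n * h"] by simp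
    also have "\<dots> \<le> T * \<bar>Re \<sigma>\<bar>" using that by (intro mult_right_mono) auto
    finally have 1: "exp (- (real n * h * Re \<sigma>)) \<le> exp (T * \<bar>Re \<sigma>\<bar>)" by simp
    have "real (Suc n) powr (\<alpha> - 1) \<le> real n powr (\<alpha> - 1) * 2 powr \<bar>\<alpha> - 1\<bar>"
      using that by (intro powr_le_powr_mult_powr_abs) auto
    then have "D * real (Suc n) powr (\<alpha> - 1) \<le> D * (real n powr (\<alpha> - 1) * 2 powr \<bar>\<alpha> - 1\<bar>)"
      using D(1) by (intro mult_left_mono) auto
    then have 2: "norm (\<omega> n) \<le> D * (real n powr (\<alpha> - 1) * 2 powr \<bar>\<alpha> - 1\<bar>)"
      using D(2)[of n] by linarith
    have "norm (kappa \<sigma> h \<omega> n) \<le> exp (T * \<bar>Re \<sigma>\<bar>) * (D * (real n powr (\<alpha> - 1) * 2 powr \<bar>\<alpha> - 1\<bar>))"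
      unfolding norm_kappa by (intro mult_mono 1 2) auto
    then show ?thesis by (simp add: mult_ac)
  qed
  then show "stable_quad T \<alpha> \<sigma> \<omega>" unfolding stable_quad_def by blast
qed

text \<open>The error multiplied by exp \<sigma> * n powr (\<alpha> + \<beta> - 1). At j = 0
  \<open>powr\<close> gives 0 even for \<beta> = 1, where \<open>sub_pow\<close> has the value 1;
  hence the extra term \<omega> n.\<close>

definition scaled_error :: "real \<Rightarrow> (nat \<Rightarrow> complex) \<Rightarrow> complex \<Rightarrow> nat \<Rightarrow> complex" where
  "scaled_error \<alpha> \<omega> \<beta> n = (\<Sum>j\<le>n. \<omega> (n - j) * of_nat j powr (\<beta> - 1)) + (if \<beta> = 1 then \<omega> n else 0)
     - Gamma \<beta> * rGamma_powr (of_real \<alpha> + \<beta>) n"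

lemma E_sub_pow_eq:
  assumes "\<beta> \<notin> \<int>\<^sub>\<le>\<^sub>0" "n > 0"
  shows "E_sub_pow \<alpha> \<sigma> \<omega> (1 / real n) \<beta> n =
    exp (- \<sigma>) * of_nat n powr (1 - of_real \<alpha> - \<beta>) * scaled_error \<alpha> \<omega> \<beta> n"
proof -
  define N where "N = (of_nat n :: complex)"
  have N: "N \<noteq> 0" using assms(2) by (simp add: N_def)
  define P where "P = (\<lambda>j::nat. of_nat j powr (\<beta> - 1) + (if j = 0 \<and> \<beta> = 1 then 1 else 0 :: complex))"
  have pow: "(if real j * (1 / real n) = 0 \<and> \<beta> = 1 then 1 else complex_of_real (real j * (1 / real n)) powr (\<beta> - 1))
      = N powr (1 - \<beta>) * P j" for j
  proof (cases "j = 0")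
    case True
    then show ?thesis using N assms(2) by (auto simp: P_def)
  next
    case False
    have "of_nat j powr (\<beta> - 1) = complex_of_real (real j * (1 / real n)) powr (\<beta> - 1) * N powr (\<beta> - 1)"
      using assms(2) powr_times_real[of "complex_of_real (real j * (1 / real n))" N "\<beta> - 1"]
      by (simp add: N_def)
    moreover have "N powr (1 - \<beta>) * N powr (\<beta> - 1) = 1" using N by (simp flip: powr_add)
    ultimately have "N powr (1 - \<beta>) * of_nat j powr (\<beta> - 1) = complex_of_real (real j * (1 / real n)) powr (\<beta> - 1)"
      by (metis (no_types, lifting) mult.commute mult.left_commute mult_1_right)
    then show ?thesis using False assms(2) by (simp add: P_def)
  qed
  have "kappa \<sigma> (1 / real n) \<omega> (n - j) * sub_pow \<sigma> \<beta> (real j * (1 / real n))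
      = exp (- \<sigma>) * (N powr (1 - \<beta>) * (\<omega> (n - j) * P j))" if "j \<le> n" for j
  proof -
    have "- (of_nat (n - j) * \<sigma> * complex_of_real (1 / real n)) + - (\<sigma> * complex_of_real (real j * (1 / real n)))
        = - (\<sigma> * ((of_nat (n - j) + of_nat j) / N))"
      by (simp add: N_def add_divide_distrib distrib_left mult_ac)
    also have "(of_nat (n - j) + of_nat j) / N = 1"
      using that N by (simp add: N_def of_nat_diff)
    finally have "exp (- (of_nat (n - j) * \<sigma> * complex_of_real (1 / real n))) * exp (- (\<sigma> * complex_of_real (real j * (1 / real n)))) = exp (- \<sigma>)"
      by (simp only: exp_add[symmetric] mult_1_right)
    then show ?thesis unfolding kappa_def sub_pow_def pow by (simp only: mult_ac)
  qed
  then have s1: "(\<Sum>j\<le>n. kappa \<sigma> (1 / real n) \<omega> (n - j) * sub_pow \<sigma> \<beta> (real j * (1 / real n)))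
      = exp (- \<sigma>) * (N powr (1 - \<beta>) * (\<Sum>j\<le>n. \<omega> (n - j) * P j))"
    by (simp add: sum_distrib_left)
  have s2: "(\<Sum>j\<le>n. \<omega> (n - j) * P j) = (\<Sum>j\<le>n. \<omega> (n - j) * of_nat j powr (\<beta> - 1)) + (if \<beta> = 1 then \<omega> n else 0)"
  proof -
    have "(\<Sum>j\<le>n. \<omega> (n - j) * (if j = 0 \<and> \<beta> = 1 then 1 else 0)) = (\<Sum>j\<le>n. if j = 0 then (if \<beta> = 1 then \<omega> n else 0) else 0)"
      by (intro sum.cong) auto
    then show ?thesis by (simp add: P_def distrib_left sum.distrib)
  qed
  have s3: "complex_of_real ((1 / real n) powr \<alpha>) = N powr (- of_real \<alpha>)"
  proof -
    have "(1 / real n) powr \<alpha> = real n powr (- \<alpha>)"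
      using assms(2) by (simp add: powr_minus inverse_powr divide_inverse)
    then show ?thesis using powr_of_real[of "real n" "- \<alpha>"] by (simp add: N_def)
  qed
  have s4: "N powr (- of_real \<alpha>) * N powr (1 - \<beta>) = N powr (1 - of_real \<alpha> - \<beta>)"
    by (simp add: algebra_simps flip: powr_add)
  have Om: "Omega_sub \<alpha> \<sigma> \<omega> (1 / real n) (sub_pow \<sigma> \<beta>) n = exp (- \<sigma>) * N powr (1 - of_real \<alpha> - \<beta>) *
      ((\<Sum>j\<le>n. \<omega> (n - j) * of_nat j powr (\<beta> - 1)) + (if \<beta> = 1 then \<omega> n else 0))"
    unfolding Omega_sub_def s3 s1 s2 s4[symmetric] by (simp only: mult_ac)
  have s5: "N powr (1 - of_real \<alpha> - \<beta>) * N powr (of_real \<alpha> + \<beta> - 1) = 1"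
    using N by (simp flip: powr_add)
  have "rGamma (of_real \<alpha> + \<beta>) = N powr (1 - of_real \<alpha> - \<beta>) * rGamma_powr (of_real \<alpha> + \<beta>) n"
    unfolding rGamma_powr_def N_def[symmetric] by (subst mult.left_commute) (simp only: s5 mult_1_right)
  moreover have "I_sub_pow \<alpha> \<sigma> \<beta> 1 = exp (- \<sigma>) * (Gamma \<beta> * rGamma (of_real \<alpha> + \<beta>))"
    using I_sub_pow_eq[OF assms(1), of 1 \<alpha> \<sigma>] by simp
  ultimately have I: "I_sub_pow \<alpha> \<sigma> \<beta> 1 = exp (- \<sigma>) * N powr (1 - of_real \<alpha> - \<beta>) * (Gamma \<beta> * rGamma_powr (of_real \<alpha> + \<beta>) n)"
    by simp
  have "real n * (1 / real n) = 1" using assms(2) by simp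
  then show ?thesis unfolding E_sub_pow_def Om scaled_error_def N_def[symmetric] using I
    by (simp only: right_diff_distrib)
qed

text \<open>The admissible error has exact order n powr (- min (Re \<beta>) p), to which the scaling
  adds the exponent \<alpha> + Re \<beta> - 1.\<close>

lemma E_sub_pow_bigo_iff:
  assumes "\<beta> \<notin> \<int>\<^sub>\<le>\<^sub>0"
  shows "(\<lambda>n. norm (E_sub_pow \<alpha> \<sigma> \<omega> (1 / real n) \<beta> n)) \<in>
      O(\<lambda>n. norm (complex_of_real (1 / real n) powr \<beta>) + (1 / real n) powr p) \<longleftrightarrow>
    poly_bounded (\<alpha> - 1 + Re \<beta> - min (Re \<beta>) p) (scaled_error \<alpha> \<omega> \<beta>)"
proof -
  define m where "m = min (Re \<beta>) p"
  have "(\<lambda>n. norm (complex_of_real (1 / real n) powr \<beta>) + (1 / real n) powr p) \<in> \<Theta>(\<lambda>n. real n powr (- m))"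
  proof (rule bigthetaI)
    have g: "norm (complex_of_real (1 / real n) powr \<beta>) + (1 / real n) powr p
        = real n powr (- Re \<beta>) + real n powr (- p)" if "n > 0" for n :: nat
    proof -
      have "norm (complex_of_real (1 / real n) powr \<beta>) = (1 / real n) powr Re \<beta>"
        by (rule trans[OF norm_powr_real_powr]) (simp_all only: Re_complex_of_real Reals_of_real, simp)
      then show ?thesis using that by (simp add: powr_minus divide_inverse inverse_powr)
    qed
    show "(\<lambda>n. norm (complex_of_real (1 / real n) powr \<beta>) + (1 / real n) powr p) \<in> O(\<lambda>n. real n powr (- m))"
    proof (rule bigoI[of _ 2], rule eventually_mono[OF eventually_gt_at_top[of 0]])
      fix n :: nat assume n: "0 < n"
      have "real n powr (- Re \<beta>) \<le> real n powr (- m)" "real n powr (- p) \<le> real n powr (- m)"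
        using n by (auto simp: m_def intro!: powr_mono)
      then show "norm (norm (complex_of_real (1 / real n) powr \<beta>) + (1 / real n) powr p) \<le> 2 * norm (real n powr (- m))"
        unfolding g[OF n] by simp
    qed
    show "(\<lambda>n. norm (complex_of_real (1 / real n) powr \<beta>) + (1 / real n) powr p) \<in> \<Omega>(\<lambda>n. real n powr (- m))"
    proof (rule landau_omega.bigI[of 1], simp, rule eventually_mono[OF eventually_gt_at_top[of 0]])
      fix n :: nat assume n: "0 < n"
      show "1 * norm (real n powr (- m)) \<le> norm (norm (complex_of_real (1 / real n) powr \<beta>) + (1 / real n) powr p)"
        unfolding g[OF n] by (simp add: m_def min_def)
    qed
  qed
  then have "(\<lambda>n. norm (E_sub_pow \<alpha> \<sigma> \<omega> (1 / real n) \<beta> n)) \<in>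
      O(\<lambda>n. norm (complex_of_real (1 / real n) powr \<beta>) + (1 / real n) powr p) \<longleftrightarrow>
    (\<lambda>n. norm (E_sub_pow \<alpha> \<sigma> \<omega> (1 / real n) \<beta> n)) \<in> O(\<lambda>n. real n powr (- m))"
    by (simp only: landau_o.big.cong_bigtheta)
  also have "\<dots> \<longleftrightarrow> (\<lambda>n. exp (- Re \<sigma>) * (real n powr (1 - \<alpha> - Re \<beta>) * norm (scaled_error \<alpha> \<omega> \<beta> n))) \<in> O(\<lambda>n. real n powr (- m))"
  proof (rule landau_o.big.in_cong, rule eventually_mono[OF eventually_gt_at_top[of 0]])
    fix n :: nat assume "0 < n"
    then show "norm (E_sub_pow \<alpha> \<sigma> \<omega> (1 / real n) \<beta> n) = exp (- Re \<sigma>) * (real n powr (1 - \<alpha> - Re \<beta>) * norm (scaled_error \<alpha> \<omega> \<beta> n))"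
      by (simp add: E_sub_pow_eq[OF assms] norm_mult norm_of_nat_powr)
  qed
  also have "\<dots> \<longleftrightarrow> (\<lambda>n. real n powr (1 - \<alpha> - Re \<beta>) * norm (scaled_error \<alpha> \<omega> \<beta> n)) \<in>
      O(\<lambda>n. real n powr (1 - \<alpha> - Re \<beta>) * real n powr (\<alpha> - 1 + Re \<beta> - m))"
    by (simp flip: powr_add)
  also have "\<dots> \<longleftrightarrow> (\<lambda>n. norm (scaled_error \<alpha> \<omega> \<beta> n)) \<in> O(\<lambda>n. real n powr (\<alpha> - 1 + Re \<beta> - m))"
    by (rule landau_o.big.mult_cancel_left)
       (auto intro!: bigthetaI_cong eventually_mono[OF eventually_gt_at_top[of 0]])
  finally show ?thesis by (simp only: poly_bounded_iff_bigo m_def)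
qed

lemma convergent_quad_iff:
  "convergent_quad p \<alpha> \<sigma> \<omega> \<longleftrightarrow>
    (\<forall>\<beta>. \<beta> \<notin> \<int>\<^sub>\<le>\<^sub>0 \<longrightarrow> poly_bounded (\<alpha> - 1 + Re \<beta> - min (Re \<beta>) p) (scaled_error \<alpha> \<omega> \<beta>))"
  unfolding convergent_quad_def by (intro iff_allI imp_cong refl E_sub_pow_bigo_iff)

section \<open>Recovering the weights from their convolution\<close>

lemma sum_Suc_powr_minus_3_le: "(\<Sum>i\<in>{1..n}. real (Suc i) powr (- 3)) \<le> 1 / 2"
proof -
  have "(\<Sum>i\<in>{1..n}. real (Suc i) powr (- 3)) \<le> (1 - 1 / real (Suc n)) / 2"
  proof (induction n)
    case (Suc n)
    let ?x = "real (Suc (Suc n))"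
    have "?x powr (- 3) = 1 / (?x * ?x * ?x)"
      by (simp add: powr_minus powr_numeral power3_eq_cube divide_inverse)
    also have "\<dots> \<le> 1 / (2 * real (Suc n) * ?x)"
      by (intro divide_left_mono mult_mono) auto
    also have "\<dots> = (1 / real (Suc n) - 1 / ?x) / 2" by (simp add: field_simps)
    finally show ?case using Suc.IH by (simp add: diff_divide_distrib)
  qed simp
  also have "\<dots> \<le> 1 / 2" by simp
  finally show ?thesis .
qed

text \<open>As 0 powr (\<beta> - 1) = 0 and 1 powr (\<beta> - 1) = 1, the convolution at n + 1 is
  \<omega> n plus a combination of earlier weights. Even with Peetre's factor its coefficients are
  at most (i + 1) powr (-3), with sum at most 1/2, so an induction with a fixed constant
  closes.\<close>

lemma poly_bounded_deconvolution:
  assumes y: "poly_bounded q (\<lambda>n. \<Sum>j\<le>n. \<omega> (n - j) * of_nat j powr (\<beta> - 1))"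
    and \<beta>: "Re \<beta> - 1 + \<bar>q\<bar> \<le> - 3"
  shows "poly_bounded q \<omega>"
proof -
  define y where "y = (\<lambda>n. \<Sum>j\<le>n. \<omega> (n - j) * of_nat j powr (\<beta> - 1))"
  obtain C where C: "C > 0" "\<And>n. norm (y n) \<le> C * real (Suc n) powr q"
    using assms(1) poly_boundedE unfolding y_def by blast
  \<comment> \<open>One half of \<open>K\<close> pays for the convolution at n + 1, with 2 powr |q|
    for moving the index to n, and the other half for the earlier weights.\<close>
  define K where "K = 2 * (C * 2 powr \<bar>q\<bar>)"
  have K: "K > 0" using C(1) by (simp add: K_def)
  have y_eq: "\<omega> n = y (Suc n) - (\<Sum>i\<in>{1..n}. \<omega> (n - i) * of_nat (Suc i) powr (\<beta> - 1))" for n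
  proof -
    have "y (Suc n) = (\<Sum>i\<le>n. \<omega> (n - i) * of_nat (Suc i) powr (\<beta> - 1))"
      unfolding y_def by (subst sum.atMost_Suc_shift) simp
    also have "\<dots> = \<omega> n + (\<Sum>i\<in>{1..n}. \<omega> (n - i) * of_nat (Suc i) powr (\<beta> - 1))"
      by (subst atMost_atLeast0, subst sum.atLeast_Suc_atMost) simp_all
    finally show ?thesis by simp
  qed
  have "norm (\<omega> n) \<le> K * real (Suc n) powr q" for n
  proof (induction n rule: less_induct)
    case (less n)
    have "real (Suc (n + 1)) powr q \<le> real (Suc n) powr q * 2 powr \<bar>q\<bar>"
      using Suc_add_powr_le[of n 1 q] by simp
    then have "C * real (Suc (n + 1)) powr q \<le> C * (real (Suc n) powr q * 2 powr \<bar>q\<bar>)"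
      using C(1) by (intro mult_left_mono) auto
    then have 1: "norm (y (Suc n)) \<le> K / 2 * real (Suc n) powr q"
      using C(2)[of "Suc n"] by (simp add: K_def mult_ac)
    have "norm (\<Sum>i\<in>{1..n}. \<omega> (n - i) * of_nat (Suc i) powr (\<beta> - 1))
        \<le> (\<Sum>i\<in>{1..n}. K * real (Suc n) powr q * real (Suc i) powr (- 3))"
    proof (rule sum_norm_le)
      fix i assume i: "i \<in> {1..n}"
      have "norm (\<omega> (n - i) * of_nat (Suc i) powr (\<beta> - 1)) = norm (\<omega> (n - i)) * real (Suc i) powr (Re \<beta> - 1)"
        by (simp only: norm_mult norm_of_nat_powr) simp
      also have "\<dots> \<le> (K * real (Suc (n - i)) powr q) * real (Suc i) powr (Re \<beta> - 1)"
        using i by (intro mult_right_mono less) auto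
      also have "\<dots> \<le> (K * (real (Suc n) powr q * real (Suc i) powr \<bar>q\<bar>)) * real (Suc i) powr (Re \<beta> - 1)"
        using i K by (intro mult_right_mono mult_left_mono Suc_diff_powr_le) auto
      also have "\<dots> = K * real (Suc n) powr q * real (Suc i) powr (\<bar>q\<bar> + (Re \<beta> - 1))"
        by (subst powr_add) (simp add: mult_ac)
      also have "\<dots> \<le> K * real (Suc n) powr q * real (Suc i) powr (- 3)"
        using \<beta> K by (intro mult_left_mono powr_mono) auto
      finally show "norm (\<omega> (n - i) * of_nat (Suc i) powr (\<beta> - 1)) \<le> K * real (Suc n) powr q * real (Suc i) powr (- 3)" .
    qed
    also have "\<dots> = K * real (Suc n) powr q * (\<Sum>i\<in>{1..n}. real (Suc i) powr (- 3))"
      by (simp only: sum_distrib_left)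
    also have "\<dots> \<le> K * real (Suc n) powr q * (1 / 2)"
      using K by (intro mult_left_mono sum_Suc_powr_minus_3_le) auto
    finally show ?case
      using 1 norm_triangle_ineq4[of "y (Suc n)" "\<Sum>i\<in>{1..n}. \<omega> (n - i) * of_nat (Suc i) powr (\<beta> - 1)"]
      unfolding y_eq[of n, symmetric] by simp
  qed
  then show ?thesis by (rule poly_boundedI)
qed

lemma half_integer_not_Int: "of_real (real_of_int k + 1 / 2) \<notin> (\<int> :: complex set)"
proof
  assume "of_real (real_of_int k + 1 / 2) \<in> (\<int> :: complex set)"
  then have "real_of_int k + 1 / 2 \<in> \<int>" by (simp only: of_real_in_Ints_iff)
  then obtain i where "real_of_int k + 1 / 2 = of_int i" by (elim Ints_cases)
  then have "of_int (2 * k + 1) = (of_int (2 * i) :: real)" by simp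
  then have "2 * k + 1 = 2 * i" by (simp only: of_int_eq_iff)
  then show False by presburger
qed

lemma convergent_imp_poly_bounded:
  assumes "convergent_quad p \<alpha> \<sigma> \<omega>"
  shows "poly_bounded (\<alpha> - 1) \<omega>"
proof -
  \<comment> \<open>b \<le> p makes O(h powr \<beta>) the larger error, so that the scaled error is
    O(n powr (\<alpha> - 1)); b < 0 gives the same for the exact value; the third bound is the one
    of the deconvolution. The added 1/2 keeps \<beta> off the poles of Gamma.\<close>
  define b where "b = real_of_int (- \<lceil>\<bar>p\<bar> + \<bar>\<alpha> - 1\<bar> + 3\<rceil>) + 1 / 2"
  define \<beta> where "\<beta> = complex_of_real b"
  have b: "b \<le> p" "b < 0" "b - 1 + \<bar>\<alpha> - 1\<bar> \<le> - 3" unfolding b_def by linarith+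
  have "\<beta> \<notin> \<int>" unfolding \<beta>_def b_def by (rule half_integer_not_Int)
  then have "\<beta> \<notin> \<int>\<^sub>\<le>\<^sub>0" using nonpos_Ints_subset_Ints by blast
  then have "poly_bounded (\<alpha> - 1 + Re \<beta> - min (Re \<beta>) p) (scaled_error \<alpha> \<omega> \<beta>)"
    using assms unfolding convergent_quad_iff by blast
  then have 1: "poly_bounded (\<alpha> - 1) (scaled_error \<alpha> \<omega> \<beta>)" using b by (simp add: \<beta>_def)
  have 2: "poly_bounded (\<alpha> - 1) (\<lambda>n. Gamma \<beta> * rGamma_powr (of_real \<alpha> + \<beta>) n)"
    by (intro poly_bounded_cmult poly_bounded_mono[OF poly_bounded_rGamma_powr]) (use b in \<open>simp add: \<beta>_def\<close>)
  have "\<beta> \<noteq> 1" using b(2) by (auto simp: \<beta>_def complex_eq_iff)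
  then have "poly_bounded (\<alpha> - 1) (\<lambda>n. \<Sum>j\<le>n. \<omega> (n - j) * of_nat j powr (\<beta> - 1))"
    using poly_bounded_add[OF 1 2] by (simp add: scaled_error_def)
  then show ?thesis by (rule poly_bounded_deconvolution) (use b(3) in \<open>simp add: \<beta>_def\<close>)
qed

lemma fps_nth_Abs_fps_eta: "fps_nth (Abs_fps f) = f"
  by (rule ext) simp

text \<open>Coefficient l contributes n powr (\<alpha> + Re \<beta> - l - 1), against an allowance
  of n powr (\<alpha> + Re \<beta> - 1 - min (Re \<beta>) p). Hence l \<ge> p is harmless for every
  \<beta>, while one \<beta> with large real part detects every l < p.\<close>

lemma convergent_quad_iff_symbol:
  assumes gen: "generating_form \<alpha> \<omega> w" and bd: "poly_bounded (\<alpha> - 1) \<omega>"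
  shows "convergent_quad p \<alpha> \<sigma> \<omega> \<longleftrightarrow> (\<forall>l. real l < p \<longrightarrow> fps_nth (quad_symbol \<alpha> w - 1) l = 0)"
proof -
  let ?e = "fps_nth (quad_symbol \<alpha> w - 1)"
  let ?s = "\<lambda>\<beta> L n. \<Sum>l<L. ?e l * rGamma_powr (of_real \<alpha> + \<beta> - of_nat l) n"
  have bd': "coeff_bounded (\<alpha> - 1) (Abs_fps \<omega>)"
    using bd by (simp add: fps_nth_Abs_fps_eta)
  have main: "poly_bounded (\<alpha> - 1) (\<lambda>n. scaled_error \<alpha> \<omega> \<beta> n - Gamma \<beta> * ?s \<beta> L n)"
    if \<beta>: "\<beta> \<notin> \<int>\<^sub>\<le>\<^sub>0" and L: "Re \<beta> \<le> real L" "L > 0" for \<beta> L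
  proof -
    have "poly_bounded (\<alpha> - 1) (\<lambda>n. if \<beta> = 1 then \<omega> n else 0)"
      using bd by (cases "\<beta> = 1") (auto simp: poly_bounded_zero)
    from poly_bounded_add[OF convolution_power_expansion[OF gen bd' \<beta> L(1)] this]
    show ?thesis
    proof (rule arg_cong[where f = "poly_bounded (\<alpha> - 1)", THEN iffD1, rotated], intro ext)
      fix n
      have "(\<Sum>l<L. fps_nth 1 l * rGamma_powr (of_real \<alpha> + \<beta> - of_nat l) n) = rGamma_powr (of_real \<alpha> + \<beta>) n"
        using L(2) by (subst sum.remove[of _ 0]) auto
      then have "?s \<beta> L n = (\<Sum>l<L. fps_nth (quad_symbol \<alpha> w) l * rGamma_powr (of_real \<alpha> + \<beta> - of_nat l) n)
          - rGamma_powr (of_real \<alpha> + \<beta>) n"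
        by (simp add: left_diff_distrib sum_subtractf)
      then show "(\<Sum>j\<le>n. \<omega> (n - j) * of_nat j powr (\<beta> - 1)) -
          Gamma \<beta> * (\<Sum>l<L. fps_nth (quad_symbol \<alpha> w) l * rGamma_powr (of_real \<alpha> + \<beta> - of_nat l) n)
          + (if \<beta> = 1 then \<omega> n else 0) = scaled_error \<alpha> \<omega> \<beta> n - Gamma \<beta> * ?s \<beta> L n"
        by (simp add: scaled_error_def right_diff_distrib)
    qed
  qed
  show ?thesis
  proof
    assume conv: "convergent_quad p \<alpha> \<sigma> \<omega>"
    show "\<forall>l. real l < p \<longrightarrow> ?e l = 0"
    proof (rule ccontr)
      assume "\<not> ?thesis"
      then obtain l' where l': "real l' < p" "?e l' \<noteq> 0" by blast
      define l where "l = (LEAST l. ?e l \<noteq> 0)"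
      have l: "?e l \<noteq> 0" unfolding l_def using l'(2) by (rule LeastI)
      have "l \<le> l'" unfolding l_def using l'(2) by (rule Least_le)
      then have lp: "real l < p" using l'(1) by linarith
      have below: "?e k = 0" if "k < l" for k using that not_less_Least unfolding l_def by blast
      define k where "k = \<lceil>\<bar>p\<bar> + \<bar>\<alpha>\<bar> + 1\<rceil>"
      \<comment> \<open>b > p lets p decide the allowance, and \<alpha> + \<beta>, half an odd
        integer, keeps 1 / Gamma(\<alpha> + \<beta> - l) from vanishing.\<close>
      define b where "b = real_of_int k + 1 / 2 - \<alpha>"
      define \<beta> where "\<beta> = complex_of_real b"
      have b: "p < b" "0 < b" unfolding b_def k_def by linarith+
      define L where "L = nat \<lceil>b\<rceil>"
      have L: "b \<le> real L" unfolding L_def by linarith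
      have lL: "l < L" "L > 0" using L lp b by linarith+
      have \<beta>: "\<beta> \<notin> \<int>\<^sub>\<le>\<^sub>0" using b(2) by (intro Re_pos_not_nonpos_Int) (simp add: \<beta>_def)
      \<comment> \<open>Covers the allowance and all terms after the first nonzero one, yet stays
        below the exponent \<alpha> + b - l - 1 of that term.\<close>
      define r where "r = max (\<alpha> + b - 1 - p) (\<alpha> + b - real l - 2)"
      have "poly_bounded (\<alpha> - 1 + Re \<beta> - min (Re \<beta>) p) (scaled_error \<alpha> \<omega> \<beta>)"
        using conv \<beta> unfolding convergent_quad_iff by blast
      then have 1: "poly_bounded (\<alpha> + b - 1 - p) (scaled_error \<alpha> \<omega> \<beta>)"
        using b(1) by (simp add: \<beta>_def min_def algebra_simps)
      have "poly_bounded (\<alpha> + b - 1 - p) (\<lambda>n. scaled_error \<alpha> \<omega> \<beta> n - Gamma \<beta> * ?s \<beta> L n)"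
        by (rule poly_bounded_mono[OF main[OF \<beta>]]) (use L lL b in \<open>simp_all add: \<beta>_def\<close>)
      from poly_bounded_diff[OF 1 this] have "poly_bounded (\<alpha> + b - 1 - p) (\<lambda>n. Gamma \<beta> * ?s \<beta> L n)" by simp
      from poly_bounded_cmult[OF this, of "rGamma \<beta>"] have "poly_bounded (\<alpha> + b - 1 - p) (?s \<beta> L)"
        using \<beta> by (simp add: Gamma_def rGamma_eq_zero_iff flip: mult.assoc)
      then have 2: "poly_bounded r (?s \<beta> L)" by (rule poly_bounded_mono) (simp add: r_def)
      have 3: "poly_bounded r (\<lambda>n. \<Sum>i\<in>{l<..<L}. ?e i * rGamma_powr (of_real \<alpha> + \<beta> - of_nat i) n)"
      proof (intro poly_bounded_sum poly_bounded_cmult)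
        fix i assume "i \<in> {l<..<L}"
        then have "real l + 1 \<le> real i" by simp
        then show "poly_bounded r (rGamma_powr (of_real \<alpha> + \<beta> - of_nat i))"
          by (intro poly_bounded_mono[OF poly_bounded_rGamma_powr]) (simp add: r_def \<beta>_def)
      qed
      have "?s \<beta> L n - (\<Sum>i\<in>{l<..<L}. ?e i * rGamma_powr (of_real \<alpha> + \<beta> - of_nat i) n) =
          (?e l * rGamma (of_real \<alpha> + \<beta> - of_nat l)) * of_nat n powr (of_real \<alpha> + \<beta> - of_nat l - 1)" for n
      proof -
        have "?s \<beta> L n = (\<Sum>i\<in>insert l {l<..<L}. ?e i * rGamma_powr (of_real \<alpha> + \<beta> - of_nat i) n)"
          by (rule sum.mono_neutral_right) (use below lL in auto)
        then show ?thesis by (simp add: rGamma_powr_def)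
      qed
      with poly_bounded_diff[OF 2 3] have "poly_bounded r (\<lambda>n.
          (?e l * rGamma (of_real \<alpha> + \<beta> - of_nat l)) * of_nat n powr (of_real \<alpha> + \<beta> - of_nat l - 1))" by simp
      then have "?e l * rGamma (of_real \<alpha> + \<beta> - of_nat l) = 0"
        by (rule poly_bounded_powr_imp_zero) (use lp in \<open>simp add: r_def \<beta>_def\<close>)
      then have "of_real \<alpha> + \<beta> - of_nat l \<in> \<int>\<^sub>\<le>\<^sub>0" using l by (simp add: rGamma_eq_zero_iff)
      moreover have "of_real \<alpha> + \<beta> - of_nat l = of_real (real_of_int (k - int l) + 1 / 2)"
        by (simp add: \<beta>_def b_def)
      ultimately show False using half_integer_not_Int[of "k - int l"] nonpos_Ints_subset_Ints by auto
    qed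
  next
    assume e: "\<forall>l. real l < p \<longrightarrow> ?e l = 0"
    show "convergent_quad p \<alpha> \<sigma> \<omega>" unfolding convergent_quad_iff
    proof (intro allI impI)
      fix \<beta> :: complex assume \<beta>: "\<beta> \<notin> \<int>\<^sub>\<le>\<^sub>0"
      define r where "r = \<alpha> - 1 + Re \<beta> - min (Re \<beta>) p"
      \<comment> \<open>The successor keeps in the sum the term l = 0, from which the exact value is
        subtracted.\<close>
      define L where "L = Suc (nat \<lceil>Re \<beta>\<rceil>)"
      have L: "Re \<beta> \<le> real L" "L > 0" unfolding L_def by linarith+
      have 1: "poly_bounded r (\<lambda>n. scaled_error \<alpha> \<omega> \<beta> n - Gamma \<beta> * ?s \<beta> L n)"
        by (rule poly_bounded_mono[OF main[OF \<beta> L]]) (simp add: r_def)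
      have "poly_bounded r (\<lambda>n. ?e l * rGamma_powr (of_real \<alpha> + \<beta> - of_nat l) n)" for l
      proof (cases "real l < p")
        case True
        then show ?thesis using e by (simp add: poly_bounded_zero)
      next
        case False
        then show ?thesis
          by (intro poly_bounded_cmult poly_bounded_mono[OF poly_bounded_rGamma_powr]) (simp add: r_def min_def)
      qed
      then have "poly_bounded r (\<lambda>n. Gamma \<beta> * ?s \<beta> L n)"
        by (intro poly_bounded_cmult[of r "?s \<beta> L"] poly_bounded_sum)
      from poly_bounded_add[OF 1 this] show "poly_bounded r (scaled_error \<alpha> \<omega> \<beta>)" by simp
    qed
  qed
qed

section \<open>The consistency error as a power series in h\<close>

lemma fps_expansion_bigo_powr_iff:
  fixes H :: "complex \<Rightarrow> complex"
  assumes "H has_fps_expansion F"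
  shows "(\<lambda>h. norm (H (of_real h))) \<in> O[at_right 0](\<lambda>h. h powr p) \<longleftrightarrow> (\<forall>l. real l < p \<longrightarrow> fps_nth F l = 0)"
proof -
  have lim: "filterlim (\<lambda>h. complex_of_real h) (nhds 0) (at_right 0)"
    by (rule tendsto_eq_intros refl | simp)+
  have rem: "\<exists>g :: complex \<Rightarrow> complex. ((\<lambda>h. norm (g (complex_of_real h))) \<longlongrightarrow> norm (fps_nth F N)) (at_right 0) \<and>
      eventually (\<lambda>h. norm (H (of_real h)) = h ^ N * norm (g (of_real h))) (at_right 0)"
    if "\<And>l. l < N \<Longrightarrow> fps_nth F l = 0" for N
  proof -
    obtain g where g: "isCont g 0" "g 0 = fps_nth F N"
      "eventually (\<lambda>z. H z = (\<Sum>k<N. fps_nth F k * z ^ k) + z ^ N * g z) (nhds 0)"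
      by (rule has_fps_expansion_remainder[OF assms, of N]) blast
    have "((\<lambda>h. norm (g (complex_of_real h))) \<longlongrightarrow> norm (g 0)) (at_right 0)"
      by (intro tendsto_norm isCont_tendsto_compose[OF g(1) lim])
    moreover have "eventually (\<lambda>h. norm (H (of_real h)) = h ^ N * norm (g (of_real h))) (at_right 0)"
      using eventually_compose_filterlim[OF g(3) lim] eventually_at_right_less[of "0::real"]
      by eventually_elim (simp add: that norm_mult norm_power)
    ultimately show ?thesis using g(2) by auto
  qed
  show ?thesis
  proof
    assume bigo: "(\<lambda>h. norm (H (of_real h))) \<in> O[at_right 0](\<lambda>h. h powr p)"
    show "\<forall>l. real l < p \<longrightarrow> fps_nth F l = 0"
    proof (rule ccontr)
      assume "\<not> ?thesis"
      then obtain l' where l': "real l' < p" "fps_nth F l' \<noteq> 0" by blast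
      define l where "l = (LEAST l. fps_nth F l \<noteq> 0)"
      have l: "fps_nth F l \<noteq> 0" unfolding l_def using l'(2) by (rule LeastI)
      have "l \<le> l'" unfolding l_def using l'(2) by (rule Least_le)
      then have lp: "real l < p" using l'(1) by linarith
      have below: "fps_nth F k = 0" if "k < l" for k using that not_less_Least unfolding l_def by blast
      obtain g :: "complex \<Rightarrow> complex" where g: "((\<lambda>h. norm (g (complex_of_real h))) \<longlongrightarrow> norm (fps_nth F l)) (at_right 0)"
        "eventually (\<lambda>h. norm (H (of_real h)) = h ^ l * norm (g (of_real h))) (at_right 0)"
      proof -
        have "\<exists>g :: complex \<Rightarrow> complex. ((\<lambda>h. norm (g (complex_of_real h))) \<longlongrightarrow> norm (fps_nth F l)) (at_right 0) \<and>
            eventually (\<lambda>h. norm (H (of_real h)) = h ^ l * norm (g (of_real h))) (at_right 0)"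
          by (rule rem) (rule below)
        then show ?thesis using that by (elim exE conjE)
      qed
      obtain c where c: "eventually (\<lambda>h. norm (H (of_real h)) \<le> c * h powr p) (at_right 0)"
        using bigo by (elim landau_o.bigE) (auto elim!: eventually_mono)
      have "eventually (\<lambda>h. norm (g (complex_of_real h)) \<le> c * h powr (p - real l)) (at_right 0)"
        using c g(2) eventually_at_right_less[of "0::real"]
      proof eventually_elim
        case (elim h)
        then have "h ^ l * norm (g (of_real h)) \<le> h ^ l * (c * h powr (p - real l))"
          by (simp add: powr_diff powr_realpow)
        then show ?case using elim(3) by simp
      qed
      moreover have "((\<lambda>h. c * h powr (p - real l)) \<longlongrightarrow> 0) (at_right 0)"
        using lp by real_asymp
      ultimately have "norm (fps_nth F l) \<le> 0"
        using g(1) by (intro tendsto_le[of "at_right (0::real)"]) auto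
      then show False using l by simp
    qed
  next
    assume zero: "\<forall>l. real l < p \<longrightarrow> fps_nth F l = 0"
    \<comment> \<open>For p \<le> 0 this is 0, and no coefficient has to vanish.\<close>
    define N where "N = nat \<lceil>p\<rceil>"
    have N: "p \<le> real N" unfolding N_def by linarith
    have "fps_nth F l = 0" if "l < N" for l
    proof -
      have "real l < p" using that unfolding N_def by linarith
      then show ?thesis using zero by blast
    qed
    then have "\<exists>g :: complex \<Rightarrow> complex. ((\<lambda>h. norm (g (complex_of_real h))) \<longlongrightarrow> norm (fps_nth F N)) (at_right 0) \<and>
        eventually (\<lambda>h. norm (H (of_real h)) = h ^ N * norm (g (of_real h))) (at_right 0)"
      by (rule rem)
    then obtain g :: "complex \<Rightarrow> complex" where g:
      "((\<lambda>h. norm (g (complex_of_real h))) \<longlongrightarrow> norm (fps_nth F N)) (at_right 0)"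
      "eventually (\<lambda>h. norm (H (of_real h)) = h ^ N * norm (g (of_real h))) (at_right 0)"
      by (elim exE conjE)
    have "eventually (\<lambda>h. norm (g (complex_of_real h)) < norm (fps_nth F N) + 1) (at_right 0)"
      by (rule order_tendstoD(2)[OF g(1)]) simp
    moreover have "eventually (\<lambda>h::real. h < 1) (at_right 0)"
      by (rule eventually_at_right_real[of 0 1, simplified, THEN eventually_mono]) auto
    ultimately have "eventually (\<lambda>h. norm (norm (H (of_real h))) \<le> (norm (fps_nth F N) + 1) * norm (h powr p)) (at_right 0)"
      using g(2) eventually_at_right_less[of "0::real"]
    proof eventually_elim
      case (elim h)
      have "h ^ N = h powr real N" using elim by (simp add: powr_realpow)
      also have "\<dots> \<le> h powr p" using elim N by (intro powr_mono') auto
      finally have "h ^ N * norm (g (complex_of_real h)) \<le> h powr p * (norm (fps_nth F N) + 1)"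
        using elim by (intro mult_mono) auto
      then show ?case using elim by (simp add: mult.commute)
    qed
    then show "(\<lambda>h. norm (H (of_real h))) \<in> O[at_right 0](\<lambda>h. h powr p)" by (rule bigoI)
  qed
qed

text \<open>The powers of h and of 1 - exp(-h) are merged, so that the base tends to 1 and the
  principal branch of \<open>powr\<close> is analytic at h = 0.\<close>

definition quad_symbol_fun :: "real \<Rightarrow> (complex \<Rightarrow> complex) \<Rightarrow> complex \<Rightarrow> complex" where
  "quad_symbol_fun \<alpha> w z =
     w (exp (- z)) * (if z = 0 then 1 else (1 - exp (- z)) / z) powr (- of_real \<alpha>)"

lemma quad_symbol_fun_has_fps_expansion:
  assumes "w analytic_on {1}"
  shows "quad_symbol_fun \<alpha> w has_fps_expansion quad_symbol \<alpha> w"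
proof -
  have Z: "(\<lambda>z. 1 - exp (- z)) has_fps_expansion Z_fps"
    unfolding Z_fps_def by (intro has_fps_expansion_diff has_fps_expansion_1 has_fps_expansion_exp_neg1)
  have "(\<lambda>x. w (1 - x)) has_fps_expansion taylor_at_1 w"
    using assms by (auto elim: analytic_at_1_reflect)
  from has_fps_expansion_compose[OF this Z] have 1: "(\<lambda>z. w (exp (- z))) has_fps_expansion (taylor_at_1 w oo Z_fps)"
    by (simp add: o_def)
  have "(\<lambda>z. if z = 0 then 1 else (1 - exp (- z)) / z ^ 1) has_fps_expansion fps_shift 1 Z_fps"
  proof (rule has_fps_expansion_shift[OF Z])
    have "fps_nth Z_fps 1 \<noteq> 0" by (simp add: Z_fps_eq)
    then show "1 \<le> subdegree Z_fps" by (intro subdegree_geI) auto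
  qed (simp add: Z_fps_eq)
  moreover have "fps_shift 1 Z_fps = \<phi>_fps" by (rule fps_ext) (simp add: Z_fps_eq)
  ultimately have "(\<lambda>z. if z = 0 then 1 else (1 - exp (- z)) / z) has_fps_expansion \<phi>_fps"
    unfolding power_one_right by (simp only:)
  then have "(\<lambda>z. (if z = 0 then 1 else (1 - exp (- z)) / z) - 1) has_fps_expansion (\<phi>_fps - 1)"
    by (intro has_fps_expansion_diff has_fps_expansion_1)
  from has_fps_expansion_compose[OF has_fps_expansion_binomial_complex[of "- of_real \<alpha>"] this]
  have 2: "(\<lambda>z. (if z = 0 then 1 else (1 - exp (- z)) / z) powr (- of_real \<alpha>)) has_fps_expansion \<Phi>_fps (of_real \<alpha>)"
    by (simp add: o_def \<Phi>_fps_def)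
  show ?thesis
    unfolding quad_symbol_fun_def[abs_def] quad_symbol_def by (rule has_fps_expansion_mult[OF 1 2])
qed

lemma consistent_quad_iff_symbol:
  assumes gen: "generating_form \<alpha> \<omega> w" and bd: "poly_bounded (\<alpha> - 1) \<omega>"
  shows "consistent_quad p \<alpha> \<sigma> \<omega> \<longleftrightarrow> (\<forall>l. real l < p \<longrightarrow> fps_nth (quad_symbol \<alpha> w - 1) l = 0)"
proof -
  define A where "A = Abs_fps \<omega>"
  have radA: "fps_conv_radius A \<ge> 1"
    unfolding A_def by (rule fps_conv_radius_ge_1_if_coeff_bounded) (use bd in \<open>simp add: fps_nth_Abs_fps_eta\<close>)
  \<comment> \<open>The factors with \<sigma> in weight and argument cancel. A separate t is kept
    for the radius of convergence: convergence at t = h / 2 puts the point with t = h strictly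
    inside the disc.\<close>
  have kappa_term: "kappa \<sigma> h \<omega> n * (exp (\<sigma> * complex_of_real h) * exp (- complex_of_real t)) ^ n
      = \<omega> n * exp (- complex_of_real t) ^ n" for h t n
  proof -
    have 1: "exp (- (of_nat n * \<sigma> * complex_of_real h)) * exp (\<sigma> * complex_of_real h) ^ n = 1"
      unfolding exp_of_nat_mult[symmetric] exp_add[symmetric] by (simp add: mult.assoc)
    have "kappa \<sigma> h \<omega> n * (exp (\<sigma> * complex_of_real h) * exp (- complex_of_real t)) ^ n =
        (exp (- (of_nat n * \<sigma> * complex_of_real h)) * exp (\<sigma> * complex_of_real h) ^ n) * (\<omega> n * exp (- complex_of_real t) ^ n)"
      by (simp only: kappa_def power_mult_distrib mult_ac)
    then show ?thesis by (simp only: 1 mult_1_left)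
  qed
  have small: "norm (exp (- complex_of_real t)) < 1" if "t > 0" for t using that by simp
  have radius: "ereal (norm (exp (\<sigma> * complex_of_real h) * exp (- complex_of_real h)))
      < fps_conv_radius (Abs_fps (kappa \<sigma> h \<omega>))" if "h > 0" for h
  proof -
    have "summable (\<lambda>n. fps_nth A n * exp (- complex_of_real (h / 2)) ^ n)"
      by (rule summable_fps, rule less_le_trans[OF _ radA]) (use small[of "h / 2"] that in simp)
    then have "summable (\<lambda>n. kappa \<sigma> h \<omega> n * (exp (\<sigma> * complex_of_real h) * exp (- complex_of_real (h / 2))) ^ n)"
      by (simp only: kappa_term A_def fps_nth_Abs_fps)
    then have "ereal (norm (exp (\<sigma> * complex_of_real h) * exp (- complex_of_real (h / 2)))) \<le> conv_radius (kappa \<sigma> h \<omega>)"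
      by (rule conv_radius_geI)
    moreover have "norm (exp (\<sigma> * complex_of_real h) * exp (- complex_of_real h))
        < norm (exp (\<sigma> * complex_of_real h) * exp (- complex_of_real (h / 2)))"
      using that by (simp add: norm_mult)
    ultimately show ?thesis unfolding fps_conv_radius_def
      by (auto simp: Abs_fps_inverse intro: less_le_trans[of _ "ereal _"])
  qed
  have eval: "complex_of_real (h powr \<alpha>) * eval_fps (Abs_fps (kappa \<sigma> h \<omega>)) (exp (\<sigma> * complex_of_real h) * exp (- complex_of_real h))
      = quad_symbol_fun \<alpha> w (of_real h)" if h: "h > 0" for h
  proof -
    define u where "u = 1 - exp (- h)"
    have u: "u > 0" using h by (simp add: u_def)
    have ofu: "1 - exp (- complex_of_real h) = of_real u" by (simp add: u_def exp_of_real flip: of_real_minus)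
    have "eval_fps (Abs_fps (kappa \<sigma> h \<omega>)) (exp (\<sigma> * complex_of_real h) * exp (- complex_of_real h)) = eval_fps A (exp (- complex_of_real h))"
      by (simp add: eval_fps_def kappa_term A_def)
    also have "\<dots> = (1 - exp (- complex_of_real h)) powr (- of_real \<alpha>) * w (exp (- complex_of_real h))"
      using gen small[OF h] less_le_trans[OF _ radA, of "ereal (norm (exp (- complex_of_real h)))"]
      unfolding generating_form_def A_def by simp
    also have "(1 - exp (- complex_of_real h)) powr (- of_real \<alpha>) = of_real (u powr (- \<alpha>))"
      unfolding ofu using u by (simp add: powr_of_real[symmetric])
    finally have "complex_of_real (h powr \<alpha>) * eval_fps (Abs_fps (kappa \<sigma> h \<omega>)) (exp (\<sigma> * complex_of_real h) * exp (- complex_of_real h))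
        = w (exp (- complex_of_real h)) * of_real (h powr \<alpha> * u powr (- \<alpha>))" by simp
    also have "h powr \<alpha> * u powr (- \<alpha>) = (u / h) powr (- \<alpha>)"
      using h u by (simp add: powr_divide powr_minus field_simps)
    also have "complex_of_real ((u / h) powr (- \<alpha>)) = of_real (u / h) powr (- of_real \<alpha>)"
      using h u powr_of_real[of "u / h" "- \<alpha>"] by simp
    finally show ?thesis using h by (simp add: quad_symbol_fun_def ofu)
  qed
  have "(\<lambda>h. norm (complex_of_real (h powr \<alpha>) * eval_fps (Abs_fps (kappa \<sigma> h \<omega>)) (exp (\<sigma> * complex_of_real h) * exp (- complex_of_real h)) - 1))
       \<in> O[at_right 0](\<lambda>h. h powr p) \<longleftrightarrow>
      (\<lambda>h. norm (quad_symbol_fun \<alpha> w (of_real h) - 1)) \<in> O[at_right 0](\<lambda>h. h powr p)"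
    by (rule landau_o.big.in_cong) (use eval in \<open>auto intro!: eventually_mono[OF eventually_at_right_less]\<close>)
  also have "\<dots> \<longleftrightarrow> (\<forall>l. real l < p \<longrightarrow> fps_nth (quad_symbol \<alpha> w - 1) l = 0)"
  proof (rule fps_expansion_bigo_powr_iff[of "\<lambda>z. quad_symbol_fun \<alpha> w z - 1"])
    show "(\<lambda>z. quad_symbol_fun \<alpha> w z - 1) has_fps_expansion quad_symbol \<alpha> w - 1"
      using gen by (intro has_fps_expansion_diff has_fps_expansion_1 quad_symbol_fun_has_fps_expansion)
                   (simp add: generating_form_def)
  qed
  finally show ?thesis
    unfolding consistent_quad_def using radius by (auto intro!: eventually_mono[OF eventually_at_right_less])
qed

text \<open>Stability amounts to \<omega> n = O(n powr (\<alpha> - 1)), which convergence implies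
  too; under this bound consistency and convergence are the same condition on
  \<open>quad_symbol\<close>.\<close>

theorem theorem4p12:
  fixes \<alpha> p T :: real and \<sigma> :: complex
    and \<omega> :: "nat \<Rightarrow> complex" and w :: "complex \<Rightarrow> complex"
  assumes "T > 0" and "generating_form \<alpha> \<omega> w"
  shows "stable_quad T \<alpha> \<sigma> \<omega> \<and> consistent_quad p \<alpha> \<sigma> \<omega> \<longleftrightarrow> convergent_quad p \<alpha> \<sigma> \<omega>"
  using stable_quad_iff[OF assms(1)] convergent_imp_poly_bounded
    consistent_quad_iff_symbol[OF assms(2)] convergent_quad_iff_symbol[OF assms(2)] by metis

end
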